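(* Let $F$ be a field and $A$ a finite subset of $\mathbb N$. The Ext-quiver of the algebra $(F\Pi_A,\wedge)$ is given by the Hasse diagram of the support lattice of the semigroup $(\Pi_A,\wedge)$; that is, it is isomorphic to the directed graph $(\Pi_A^<,\to)$.
   Context: For a finite subset $A$ of $\mathbb N=\{1,2,\ldots\}$, a set composition of $A$ is a tuple $P=(P_1,\ldots,P_l)$ of mutually disjoint non-empty subsets of $A$ with union $A$; its length is $\ell(P)=l$; $\Pi_A$ is the set of all set compositions of $A$ ($\Pi_\emptyset$ consists of the empty tuple). $\Pi_A$ is an idempotent semigroup with identity under $(P_1,\ldots,P_l)\wedge(Q_1,\ldots,Q_k)=(P_1\cap Q_1,\ldots,P_1\cap Q_k,\ldots,P_l\cap Q_1,\ldots,P_l\cap Q_k)$ with empty sets deleted, and $F\Pi_A$ is its semigroup algebra. On $\bigoplus_AF\Pi_A$ (over all finite $A\subset\mathbb N$), $\vee$ is the bilinear product with $P\vee Q=(P_1,\ldots,P_l,Q_1,\ldots,Q_k)$ for $P\in\Pi_A$, $Q\in\Pi_B$, $A\cap B=\emptyset$, and $P\vee Q=0$ if $A\cap B\ne\emptyset$. For $P,Q\in\Pi_A$, $Q\preceq P$ means that each component of $Q$ is contained in a component of $P$; $Q\approx P$ means that $Q$ is a rearrangement of the components of $P$ (equivalently $Q\preceq P$ and $P\preceq Q$). The support lattice of $(\Pi_A,\wedge)$ is the set of $\approx$-classes with the order induced by $\preceq$, i.e. the lattice of unordered set partitions of $A$ ordered by refinement. $\Pi_A^<=\{(Q_1,\ldots,Q_k)\in\Pi_A\mid\min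 Q_1<\cdots<\min Q_k\}$ is a transversal of the $\approx$-classes. For $P,Q\in\Pi_A^<$ write $P\to Q$ if $Q\preceq P$ and $\ell(Q)-\ell(P)=1$ (so $(\Pi_A^<,\to)$ is the Hasse diagram, with edges oriented from the coarser to the finer partition). For non-empty finite $B$: $e_B=\sum_P(-1)^{\ell(P)-1}P$, the sum over all $P=(P_1,\ldots,P_l)\in\Pi_B$ with $\min B\in P_1$. For $Q=(Q_1,\ldots,Q_k)\in\Pi_A$, $e_Q=e_{Q_1}\vee\cdots\vee e_{Q_k}$ (the empty tuple if $k=0$), $\Lambda_Q=F\Pi_A\wedge e_Q$ (left ideal), and $M_Q=\Lambda_Q/\mathrm{rad}_{F\Pi_A}\Lambda_Q$, where $\mathrm{rad}_{F\Pi_A}$ denotes the intersection of all maximal submodules. The $\Lambda_Q$ and the one-dimensional modules $M_Q$ ($Q\in\Pi_A^<$) represent the principal indecomposable and the irreducible left $F\Pi_A$-modules. The Ext-quiver of $F\Pi_A$ has the irreducible modules $M_Q$, $Q\in\Pi_A^<$, as vertices, and the number of arrows from $M_P$ to $M_Q$ is the multiplicity of $M_P$ in the first Loewy layer $\mathrm{rad}_{F\Pi_A}\Lambda_Q/\mathrm{rad}_{F\Pi_A}(\mathrm{rad}_{F\Pi_A}\Lambda_Q)$ of $\Lambda_Q$. *)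

theory Defs
  imports
    "HOL-Algebra.Module"
    "HOL-Algebra.AbelCoset"
    "HOL-Library.Poly_Mapping"
    "HOL-Library.Multiset"
    "HOL-Library.Disjoint_Sets"
    "Graph_Theory.Digraph_Isomorphism"
begin

section \<open>Left modules over a not necessarily commutative ring\<close>

text \<open>
  The locale \<^locale>\<open>module\<close> is restricted to commutative rings, but its record type and the
  locale \<^locale>\<open>submodule\<close> (additive subgroup closed under scalars) are not; they are reused
  here for left modules. The fields \<open>mult\<close> and \<open>one\<close> of a module record play no role.
\<close>

abbreviation sub_module :: "('r, 'm) module \<Rightarrow> 'm set \<Rightarrow> ('r, 'm) module" where
  "sub_module M N \<equiv> M\<lparr>carrier := N\<rparr>"

definition quot_module :: "('r, 'm) module \<Rightarrow> 'm set \<Rightarrow> ('r, 'm set) module" where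
  "quot_module M N =
    \<lparr>carrier = a_rcosets\<^bsub>M\<^esub> N, monoid.mult = undefined, one = undefined,
     zero = N, add = set_add M,
     smult = (\<lambda>r X. \<Union>x\<in>X. N +>\<^bsub>M\<^esub> (r \<odot>\<^bsub>M\<^esub> x))\<rparr>"

definition module_iso ::
    "('r, 'k) ring_scheme \<Rightarrow> ('r, 'm) module \<Rightarrow> ('r, 'n) module \<Rightarrow> bool" where
  "module_iso R M N \<longleftrightarrow>
    (\<exists>f \<in> iso (add_monoid M) (add_monoid N).
       \<forall>r\<in>carrier R. \<forall>x\<in>carrier M. f (r \<odot>\<^bsub>M\<^esub> x) = r \<odot>\<^bsub>N\<^esub> f x)"

definition irreducible_module :: "('r, 'k) ring_scheme \<Rightarrow> ('r, 'm) module \<Rightarrow> bool" where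
  "irreducible_module R M \<longleftrightarrow>
    carrier M \<noteq> {\<zero>\<^bsub>M\<^esub>} \<and>
    (\<forall>N. submodule N R M \<longrightarrow> N = {\<zero>\<^bsub>M\<^esub>} \<or> N = carrier M)"

definition maximal_submodule ::
    "('r, 'k) ring_scheme \<Rightarrow> ('r, 'm) module \<Rightarrow> 'm set \<Rightarrow> bool" where
  "maximal_submodule R M N \<longleftrightarrow>
    submodule N R M \<and> N \<noteq> carrier M \<and>
    (\<forall>N'. submodule N' R M \<and> N \<subseteq> N' \<longrightarrow> N' = N \<or> N' = carrier M)"

text \<open>Intersecting with the carrier matters only if there is no maximal submodule, as for
  the zero module, whose radical is thus zero.\<close>

definition module_rad :: "('r, 'k) ring_scheme \<Rightarrow> ('r, 'm) module \<Rightarrow> 'm set" where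
  "module_rad R M = carrier M \<inter> \<Inter>{N. maximal_submodule R M N}"

definition composition_series ::
    "('r, 'k) ring_scheme \<Rightarrow> ('r, 'm) module \<Rightarrow> 'm set list \<Rightarrow> bool" where
  "composition_series R M Vs \<longleftrightarrow>
    Vs \<noteq> [] \<and> hd Vs = {\<zero>\<^bsub>M\<^esub>} \<and> last Vs = carrier M \<and>
    (\<forall>V\<in>set Vs. submodule V R M) \<and>
    (\<forall>i. Suc i < length Vs \<longrightarrow>
       Vs ! i \<subseteq> Vs ! Suc i \<and>
       irreducible_module R (quot_module (sub_module M (Vs ! Suc i)) (Vs ! i)))"

text \<open>Jordan--Hoelder multiplicity of an irreducible module \<open>S\<close> in a module \<open>M\<close> of finite
  length.\<close>

definition multiplicity_in ::
    "('r, 'k) ring_scheme \<Rightarrow> ('r, 's) module \<Rightarrow> ('r, 'm) module \<Rightarrow> nat" where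
  "multiplicity_in R S M =
    (THE n. \<exists>Vs. composition_series R M Vs \<and>
       n = card {i. Suc i < length Vs \<and>
                    module_iso R S (quot_module (sub_module M (Vs ! Suc i)) (Vs ! i))})"

definition first_Loewy_layer ::
    "('r, 'k) ring_scheme \<Rightarrow> ('r, 'm) module \<Rightarrow> ('r, 'm set) module" where
  "first_Loewy_layer R M =
    (let J = sub_module M (module_rad R M) in quot_module J (module_rad R J))"


section \<open>Set compositions\<close>

definition set_compositions :: "nat set \<Rightarrow> nat set list set" where
  "set_compositions A = {P. distinct P \<and> partition_on A (set P)}"

definition meet :: "nat set list \<Rightarrow> nat set list \<Rightarrow> nat set list" where
  "meet P Q = filter (\<lambda>X. X \<noteq> {}) [X \<inter> Y. X \<leftarrow> P, Y \<leftarrow> Q]"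

definition finer :: "nat set \<Rightarrow> nat set list \<Rightarrow> nat set list \<Rightarrow> bool" where
  "finer A Q P \<longleftrightarrow> refines A (set Q) (set P)"

definition rearrangement_rel :: "nat set \<Rightarrow> (nat set list \<times> nat set list) set" where
  "rearrangement_rel A =
    {(Q, P). Q \<in> set_compositions A \<and> P \<in> set_compositions A \<and> mset Q = mset P}"

definition support_lattice :: "nat set \<Rightarrow> nat set list set gorder" where
  "support_lattice A =
    \<lparr>carrier = set_compositions A // rearrangement_rel A, eq = (=),
     le = (\<lambda>X Y. \<exists>Q\<in>X. \<exists>P\<in>Y. finer A Q P)\<rparr>"

text \<open>The edges point downwards, from an element to the elements it covers.\<close>

definition hasse_diagram :: "('a, 'k) gorder_scheme \<Rightarrow> ('a, 'a \<times> 'a) pre_digraph" where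
  "hasse_diagram L =
    \<lparr>verts = carrier L,
     arcs = {(x, y). x \<in> carrier L \<and> y \<in> carrier L \<and> y \<sqsubset>\<^bsub>L\<^esub> x \<and>
                     \<not> (\<exists>z\<in>carrier L. y \<sqsubset>\<^bsub>L\<^esub> z \<and> z \<sqsubset>\<^bsub>L\<^esub> x)},
     tail = fst, head = snd\<rparr>"

definition ordered_compositions :: "nat set \<Rightarrow> nat set list set" where
  "ordered_compositions A = {Q \<in> set_compositions A. sorted_wrt (<) (map Min Q)}"

definition ordered_composition_digraph ::
    "nat set \<Rightarrow> (nat set list, nat set list \<times> nat set list) pre_digraph" where
  "ordered_composition_digraph A =
    \<lparr>verts = ordered_compositions A,
     arcs = {(P, Q). P \<in> ordered_compositions A \<and> Q \<in> ordered_compositions A \<and>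
                     finer A Q P \<and> length Q = length P + 1},
     tail = fst, head = snd\<rparr>"


section \<open>The semigroup algebra and its modules\<close>

text \<open>
  The direct sum of all \<open>F\<Pi>\<^sub>A\<close> lives in the finitely supported functions on
  lists of sets: the sets \<^term>\<open>set_compositions A\<close> are mutually disjoint, and \<open>F\<Pi>\<^sub>A\<close>
  consists of the functions supported in \<^term>\<open>set_compositions A\<close>.
\<close>

type_synonym 'f combination = "nat set list \<Rightarrow>\<^sub>0 'f"

definition wedge :: "'f::field combination \<Rightarrow> 'f combination \<Rightarrow> 'f combination" where
  "wedge x y =
    (\<Sum>P\<in>Poly_Mapping.keys x. \<Sum>Q\<in>Poly_Mapping.keys y.
       Poly_Mapping.single (meet P Q) (Poly_Mapping.lookup x P * Poly_Mapping.lookup y Q))"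

definition vee :: "'f::field combination \<Rightarrow> 'f combination \<Rightarrow> 'f combination" where
  "vee x y =
    (\<Sum>P\<in>Poly_Mapping.keys x. \<Sum>Q\<in>Poly_Mapping.keys y.
       if \<Union>(set P) \<inter> \<Union>(set Q) = {}
       then Poly_Mapping.single (P @ Q) (Poly_Mapping.lookup x P * Poly_Mapping.lookup y Q)
       else 0)"

text \<open>Both the algebra \<open>F\<Pi>\<^sub>A\<close> and its left regular module.\<close>

definition comp_algebra :: "nat set \<Rightarrow> ('f::field combination, 'f combination) module" where
  "comp_algebra A =
    \<lparr>carrier = {x. Poly_Mapping.keys x \<subseteq> set_compositions A}, monoid.mult = wedge,
     one = Poly_Mapping.single (if A = {} then [] else [A]) 1, zero = 0, add = (+),
     smult = wedge\<rparr>"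

definition e_set :: "nat set \<Rightarrow> 'f::field combination" where
  "e_set B =
    (\<Sum>P \<in> {P \<in> set_compositions B. Min B \<in> hd P}.
       Poly_Mapping.single P ((-1) ^ (length P - 1)))"

definition e_comp :: "nat set list \<Rightarrow> 'f::field combination" where
  "e_comp Q = foldr (\<lambda>B x. vee (e_set B) x) Q (Poly_Mapping.single [] 1)"

definition Lambda_module ::
    "nat set \<Rightarrow> nat set list \<Rightarrow> ('f::field combination, 'f combination) module" where
  "Lambda_module A Q =
    sub_module (comp_algebra A) ((\<lambda>x. wedge x (e_comp Q)) ` carrier (comp_algebra A))"

definition M_module ::
    "nat set \<Rightarrow> nat set list \<Rightarrow> ('f::field combination, 'f combination set) module" where
  "M_module A Q =
    quot_module (Lambda_module A Q) (module_rad (comp_algebra A) (Lambda_module A Q))"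

text \<open>The arrows from \<open>M\<^sub>P\<close> to \<open>M\<^sub>Q\<close> are the triples \<open>(M\<^sub>P, M\<^sub>Q, i)\<close>, with \<open>i\<close> below the
  multiplicity of \<open>M\<^sub>P\<close> in the first Loewy layer of \<open>\<Lambda>\<^sub>Q\<close>. The first argument only fixes
  the field.\<close>

definition ext_quiver ::
    "'f::field itself \<Rightarrow> nat set \<Rightarrow>
     (('f combination, 'f combination set) module,
      ('f combination, 'f combination set) module \<times>
      ('f combination, 'f combination set) module \<times> nat) pre_digraph" where
  "ext_quiver F A =
    \<lparr>verts = M_module A ` ordered_compositions A,
     arcs = {(M_module A P, M_module A Q, i) | P Q i.
       P \<in> ordered_compositions A \<and> Q \<in> ordered_compositions A \<and>
       i < multiplicity_in (comp_algebra A :: ('f combination, 'f combination) module)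
             (M_module A P) (first_Loewy_layer (comp_algebra A) (Lambda_module A Q))},
     tail = fst, head = (\<lambda>a. fst (snd a))\<rparr>"

end

theory Submission
  imports Defs
begin

text \<open>
  Fix a composition \<open>Q\<close> of \<open>A\<close>. The module
  \<open>\<Lambda>\<^sub>Q\<close> has the vectors \<open>e\<^sub>w\<close> as a basis, where
  \<open>w\<close> runs through the rearrangements of \<open>Q\<close>, and a composition
  \<open>P\<close> maps \<open>e\<^sub>w\<close> to \<open>e\<^bsub>P \<and> w\<^esub>\<close> if
  \<open>Q\<close> refines \<open>P\<close>, and to \<open>0\<close> otherwise
  (\<open>act_e_comp_refined\<close>, \<open>act_e_comp_not_refined\<close>). The vanishing is what
  the alternating signs in \<open>e\<^sub>Q\<close> are for; it comes from a sign-reversing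
  involution. The basis property holds because \<open>e\<^sub>w\<close> is \<open>w\<close> plus
  longer compositions (\<open>lookup_e_comp\<close>). So \<open>\<Lambda>\<^sub>Q\<close> is spanned
  by the words in the blocks of \<open>Q\<close>, and \<open>P\<close> sorts a word stably according
  to the blocks of \<open>P\<close>.

  Sorting by \<open>w\<close> itself maps every word to \<open>w\<close>. Hence a vector whose
  coordinates do not sum to zero generates \<open>\<Lambda>\<^sub>Q\<close>, and the kernel
  \<open>K\<close> of the coordinate sum is the radical (\<open>module_rad_\<Lambda>\<close>). The
  quotient \<open>M\<^sub>Q\<close> is one-dimensional with character
  \<open>P \<mapsto> [Q refines P]\<close>, which determines the partition underlying
  \<open>Q\<close>.

  For two blocks \<open>a\<close>, \<open>b\<close> of \<open>Q\<close> consider the functional that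
  adds up the coordinates of the words with \<open>a\<close> before \<open>b\<close>. Stable sorting
  keeps the order of \<open>a\<close> and \<open>b\<close> if they lie in the same block of
  \<open>P\<close>, and prescribes it otherwise; hence on \<open>K\<close> this functional is
  equivariant for the character of the partition obtained from \<open>Q\<close> by merging
  \<open>a\<close> and \<open>b\<close> (\<open>order_coord_act\<close>), and its kernel is a
  maximal submodule of \<open>K\<close>. There are no other maximal submodules: \<open>K\<close> is
  spanned by differences of words that differ by an adjacent transposition, and the composition
  obtained from such a word by merging the two letters maps \<open>K\<close> onto the line of that
  difference (\<open>merged_face_act\<close>, \<open>maximal_submodule_K_module\<close>). Therefore
  the first Loewy layer \<open>K / rad K\<close> is the direct sum of the one-dimensional modules of
  the partitions that cover \<open>Q\<close>, each occurring once
  (\<open>multiplicity_layer\<close>).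

  Finally, a partition covers \<open>Q\<close> if and only if it is coarser with exactly one block
  less (\<open>merge_iff_finer\<close>, \<open>covers_support_lattice\<close>), which identifies the
  quiver with the digraph of ordered compositions and with the Hasse diagram of
  the support lattice.
\<close>

section \<open>Modules over a set of operators and one-dimensional modules\<close>

text \<open>
  An abelian group with operators. Submodules, radicals, composition series and isomorphisms only
  see how the elements of \<open>R\<close> act, which makes this the natural generality for them.
\<close>
locale operator_module = abelian_group M
  for R :: "('r, 'k) ring_scheme" and M :: "('r, 'm) module" (structure) +
  assumes smult_closed [simp, intro]:
      "\<lbrakk>r \<in> carrier R; x \<in> carrier M\<rbrakk> \<Longrightarrow> r \<odot> x \<in> carrier M"
    and smult_r_distr:
      "\<lbrakk>r \<in> carrier R; x \<in> carrier M; y \<in> carrier M\<rbrakk> \<Longrightarrow> r \<odot> (x \<oplus> y) = r \<odot> x \<oplus> r \<odot> y"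
begin

lemma submoduleI:
  assumes "N \<subseteq> carrier M" "\<zero> \<in> N" "\<And>x. x \<in> N \<Longrightarrow> \<ominus> x \<in> N"
    "\<And>x y. \<lbrakk>x \<in> N; y \<in> N\<rbrakk> \<Longrightarrow> x \<oplus> y \<in> N"
    "\<And>r x. \<lbrakk>r \<in> carrier R; x \<in> N\<rbrakk> \<Longrightarrow> r \<odot> x \<in> N"
  shows "submodule N R M"
  using assms by (intro submodule.intro subgroup.intro submodule_axioms.intro) (auto simp: a_inv_def)

lemma submoduleD:
  assumes "submodule N R M"
  shows "N \<subseteq> carrier M" "\<zero> \<in> N" "x \<in> N \<Longrightarrow> \<ominus> x \<in> N"
    "\<lbrakk>x \<in> N; y \<in> N\<rbrakk> \<Longrightarrow> x \<oplus> y \<in> N" "\<lbrakk>x \<in> N; y \<in> N\<rbrakk> \<Longrightarrow> x \<ominus> y \<in> N"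
    "\<lbrakk>r \<in> carrier R; x \<in> N\<rbrakk> \<Longrightarrow> r \<odot> x \<in> N"
proof -
  interpret N: submodule N R M by fact
  show "N \<subseteq> carrier M" using N.subset by simp
  show "\<zero> \<in> N" using N.one_closed by simp
  show inv: "\<ominus> x \<in> N" if "x \<in> N" for x using N.m_inv_closed that by (simp add: a_inv_def)
  show add: "x \<oplus> y \<in> N" if "x \<in> N" "y \<in> N" for x y using N.m_closed that by simp
  show "x \<ominus> y \<in> N" if "x \<in> N" "y \<in> N" using inv add that by (simp add: a_minus_def)
qed (rule submodule.smult_closed[OF assms])

lemma sub_module_operator_module:
  assumes "submodule N R M"
  shows "operator_module R (sub_module M N)"
proof -
  note D = submoduleD[OF assms]
  have "abelian_group (sub_module M N)"
  proof (rule abelian_groupI)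
    fix x assume "x \<in> carrier (sub_module M N)"
    then show "\<exists>y\<in>carrier (sub_module M N). y \<oplus>\<^bsub>sub_module M N\<^esub> x = \<zero>\<^bsub>sub_module M N\<^esub>"
      using D(1,3) by (auto intro!: bexI[of _ "\<ominus> x"] l_neg)
  qed (use D in \<open>auto simp: a_ac subset_iff\<close>)
  then show ?thesis
    using D by (auto intro!: operator_module.intro operator_module_axioms.intro
        simp: smult_r_distr subset_iff)
qed

lemma abelian_subgroup_submodule:
  assumes "submodule N R M" shows "abelian_subgroup N M"
  using submodule.axioms(1)[OF assms] additive_subgroupI abelian_group_axioms
  by (intro abelian_subgroupI3)

lemma mem_coset_iff:
  assumes "submodule N R M" "x \<in> carrier M"
  shows "y \<in> N +> x \<longleftrightarrow> y \<in> carrier M \<and> y \<ominus> x \<in> N"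
proof
  assume "y \<in> N +> x"
  then obtain n where n: "n \<in> N" "y = n \<oplus> x" by (auto simp: a_r_coset_def')
  with submoduleD(1)[OF assms(1)] assms(2) show "y \<in> carrier M \<and> y \<ominus> x \<in> N"
    by (auto simp: a_minus_def a_assoc r_neg)
next
  assume y: "y \<in> carrier M \<and> y \<ominus> x \<in> N"
  then have "y = (y \<ominus> x) \<oplus> x" using assms(2) by (simp add: a_minus_def a_assoc l_neg)
  with y show "y \<in> N +> x" by (auto simp: a_r_coset_def')
qed

lemma coset_self: "\<lbrakk>submodule N R M; x \<in> carrier M\<rbrakk> \<Longrightarrow> x \<in> N +> x"
  using submoduleD(2) by (simp add: mem_coset_iff a_minus_def r_neg)

lemma minus_add_self: "\<lbrakk>x \<in> carrier M; y \<in> carrier M\<rbrakk> \<Longrightarrow> x \<ominus> y \<oplus> y = x"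
  by (simp add: a_minus_def a_assoc l_neg)

lemma coset_eq_iff:
  assumes "submodule N R M" "x \<in> carrier M" "y \<in> carrier M"
  shows "N +> x = N +> y \<longleftrightarrow> x \<ominus> y \<in> N"
proof
  assume "N +> x = N +> y"
  moreover have "x \<in> N +> x" using assms by (intro coset_self)
  ultimately show "x \<ominus> y \<in> N" using assms by (simp add: mem_coset_iff)
next
  assume "x \<ominus> y \<in> N"
  with assms have "x \<in> N +> y" by (simp add: mem_coset_iff)
  then show "N +> x = N +> y"
    using a_repr_independence[of x N y] assms submodule.axioms(1)[OF assms(1)] by metis
qed

lemma carrier_quot_module: "carrier (quot_module M N) = (\<lambda>x. N +> x) ` carrier M"
  by (auto simp: quot_module_def A_RCOSETS_def')

lemma coset_zero: "submodule N R M \<Longrightarrow> N +> \<zero> = N"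
  using submoduleD(1) by (simp add: a_coset_add_zero)

lemma zero_quot_module: "submodule N R M \<Longrightarrow> \<zero>\<^bsub>quot_module M N\<^esub> = N +> \<zero>"
  by (simp add: quot_module_def coset_zero)

lemma add_quot_module:
  assumes "submodule N R M" "x \<in> carrier M" "y \<in> carrier M"
  shows "(N +> x) \<oplus>\<^bsub>quot_module M N\<^esub> (N +> y) = N +> (x \<oplus> y)"
  using abelian_subgroup.a_rcos_sum[OF abelian_subgroup_submodule[OF assms(1)]] assms(2,3)
  by (simp add: quot_module_def)

lemma smult_quot_module:
  assumes "submodule N R M" "r \<in> carrier R" "x \<in> carrier M"
  shows "r \<odot>\<^bsub>quot_module M N\<^esub> (N +> x) = N +> (r \<odot> x)"
proof -
  note D = submoduleD[OF assms(1)]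
  have "N +> (r \<odot> y) = N +> (r \<odot> x)" if y: "y \<in> N +> x" for y
  proof -
    obtain n where n: "n \<in> N" "y = n \<oplus> x" using y by (auto simp: a_r_coset_def')
    then have nM: "n \<in> carrier M" using D(1) by blast
    then have "r \<odot> y \<ominus> r \<odot> x = r \<odot> n"
      using assms(2,3) n(2) by (simp add: smult_r_distr a_minus_def a_assoc r_neg)
    then have "r \<odot> y \<ominus> r \<odot> x \<in> N" using D(6)[OF assms(2) n(1)] by simp
    moreover have "r \<odot> y \<in> carrier M" using n(2) nM assms(2,3) by simp
    ultimately show ?thesis
      using assms by (simp add: coset_eq_iff)
  qed
  moreover have "x \<in> N +> x" using assms by (intro coset_self)
  ultimately have "(\<Union>y\<in>N +> x. N +> (r \<odot> y)) = N +> (r \<odot> x)" by blast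
  then show ?thesis by (simp add: quot_module_def)
qed

lemma quot_module_operator_module:
  assumes N: "submodule N R M"
  shows "operator_module R (quot_module M N)"
proof (intro operator_module.intro operator_module_axioms.intro abelian_groupI)
  let ?Q = "quot_module M N"
  note simps = carrier_quot_module add_quot_module[OF N] smult_quot_module[OF N]
  note zero = zero_quot_module[OF N]
  have add: "\<And>x y. \<lbrakk>x \<in> carrier M; y \<in> carrier M\<rbrakk> \<Longrightarrow> N +> (x \<oplus> y) \<in> carrier ?Q"
    unfolding carrier_quot_module by blast
  show "\<zero>\<^bsub>?Q\<^esub> \<in> carrier ?Q" unfolding zero carrier_quot_module by blast
  fix X assume "X \<in> carrier ?Q"
  then obtain x where x: "x \<in> carrier M" "X = N +> x" unfolding carrier_quot_module by blast
  show "\<zero>\<^bsub>?Q\<^esub> \<oplus>\<^bsub>?Q\<^esub> X = X"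
    using x(1) unfolding zero x(2) by (subst add_quot_module[OF N]) simp_all
  show "\<exists>Y\<in>carrier ?Q. Y \<oplus>\<^bsub>?Q\<^esub> X = \<zero>\<^bsub>?Q\<^esub>"
  proof (rule bexI)
    show "(N +> \<ominus> x) \<oplus>\<^bsub>?Q\<^esub> X = \<zero>\<^bsub>?Q\<^esub>"
      using x(1) unfolding zero x(2) by (subst add_quot_module[OF N]) (simp_all add: l_neg)
  qed (use x(1) in \<open>auto simp: carrier_quot_module\<close>)
  show "r \<odot>\<^bsub>?Q\<^esub> X \<in> carrier ?Q" if "r \<in> carrier R" for r
    using that x(1) unfolding x(2) smult_quot_module[OF N that x(1)] carrier_quot_module by blast
  fix Y assume "Y \<in> carrier ?Q"
  then obtain y where y: "y \<in> carrier M" "Y = N +> y" unfolding carrier_quot_module by blast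
  show "X \<oplus>\<^bsub>?Q\<^esub> Y \<in> carrier ?Q"
    unfolding x(2) y(2) add_quot_module[OF N x(1) y(1)] using x(1) y(1) by (rule add)
  show "X \<oplus>\<^bsub>?Q\<^esub> Y = Y \<oplus>\<^bsub>?Q\<^esub> X"
    using x(1) y(1) unfolding x(2) y(2) by (simp add: add_quot_module[OF N] a_comm)
  show "r \<odot>\<^bsub>?Q\<^esub> (X \<oplus>\<^bsub>?Q\<^esub> Y) = r \<odot>\<^bsub>?Q\<^esub> X \<oplus>\<^bsub>?Q\<^esub> r \<odot>\<^bsub>?Q\<^esub> Y" if "r \<in> carrier R" for r
    using that x(1) y(1) unfolding x(2) y(2)
    by (simp add: add_quot_module[OF N] smult_quot_module[OF N] smult_r_distr)
  fix Z assume "Z \<in> carrier ?Q"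
  then obtain z where z: "z \<in> carrier M" "Z = N +> z" unfolding carrier_quot_module by blast
  show "X \<oplus>\<^bsub>?Q\<^esub> Y \<oplus>\<^bsub>?Q\<^esub> Z = X \<oplus>\<^bsub>?Q\<^esub> (Y \<oplus>\<^bsub>?Q\<^esub> Z)"
    using x(1) y(1) z(1) unfolding x(2) y(2) z(2) by (simp add: add_quot_module[OF N] a_assoc)
qed

text \<open>
  One half of the correspondence theorem: the image of \<open>N\<close> in the quotient is a
  submodule.
\<close>
lemma irreducible_quot_module_between:
  assumes V: "submodule V R M" and N: "submodule N R M" and "V \<subseteq> N"
    and irred: "irreducible_module R (quot_module M V)"
  shows "N = V \<or> N = carrier M"
proof -
  interpret Q: operator_module R "quot_module M V" by (rule quot_module_operator_module[OF V])
  note D = submoduleD[OF N]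
  have inN: "x \<in> carrier M" if "x \<in> N" for x using that D(1) by blast
  have "submodule ((\<lambda>x. V +> x) ` N) R (quot_module M V)"
  proof (rule Q.submoduleI)
    show "(\<lambda>x. V +> x) ` N \<subseteq> carrier (quot_module M V)"
      unfolding carrier_quot_module using D(1) by (rule image_mono)
    show "\<zero>\<^bsub>quot_module M V\<^esub> \<in> (\<lambda>x. V +> x) ` N"
      unfolding zero_quot_module[OF V] using D(2) by (rule imageI)
    fix X assume "X \<in> (\<lambda>x. V +> x) ` N"
    then obtain x where x: "x \<in> N" "X = V +> x" by blast
    have "(V +> \<ominus> x) \<oplus>\<^bsub>quot_module M V\<^esub> (V +> x) = \<zero>\<^bsub>quot_module M V\<^esub>"
      unfolding zero_quot_module[OF V] using inN[OF x(1)]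
      by (subst add_quot_module[OF V]) (simp_all add: l_neg)
    then have "\<ominus>\<^bsub>quot_module M V\<^esub> X = V +> \<ominus> x"
      using inN[OF x(1)] unfolding x(2) by (intro Q.minus_equality) (auto simp: carrier_quot_module)
    then show "\<ominus>\<^bsub>quot_module M V\<^esub> X \<in> (\<lambda>x. V +> x) ` N"
      using D(3)[OF x(1)] by auto
    show "r \<odot>\<^bsub>quot_module M V\<^esub> X \<in> (\<lambda>x. V +> x) ` N" if "r \<in> carrier R" for r
      unfolding x(2) smult_quot_module[OF V that inN[OF x(1)]] using D(6)[OF that x(1)] by (rule imageI)
    fix Y assume "Y \<in> (\<lambda>x. V +> x) ` N"
    then obtain y where y: "y \<in> N" "Y = V +> y" by blast
    show "X \<oplus>\<^bsub>quot_module M V\<^esub> Y \<in> (\<lambda>x. V +> x) ` N"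
      unfolding x(2) y(2) add_quot_module[OF V inN[OF x(1)] inN[OF y(1)]]
      using D(4)[OF x(1) y(1)] by (rule imageI)
  qed
  then consider "(\<lambda>x. V +> x) ` N = {V +> \<zero>}" | "(\<lambda>x. V +> x) ` N = (\<lambda>x. V +> x) ` carrier M"
    using irred unfolding irreducible_module_def zero_quot_module[OF V] carrier_quot_module by blast
  then show ?thesis
  proof cases
    case 1
    have "x \<in> V" if "x \<in> N" for x
    proof -
      have "V +> x = V +> \<zero>" using 1 that by blast
      then show ?thesis using coset_self[OF V inN[OF that]] coset_zero[OF V] by simp
    qed
    then show ?thesis using \<open>V \<subseteq> N\<close> by auto
  next
    case 2
    have "x \<in> N" if x: "x \<in> carrier M" for x
    proof -
      obtain y where y: "y \<in> N" "V +> x = V +> y" using 2 x by blast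
      then have "x \<ominus> y \<in> N" using x inN[OF y(1)] coset_eq_iff[OF V] \<open>V \<subseteq> N\<close> by blast
      then have "(x \<ominus> y) \<oplus> y \<in> N" using y(1) D(4) by blast
      then show ?thesis using x inN[OF y(1)] by (simp add: a_minus_def a_assoc l_neg)
    qed
    then show ?thesis using D(1) by auto
  qed
qed

end

lemma a_r_coset_sub_module [simp]: "a_r_coset (sub_module M V) = a_r_coset M"
  by (intro ext) (simp add: a_r_coset_def')

lemma module_iso_sym:
  assumes "module_iso R M N" and "operator_module R M"
  shows "module_iso R N M"
proof -
  interpret M: operator_module R M by fact
  obtain f where f: "f \<in> iso (add_monoid M) (add_monoid N)"
      "\<And>r x. \<lbrakk>r \<in> carrier R; x \<in> carrier M\<rbrakk> \<Longrightarrow> f (r \<odot>\<^bsub>M\<^esub> x) = r \<odot>\<^bsub>N\<^esub> f x"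
    using assms(1) by (auto simp: module_iso_def)
  have bij: "bij_betw f (carrier M) (carrier N)" using f(1) by (simp add: iso_def)
  have "inv_into (carrier M) f \<in> iso (add_monoid N) (add_monoid M)"
    using group.iso_set_sym[OF M.a_group f(1)] by simp
  moreover have "inv_into (carrier M) f (r \<odot>\<^bsub>N\<^esub> y) = r \<odot>\<^bsub>M\<^esub> inv_into (carrier M) f y"
    if "r \<in> carrier R" "y \<in> carrier N" for r y
  proof -
    have "y \<in> f ` carrier M" using bij that by (simp add: bij_betw_def)
    then obtain x where "x \<in> carrier M" "y = f x" by blast
    then show ?thesis
      using f(2)[of r x, symmetric] that bij by (auto simp: bij_betw_def)
  qed
  ultimately show ?thesis unfolding module_iso_def by blast
qed

lemma module_iso_trans:
  assumes "module_iso R M N" and "module_iso R N K"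
  shows "module_iso R M K"
proof -
  obtain f g where f: "f \<in> iso (add_monoid M) (add_monoid N)"
      "\<And>r x. \<lbrakk>r \<in> carrier R; x \<in> carrier M\<rbrakk> \<Longrightarrow> f (r \<odot>\<^bsub>M\<^esub> x) = r \<odot>\<^bsub>N\<^esub> f x"
    and g: "g \<in> iso (add_monoid N) (add_monoid K)"
      "\<And>r x. \<lbrakk>r \<in> carrier R; x \<in> carrier N\<rbrakk> \<Longrightarrow> g (r \<odot>\<^bsub>N\<^esub> x) = r \<odot>\<^bsub>K\<^esub> g x"
    using assms by (auto simp: module_iso_def)
  have "f x \<in> carrier N" if "x \<in> carrier M" for x
    using f(1) that by (auto simp: iso_def bij_betw_def)
  then show ?thesis
    unfolding module_iso_def using f g iso_set_trans[OF f(1) g(1)]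
    by (auto intro!: bexI[of _ "g \<circ> f"])
qed

text \<open>
  The one-dimensional module of a character \<open>\<chi>\<close>; up to isomorphism, all
  irreducible modules met here have this form.
\<close>
definition char_module :: "('r \<Rightarrow> 'f::field) \<Rightarrow> ('r, 'f) module" where
  "char_module \<chi> = \<lparr>carrier = UNIV, monoid.mult = (*), one = 1, zero = 0, add = (+),
     smult = (\<lambda>r x. \<chi> r * x)\<rparr>"

lemma char_module_simps [simp]:
  "carrier (char_module \<chi>) = UNIV" "zero (char_module \<chi>) = 0" "add (char_module \<chi>) = (+)"
  "smult (char_module \<chi>) r x = \<chi> r * x"
  by (simp_all add: char_module_def)

lemma operator_module_char_module: "operator_module R (char_module \<chi>)"
proof (intro operator_module.intro operator_module_axioms.intro abelian_groupI)
  fix x show "\<exists>y\<in>carrier (char_module \<chi>). y \<oplus>\<^bsub>char_module \<chi>\<^esub> x = \<zero>\<^bsub>char_module \<chi>\<^esub>"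
    by (auto intro!: exI[of _ "- x"])
qed (auto simp: algebra_simps)

lemma module_iso_char_moduleD:
  assumes "operator_module R M" "module_iso R M (char_module \<chi>)"
  obtains f where "bij_betw f (carrier M) UNIV"
    "\<And>r x. \<lbrakk>r \<in> carrier R; x \<in> carrier M\<rbrakk> \<Longrightarrow> f (r \<odot>\<^bsub>M\<^esub> x) = \<chi> r * f x"
    "\<And>x. x \<in> carrier M \<Longrightarrow> f x = 0 \<longleftrightarrow> x = \<zero>\<^bsub>M\<^esub>"
proof -
  interpret M: operator_module R M by fact
  interpret K: operator_module R "char_module \<chi>" by (rule operator_module_char_module)
  obtain f where f: "f \<in> iso (add_monoid M) (add_monoid (char_module \<chi>))"
      "\<And>r x. \<lbrakk>r \<in> carrier R; x \<in> carrier M\<rbrakk> \<Longrightarrow> f (r \<odot>\<^bsub>M\<^esub> x) = \<chi> r * f x"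
    using assms(2) by (auto simp: module_iso_def)
  have bij: "bij_betw f (carrier M) UNIV" using f(1) by (auto simp: iso_def)
  have "f \<zero>\<^bsub>M\<^esub> = 0"
    using hom_one[OF _ M.a_group K.a_group, of f] f(1) by (auto simp: iso_def)
  then have "f x = 0 \<longleftrightarrow> x = \<zero>\<^bsub>M\<^esub>" if "x \<in> carrier M" for x
    using bij that M.zero_closed by (metis bij_betw_def inj_onD)
  then show ?thesis using that bij f(2) by blast
qed

lemma (in operator_module) submodule_sub_module:
  assumes V: "submodule V R M" and W: "submodule W R M" and "V \<subseteq> W"
  shows "submodule V R (sub_module M W)"
proof -
  interpret W: operator_module R "sub_module M W" by (rule sub_module_operator_module[OF W])
  show ?thesis
  proof (rule W.submoduleI)
    fix x assume x: "x \<in> V"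
    have "\<ominus>\<^bsub>sub_module M W\<^esub> x = \<ominus> x"
      using x submoduleD(1,3)[OF V] \<open>V \<subseteq> W\<close> l_neg by (intro W.minus_equality) auto
    then show "\<ominus>\<^bsub>sub_module M W\<^esub> x \<in> V" using submoduleD(3)[OF V x] by simp
  qed (use submoduleD[OF V] \<open>V \<subseteq> W\<close> in auto)
qed

text \<open>
  Since \<open>\<chi>\<close> takes every value, a single non-zero vector generates the module.
\<close>
lemma irreducible_module_char:
  assumes M: "operator_module R M" and iso: "module_iso R M (char_module \<chi>)"
    and onto: "\<And>a. \<exists>r\<in>carrier R. \<chi> r = a"
  shows "irreducible_module R M"
proof -
  interpret M: operator_module R M by fact
  obtain f where f: "bij_betw f (carrier M) UNIV"
    "\<And>r x. \<lbrakk>r \<in> carrier R; x \<in> carrier M\<rbrakk> \<Longrightarrow> f (r \<odot>\<^bsub>M\<^esub> x) = \<chi> r * f x"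
    "\<And>x. x \<in> carrier M \<Longrightarrow> f x = 0 \<longleftrightarrow> x = \<zero>\<^bsub>M\<^esub>"
    using module_iso_char_moduleD[OF M iso] by metis
  have "carrier M \<noteq> {\<zero>\<^bsub>M\<^esub>}"
  proof
    assume "carrier M = {\<zero>\<^bsub>M\<^esub>}"
    then have "UNIV = {f \<zero>\<^bsub>M\<^esub>}" using f(1) by (auto simp: bij_betw_def)
    then show False by (metis UNIV_I singletonD zero_neq_one)
  qed
  moreover have "N = {\<zero>\<^bsub>M\<^esub>} \<or> N = carrier M" if N: "submodule N R M" for N
  proof (rule disjCI)
    assume "N \<noteq> carrier M"
    note D = M.submoduleD[OF N]
    have False if u: "u \<in> N" "u \<noteq> \<zero>\<^bsub>M\<^esub>" for u
    proof -
      have "x \<in> N" if x: "x \<in> carrier M" for x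
      proof -
        obtain r where r: "r \<in> carrier R" "\<chi> r = f x / f u" using onto by blast
        have uM: "u \<in> carrier M" and fu: "f u \<noteq> 0" using u D(1) f(3) by auto
        then have "f (r \<odot>\<^bsub>M\<^esub> u) = f x" using r f(2) by simp
        then have "r \<odot>\<^bsub>M\<^esub> u = x"
          using f(1) x uM r(1) M.smult_closed by (metis bij_betw_def inj_onD)
        then show ?thesis using D(6) r(1) u(1) by blast
      qed
      then show False using \<open>N \<noteq> carrier M\<close> D(1) by blast
    qed
    then show "N = {\<zero>\<^bsub>M\<^esub>}" using D(2) by blast
  qed
  ultimately show ?thesis unfolding irreducible_module_def by blast
qed

text \<open>
  The zeros of \<open>\<chi>\<close> are an invariant of the isomorphism class. The function
  \<open>\<chi>\<close> itself is not: isomorphisms are only additive and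
  \<open>R\<close>-equivariant, so a field automorphism can twist it.
\<close>
lemma module_iso_char_annihilator:
  assumes "operator_module R M" "module_iso R M (char_module \<chi>)" "r \<in> carrier R"
  shows "\<chi> r = 0 \<longleftrightarrow> (\<forall>x\<in>carrier M. r \<odot>\<^bsub>M\<^esub> x = \<zero>\<^bsub>M\<^esub>)"
proof -
  interpret M: operator_module R M by fact
  obtain f where f: "bij_betw f (carrier M) UNIV"
    "\<And>r x. \<lbrakk>r \<in> carrier R; x \<in> carrier M\<rbrakk> \<Longrightarrow> f (r \<odot>\<^bsub>M\<^esub> x) = \<chi> r * f x"
    "\<And>x. x \<in> carrier M \<Longrightarrow> f x = 0 \<longleftrightarrow> x = \<zero>\<^bsub>M\<^esub>"
    using module_iso_char_moduleD[OF assms(1,2)] by metis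
  obtain x where "x \<in> carrier M" "f x = 1" using f(1) unfolding bij_betw_def by (metis UNIV_I imageE)
  then show ?thesis
    using f(2,3) assms(3) M.smult_closed by (metis mult.right_neutral mult_zero_left)
qed

context operator_module
begin

context
  fixes g :: "'m \<Rightarrow> 'f::field" and \<chi> :: "'r \<Rightarrow> 'f"
  assumes g_add: "\<And>x y. \<lbrakk>x \<in> carrier M; y \<in> carrier M\<rbrakk> \<Longrightarrow> g (x \<oplus> y) = g x + g y"
    and g_smult: "\<And>r x. \<lbrakk>r \<in> carrier R; x \<in> carrier M\<rbrakk> \<Longrightarrow> g (r \<odot> x) = \<chi> r * g x"
begin

lemma functional_group_hom: "group_hom (add_monoid M) (add_monoid (char_module \<chi>)) g"
proof -
  interpret K: operator_module R "char_module \<chi>" by (rule operator_module_char_module)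
  show ?thesis using g_add a_group K.a_group
    by (auto intro!: group_hom.intro group_hom_axioms.intro simp: hom_def)
qed

lemma functional_zero: "g \<zero> = 0"
proof -
  have "g \<zero> + g \<zero> = g \<zero> + 0" using g_add[of \<zero> \<zero>] by (metis add_0_right l_zero zero_closed)
  then show ?thesis by (simp only: add_left_cancel)
qed

lemma functional_minus: "x \<in> carrier M \<Longrightarrow> g (\<ominus> x) = - g x"
  using g_add[of "\<ominus> x" x] functional_zero by (simp add: l_neg eq_neg_iff_add_eq_0)

lemma functional_diff: "\<lbrakk>x \<in> carrier M; y \<in> carrier M\<rbrakk> \<Longrightarrow> g (x \<ominus> y) = g x - g y"
  using g_add[of x "\<ominus> y"] functional_minus by (simp add: a_minus_def)

lemma submodule_kernel: "submodule {x \<in> carrier M. g x = 0} R M"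
  using functional_minus functional_zero by (intro submoduleI) (auto simp: g_add g_smult)

lemma the_elem_functional_coset:
  assumes N: "submodule N R M" "\<And>x. x \<in> N \<Longrightarrow> g x = 0" and x: "x \<in> carrier M"
  shows "the_elem (g ` (N +> x)) = g x"
proof -
  have "g y = g x" if "y \<in> N +> x" for y
    using x that N submoduleD(1)[OF N(1)] g_add by (auto simp: a_r_coset_def')
  then have "g ` (N +> x) = {g x}" using coset_self[OF N(1) x] by blast
  then show ?thesis by simp
qed

text \<open>
  The kernel has codimension one: a vector \<open>u\<close> outside it can be scaled by operators so
  that any given \<open>x\<close> differs from \<open>r \<odot> u\<close> by an element of the
  kernel.
\<close>
lemma maximal_submodule_kernel:
  assumes v: "v \<in> carrier M" "g v \<noteq> 0" and onto: "\<And>a. \<exists>r\<in>carrier R. \<chi> r = a"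
  shows "maximal_submodule R M {x \<in> carrier M. g x = 0}"
  unfolding maximal_submodule_def
proof (intro conjI allI impI)
  show "submodule {x \<in> carrier M. g x = 0} R M" by (rule submodule_kernel)
  show "{x \<in> carrier M. g x = 0} \<noteq> carrier M" using v by blast
  fix N assume N: "submodule N R M \<and> {x \<in> carrier M. g x = 0} \<subseteq> N"
  then have sub: "submodule N R M" by blast
  note D = submoduleD[OF sub]
  have "x \<in> N" if u: "u \<in> N" "g u \<noteq> 0" and x: "x \<in> carrier M" for u x
  proof -
    obtain r where r: "r \<in> carrier R" "\<chi> r = g x / g u" using onto by blast
    have uM: "u \<in> carrier M" using u(1) D(1) by blast
    have "g (x \<ominus> r \<odot> u) = 0" using functional_diff g_smult uM x r u(2) by simp
    then have "x \<ominus> r \<odot> u \<in> N" using N uM x r(1) by auto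
    then have "(x \<ominus> r \<odot> u) \<oplus> r \<odot> u \<in> N" using D(4,6) r(1) u(1) by blast
    then show ?thesis using minus_add_self[of x "r \<odot> u"] x uM r(1) by simp
  qed
  then show "N = {x \<in> carrier M. g x = 0} \<or> N = carrier M" using N D(1) by blast
qed

text \<open>
  The first isomorphism theorem for an equivariant functional.
\<close>
lemma module_iso_char_moduleI:
  assumes v: "v \<in> carrier M" "g v \<noteq> 0" and onto: "\<And>a. \<exists>r\<in>carrier R. \<chi> r = a"
  shows "module_iso R (quot_module M {x \<in> carrier M. g x = 0}) (char_module \<chi>)"
proof -
  let ?N = "{x \<in> carrier M. g x = 0}"
  interpret g: group_hom "add_monoid M" "add_monoid (char_module \<chi>)" g
    by (rule functional_group_hom)
  have "a \<in> g ` carrier M" for a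
  proof -
    obtain r where r: "r \<in> carrier R" "\<chi> r = a / g v" using onto by blast
    then have "g (r \<odot> v) = a" using v g_smult by simp
    then show ?thesis using r v by blast
  qed
  then have "(\<lambda>X. the_elem (g ` X)) \<in> iso (add_monoid M Mod kernel (add_monoid M)
      (add_monoid (char_module \<chi>)) g) (add_monoid (char_module \<chi>))"
    by (intro g.FactGroup_iso_set) auto
  then have iso: "(\<lambda>X. the_elem (g ` X)) \<in>
      iso (add_monoid (quot_module M ?N)) (add_monoid (char_module \<chi>))"
    by (simp add: iso_def hom_def kernel_def FactGroup_def quot_module_def A_RCOSETS_def set_add_def)
  have "the_elem (g ` (?N +> x)) = g x" if "x \<in> carrier M" for x
    using submodule_kernel that by (intro the_elem_functional_coset) auto
  then have "the_elem (g ` (r \<odot>\<^bsub>quot_module M ?N\<^esub> X)) = \<chi> r * the_elem (g ` X)"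
    if "r \<in> carrier R" "X \<in> carrier (quot_module M ?N)" for r X
    using that g_smult by (auto simp: carrier_quot_module smult_quot_module[OF submodule_kernel])
  then show ?thesis unfolding module_iso_def using iso by (auto intro!: bexI[of _ "\<lambda>X. the_elem (g ` X)"])
qed

end

end


text \<open>
  A finite direct sum of one-dimensional modules with pairwise different characters, presented by
  its coordinate functionals \<open>f c\<close>. The separating operators play the role of
  orthogonal idempotents; they force every submodule to be a sum of coordinate lines, so that
  multiplicities can be read off without the Jordan--Hoelder theorem.
\<close>
locale diagonal_module = operator_module R L
  for R :: "('r, 'k) ring_scheme" and L :: "('r, 'm) module" (structure) +
  fixes C :: "'c set" and f :: "'c \<Rightarrow> 'm \<Rightarrow> 'f::field" and \<chi> :: "'c \<Rightarrow> 'r \<Rightarrow> 'f"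
  assumes finite_C: "finite C"
    and f_add: "\<lbrakk>c \<in> C; x \<in> carrier L; y \<in> carrier L\<rbrakk> \<Longrightarrow> f c (x \<oplus> y) = f c x + f c y"
    and f_smult: "\<lbrakk>c \<in> C; r \<in> carrier R; x \<in> carrier L\<rbrakk> \<Longrightarrow> f c (r \<odot> x) = \<chi> c r * f c x"
    and faithful: "\<lbrakk>x \<in> carrier L; \<And>c. c \<in> C \<Longrightarrow> f c x = 0\<rbrakk> \<Longrightarrow> x = \<zero>"
    and separating: "c \<in> C \<Longrightarrow> \<exists>t\<in>carrier R. \<chi> c t = a \<and> (\<forall>d\<in>C - {c}. \<chi> d t = 0)"
    and nonzero: "c \<in> C \<Longrightarrow> \<exists>x\<in>carrier L. f c x \<noteq> 0"
begin

lemma f_zero: "c \<in> C \<Longrightarrow> f c \<zero> = 0"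
  by (rule functional_zero[of "f c" "\<chi> c"]) (auto intro: f_add f_smult)

lemma f_minus: "\<lbrakk>c \<in> C; x \<in> carrier L\<rbrakk> \<Longrightarrow> f c (\<ominus> x) = - f c x"
  by (rule functional_minus[of "f c" "\<chi> c"]) (auto intro: f_add f_smult)

lemma f_diff: "\<lbrakk>c \<in> C; x \<in> carrier L; y \<in> carrier L\<rbrakk> \<Longrightarrow> f c (x \<ominus> y) = f c x - f c y"
  by (rule functional_diff[of "f c" "\<chi> c"]) (auto intro: f_add f_smult)

lemma f_inject:
  assumes "x \<in> carrier L" "y \<in> carrier L" "\<And>c. c \<in> C \<Longrightarrow> f c x = f c y"
  shows "x = y"
proof -
  have "x \<ominus> y = \<zero>" using assms by (intro faithful) (auto simp: f_diff)
  then show ?thesis using minus_add_self[OF assms(1,2)] assms(2) by simp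
qed

text \<open>
  The coordinates that do not vanish identically on \<open>V\<close>; for a submodule they determine
  \<open>V\<close>.
\<close>
definition coords :: "'m set \<Rightarrow> 'c set" where
  "coords V = {c \<in> C. \<exists>v\<in>V. f c v \<noteq> 0}"

lemma coords_vector:
  assumes V: "submodule V R L" and c: "c \<in> coords V"
  shows "\<exists>v\<in>V. f c v = a \<and> (\<forall>d\<in>C - {c}. f d v = 0)"
proof -
  obtain v where v: "v \<in> V" "f c v \<noteq> 0" "c \<in> C" using c by (auto simp: coords_def)
  obtain t where t: "t \<in> carrier R" "\<chi> c t = a / f c v" "\<forall>d\<in>C - {c}. \<chi> d t = 0"
    using separating[OF v(3)] by blast
  have "v \<in> carrier L" using v submoduleD(1)[OF V] by blast
  then have "f c (t \<odot> v) = a" "\<forall>d\<in>C - {c}. f d (t \<odot> v) = 0" using v t by (auto simp: f_smult)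
  then show ?thesis using submoduleD(6)[OF V t(1) v(1)] by blast
qed

text \<open>
  A vector supported on \<open>coords V\<close> is a sum of vectors on single coordinate lines, and
  these lie in \<open>V\<close> by \<open>coords_vector\<close>.
\<close>
lemma submodule_eq_coords:
  assumes V: "submodule V R L"
  shows "V = {x \<in> carrier L. \<forall>c\<in>C - coords V. f c x = 0}"
proof (intro equalityI subsetI)
  fix x assume "x \<in> V"
  then show "x \<in> {x \<in> carrier L. \<forall>c\<in>C - coords V. f c x = 0}"
    using submoduleD(1)[OF V] by (auto simp: coords_def)
next
  fix x assume x: "x \<in> {x \<in> carrier L. \<forall>c\<in>C - coords V. f c x = 0}"
  have "\<exists>v\<in>V. (\<forall>c\<in>D. f c v = f c x) \<and> (\<forall>c\<in>C - D. f c v = 0)" if "finite D" "D \<subseteq> coords V" for D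
    using that
  proof (induction D)
    case empty
    then show ?case using submoduleD(2)[OF V] f_zero by blast
  next
    case (insert d D)
    then obtain v where v: "v \<in> V" "\<forall>c\<in>D. f c v = f c x" "\<forall>c\<in>C - D. f c v = 0" by blast
    obtain w where w: "w \<in> V" "f d w = f d x" "\<forall>c\<in>C - {d}. f c w = 0"
      using coords_vector[OF V] insert.prems by blast
    have vw: "v \<in> carrier L" "w \<in> carrier L" using v(1) w(1) submoduleD(1)[OF V] by auto
    have "insert d D \<subseteq> C" using insert.prems by (auto simp: coords_def)
    then have "f c (v \<oplus> w) = (if c \<in> insert d D then f c x else 0)" if "c \<in> C" for c
      using that v(2,3) w(2,3) insert.hyps(2) by (cases "c = d") (auto simp: f_add[OF _ vw])
    then show ?case using submoduleD(4)[OF V v(1) w(1)] \<open>insert d D \<subseteq> C\<close>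
      by (intro bexI[of _ "v \<oplus> w"]) auto
  qed
  moreover have "finite (coords V)" using finite_C by (auto simp: coords_def)
  ultimately obtain v where v: "v \<in> V" "\<forall>c\<in>coords V. f c v = f c x" "\<forall>c\<in>C - coords V. f c v = 0"
    by blast
  have "v = x"
    using v x submoduleD(1)[OF V] by (intro f_inject) auto
  then show "x \<in> V" using v(1) by simp
qed

text \<open>
  If \<open>c\<close> is a coordinate of \<open>W\<close> but not of \<open>V\<close>, the kernel of
  \<open>f c\<close> on \<open>W\<close> is a proper submodule containing \<open>V\<close>, so it is
  \<open>V\<close>, and \<open>f c\<close> identifies the factor with the module of
  \<open>\<chi> c\<close>.
\<close>
lemma simple_factor:
  assumes V: "submodule V R L" and W: "submodule W R L" and "V \<subseteq> W"
    and irred: "irreducible_module R (quot_module (sub_module L W) V)"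
  obtains c where "c \<in> C" "c \<notin> coords V" "coords W = insert c (coords V)"
    "module_iso R (quot_module (sub_module L W) V) (char_module (\<chi> c))"
proof -
  interpret W: operator_module R "sub_module L W" by (rule sub_module_operator_module[OF W])
  have VW: "submodule V R (sub_module L W)"
    using V W \<open>V \<subseteq> W\<close> by (rule submodule_sub_module)
  have "V \<noteq> W"
  proof
    assume "V = W"
    have "W +> x = W" if "x \<in> W" for x
      using that submoduleD[OF W] coset_zero[OF W] coset_eq_iff[OF W, of x \<zero>] by auto
    then have "carrier (quot_module (sub_module L W) V) = {W}"
      using submoduleD(2)[OF W] \<open>V = W\<close> by (auto simp: W.carrier_quot_module)
    moreover have "\<zero>\<^bsub>quot_module (sub_module L W) V\<^esub> = W" by (simp add: quot_module_def \<open>V = W\<close>)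
    ultimately show False using irred by (simp add: irreducible_module_def)
  qed
  have sub: "coords V \<subseteq> coords W" using \<open>V \<subseteq> W\<close> by (auto simp: coords_def)
  have "coords V \<noteq> coords W"
    using submodule_eq_coords[OF V] submodule_eq_coords[OF W] \<open>V \<noteq> W\<close> by auto
  with sub obtain c where c: "c \<in> coords W" "c \<notin> coords V" by blast
  then have cC: "c \<in> C" by (simp add: coords_def)
  let ?N = "{x \<in> carrier (sub_module L W). f c x = 0}"
  have WL: "x \<in> carrier L" if "x \<in> W" for x using that submoduleD(1)[OF W] by blast
  have N: "submodule ?N R (sub_module L W)"
    using f_add f_smult cC WL by (intro W.submodule_kernel) auto
  have onto: "\<exists>r\<in>carrier R. \<chi> c r = a" for a using separating[OF cC] by blast
  have "?N \<noteq> W" using c(1) by (auto simp: coords_def)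
  moreover have "V \<subseteq> ?N" using c(2) cC \<open>V \<subseteq> W\<close> by (auto simp: coords_def)
  ultimately have NV: "?N = V"
    using W.irreducible_quot_module_between[OF VW N _ irred] by auto
  obtain v where v: "v \<in> W" "f c v \<noteq> 0" using c(1) by (auto simp: coords_def)
  have "module_iso R (quot_module (sub_module L W) ?N) (char_module (\<chi> c))"
    using f_add f_smult cC WL v onto by (intro W.module_iso_char_moduleI) auto
  moreover have "coords W = insert c (coords V)"
  proof
    show "insert c (coords V) \<subseteq> coords W" using c sub by blast
    show "coords W \<subseteq> insert c (coords V)"
    proof
      fix d assume d: "d \<in> coords W"
      obtain w where w: "w \<in> W" "f d w = 1" "\<forall>e\<in>C - {d}. f e w = 0"
        using coords_vector[OF W d] by blast
      have "d \<in> coords V" if "d \<noteq> c"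
      proof -
        have "w \<in> ?N" using w that cC by auto
        then show ?thesis using NV w(2) d by (auto simp: coords_def intro!: bexI[of _ w])
      qed
      then show "d \<in> insert c (coords V)" by blast
    qed
  qed
  ultimately show ?thesis using that[OF cC c(2)] unfolding NV by blast
qed

text \<open>
  Add the coordinates one at a time.
\<close>
lemma composition_series_exists: "\<exists>Vs. composition_series R L Vs"
proof -
  obtain cs where cs: "set cs = C" "distinct cs" using finite_distinct_list[OF finite_C] by blast
  define V where "V = (\<lambda>j. {x \<in> carrier L. \<forall>c\<in>C - set (take j cs). f c x = 0})"
  define Vs where "Vs = map V [0..<Suc (length cs)]"
  have sub: "submodule (V j) R L" for j
    unfolding V_def by (intro submoduleI) (auto simp: f_zero f_minus f_add f_smult)
  have "irreducible_module R (quot_module (sub_module L (V (Suc j))) (V j))" if j: "j < length cs" for j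
  proof -
    let ?c = "cs ! j"
    interpret W: operator_module R "sub_module L (V (Suc j))" by (rule sub_module_operator_module[OF sub])
    have cC: "?c \<in> C" using cs(1) j nth_mem by blast
    have take: "set (take (Suc j) cs) = insert ?c (set (take j cs))"
      using j by (simp add: take_Suc_conv_app_nth)
    have new: "?c \<notin> set (take j cs)"
      using cs(2) j by (metis distinct_take id_take_nth_drop not_distinct_conv_prefix)
    have Vj: "V j = {x \<in> carrier (sub_module L (V (Suc j))). f ?c x = 0}"
      unfolding V_def take using cC new by auto
    have WL: "x \<in> carrier L" if "x \<in> V (Suc j)" for x using that by (simp add: V_def)
    have onto: "\<exists>r\<in>carrier R. \<chi> ?c r = a" for a using separating[OF cC] by blast
    obtain v where v: "v \<in> carrier L" "f ?c v \<noteq> 0" using nonzero[OF cC] by blast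
    obtain t where t: "t \<in> carrier R" "\<chi> ?c t = 1" "\<forall>d\<in>C - {?c}. \<chi> d t = 0"
      using separating[OF cC] by blast
    have tv: "t \<odot> v \<in> V (Suc j)" "f ?c (t \<odot> v) \<noteq> 0"
      unfolding V_def take using v t cC by (auto simp: f_smult)
    have "module_iso R (quot_module (sub_module L (V (Suc j))) (V j)) (char_module (\<chi> ?c))"
      unfolding Vj using f_add f_smult cC WL tv onto by (intro W.module_iso_char_moduleI) auto
    moreover have "submodule (V j) R (sub_module L (V (Suc j)))"
      unfolding Vj using f_add f_smult cC WL by (intro W.submodule_kernel) auto
    ultimately show ?thesis
      using irreducible_module_char W.quot_module_operator_module onto by blast
  qed
  moreover have "V j \<subseteq> V (Suc j)" for j
    unfolding V_def using set_take_subset_set_take[of j "Suc j" cs] by auto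
  moreover have "V 0 = {\<zero>}" unfolding V_def using f_zero faithful by auto
  moreover have "V (length cs) = carrier L" unfolding V_def using cs(1) by auto
  ultimately have "composition_series R L Vs"
    unfolding composition_series_def Vs_def using sub
    by (auto simp: hd_map last_map nth_append simp del: upt_Suc simp flip: )
  then show ?thesis by blast
qed

lemma composition_series_coords:
  assumes Vs: "composition_series R L Vs"
  shows "coords (Vs ! 0) = {}" "coords (last Vs) = C"
    "Suc i < length Vs \<Longrightarrow> \<exists>c\<in>C. c \<notin> coords (Vs ! i) \<and> coords (Vs ! Suc i) = insert c (coords (Vs ! i)) \<and>
       module_iso R (quot_module (sub_module L (Vs ! Suc i)) (Vs ! i)) (char_module (\<chi> c))"
proof -
  have "Vs \<noteq> []" "hd Vs = {\<zero>}" "last Vs = carrier L"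
    and sub: "\<And>V. V \<in> set Vs \<Longrightarrow> submodule V R L"
    using Vs by (auto simp: composition_series_def)
  then show "coords (Vs ! 0) = {}" "coords (last Vs) = C"
    using f_zero nonzero by (auto simp: coords_def hd_conv_nth)
  assume i: "Suc i < length Vs"
  then show "\<exists>c\<in>C. c \<notin> coords (Vs ! i) \<and> coords (Vs ! Suc i) = insert c (coords (Vs ! i)) \<and>
       module_iso R (quot_module (sub_module L (Vs ! Suc i)) (Vs ! i)) (char_module (\<chi> c))"
    using Vs simple_factor[OF sub sub, of "Vs ! i" "Vs ! Suc i"] unfolding composition_series_def
    by (metis Suc_lessD nth_mem)
qed

text \<open>
  The coordinate sets grow from the empty set to \<open>C\<close>, so each coordinate enters exactly
  once.
\<close>
lemma factor_index_unique:
  assumes Vs: "composition_series R L Vs" and c: "c \<in> C"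
  shows "\<exists>i. {i. Suc i < length Vs \<and> c \<notin> coords (Vs ! i) \<and> c \<in> coords (Vs ! Suc i)} = {i}"
proof -
  note S = composition_series_coords[OF Vs]
  have mono: "coords (Vs ! i) \<subseteq> coords (Vs ! j)" if "i \<le> j" "j < length Vs" for i j
    using that
  proof (induction j rule: dec_induct)
    case (step j)
    then show ?case using S(3)[of j] by auto
  qed simp
  have "Vs \<noteq> []" using Vs by (simp add: composition_series_def)
  then have last: "c \<in> coords (Vs ! (length Vs - 1))" using S(2) c by (simp add: last_conv_nth)
  \<comment> \<open>The first member of the series on which the coordinate c does not vanish.\<close>
  define j where "j = (LEAST j. c \<in> coords (Vs ! j))"
  have j: "c \<in> coords (Vs ! j)" "\<And>i. i < j \<Longrightarrow> c \<notin> coords (Vs ! i)" "j \<le> length Vs - 1"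
    using last unfolding j_def by (auto intro: LeastI Least_le dest: not_less_Least)
  moreover have "j \<noteq> 0" using j(1) S(1) by (metis empty_iff)
  ultimately obtain k where k: "j = Suc k" "Suc k < length Vs" "c \<notin> coords (Vs ! k)"
    using \<open>Vs \<noteq> []\<close> by (cases j) (auto simp: Suc_le_eq less_diff_conv)
  have "i = k" if "Suc i < length Vs" "c \<notin> coords (Vs ! i)" "c \<in> coords (Vs ! Suc i)" for i
  proof -
    have "\<not> i < k" using j(2) that(3) k(1) by auto
    moreover have "\<not> k < i" using mono[of "Suc k" i] that(1,2) j(1) k(1) by auto
    ultimately show ?thesis by simp
  qed
  then show ?thesis using k j(1) by blast
qed

text \<open>
  In every composition series the factor that introduces the coordinate \<open>c\<close> belongs to
  \<open>\<chi> c\<close>, and \<open>c\<close> is introduced once; hence the count does not depend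
  on the series. The hypothesis \<open>same\<close> is there because an isomorphism only shows that
  two characters have the same zeros.
\<close>
theorem multiplicity_diagonal:
  assumes S: "operator_module R S" "module_iso R S (char_module \<psi>)"
    and same: "\<And>c. \<lbrakk>c \<in> C; \<forall>r\<in>carrier R. \<psi> r = 0 \<longleftrightarrow> \<chi> c r = 0\<rbrakk> \<Longrightarrow> \<forall>r\<in>carrier R. \<psi> r = \<chi> c r"
  shows "multiplicity_in R S L = (if \<exists>c\<in>C. \<forall>r\<in>carrier R. \<psi> r = \<chi> c r then 1 else 0)"
proof -
  let ?factor = "\<lambda>Vs i. quot_module (sub_module L (Vs ! Suc i)) (Vs ! i)"
  let ?count = "\<lambda>Vs. card {i. Suc i < length Vs \<and> module_iso R S (?factor Vs i)}"
  have op: "operator_module R (?factor Vs i)" if Vs: "composition_series R L Vs" "Suc i < length Vs" for Vs i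
  proof -
    have sub: "submodule (Vs ! i) R L" "submodule (Vs ! Suc i) R L" "Vs ! i \<subseteq> Vs ! Suc i"
      using Vs unfolding composition_series_def by auto
    then show ?thesis
      using operator_module.quot_module_operator_module submodule_sub_module sub_module_operator_module by blast
  qed
  have iff: "module_iso R S (?factor Vs i) \<longleftrightarrow> (\<forall>r\<in>carrier R. \<psi> r = \<chi> c r)"
    if Vs: "composition_series R L Vs" "Suc i < length Vs" and c: "c \<in> C"
      "module_iso R (?factor Vs i) (char_module (\<chi> c))" for Vs i c
  proof
    assume "module_iso R S (?factor Vs i)"
    then have "module_iso R S (char_module (\<chi> c))" using c(2) module_iso_trans by blast
    then show "\<forall>r\<in>carrier R. \<psi> r = \<chi> c r"
      using same[OF c(1)] module_iso_char_annihilator[OF S(1)] S(2) by metis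
  next
    assume eq: "\<forall>r\<in>carrier R. \<psi> r = \<chi> c r"
    have "module_iso R S (char_module (\<chi> c))"
      using S(2) eq unfolding module_iso_def by (auto simp: char_module_def)
    then show "module_iso R S (?factor Vs i)"
      using module_iso_trans module_iso_sym[OF c(2) op[OF Vs]] by blast
  qed
  have count: "?count Vs = (if \<exists>c\<in>C. \<forall>r\<in>carrier R. \<psi> r = \<chi> c r then 1 else 0)"
    if Vs: "composition_series R L Vs" for Vs
  proof (cases "\<exists>c\<in>C. \<forall>r\<in>carrier R. \<psi> r = \<chi> c r")
    case True
    then obtain c where c: "c \<in> C" "\<forall>r\<in>carrier R. \<psi> r = \<chi> c r" by blast
    have inj: "d = c" if "d \<in> C" "\<forall>r\<in>carrier R. \<psi> r = \<chi> d r" for d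
      using separating[OF c(1), of 1] c(2) that by (metis Diff_iff singletonD zero_neq_one)
    have "{i. Suc i < length Vs \<and> module_iso R S (?factor Vs i)} =
        {i. Suc i < length Vs \<and> c \<notin> coords (Vs ! i) \<and> c \<in> coords (Vs ! Suc i)}"
    proof (rule Collect_cong, rule conj_cong[OF refl])
      fix i assume i: "Suc i < length Vs"
      obtain d where d: "d \<in> C" "d \<notin> coords (Vs ! i)" "coords (Vs ! Suc i) = insert d (coords (Vs ! i))"
          "module_iso R (?factor Vs i) (char_module (\<chi> d))"
        using composition_series_coords(3)[OF Vs i] by blast
      show "module_iso R S (?factor Vs i) \<longleftrightarrow> c \<notin> coords (Vs ! i) \<and> c \<in> coords (Vs ! Suc i)"
        using iff[OF Vs i d(1,4)] inj[OF d(1)] d(2,3) c(2) by auto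
    qed
    then show ?thesis using factor_index_unique[OF Vs c(1)] True by auto
  next
    case False
    then have "\<not> module_iso R S (?factor Vs i)" if "Suc i < length Vs" for i
      using composition_series_coords(3)[OF Vs that] iff[OF Vs that] by blast
    then have "{i. Suc i < length Vs \<and> module_iso R S (?factor Vs i)} = {}" by blast
    then show ?thesis using False by (simp only: card.empty if_False)
  qed
  obtain Vs where Vs: "composition_series R L Vs" using composition_series_exists by blast
  show ?thesis
    unfolding multiplicity_in_def
  proof (rule the_equality)
    show "\<exists>Vs. composition_series R L Vs \<and>
        (if \<exists>c\<in>C. \<forall>r\<in>carrier R. \<psi> r = \<chi> c r then 1 else 0) = ?count Vs"
      using Vs count[OF Vs] by (intro exI[of _ Vs]) simp
  next
    fix n assume "\<exists>Vs. composition_series R L Vs \<and> n = ?count Vs"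
    then show "n = (if \<exists>c\<in>C. \<forall>r\<in>carrier R. \<psi> r = \<chi> c r then 1 else 0)"
      using count by auto
  qed
qed

end


text \<open>
  Dividing by the common kernel supplies the faithfulness that a family of coordinate functionals
  may lack. On a coset, \<open>f c\<close> is constant, and \<open>the_elem\<close> extracts its
  value.
\<close>
lemma (in operator_module) diagonal_module_quotient:
  fixes C :: "'c set" and f :: "'c \<Rightarrow> 'm \<Rightarrow> 'f::field" and \<chi> :: "'c \<Rightarrow> 'r \<Rightarrow> 'f"
  assumes "finite C"
    and add: "\<And>c x y. \<lbrakk>c \<in> C; x \<in> carrier M; y \<in> carrier M\<rbrakk> \<Longrightarrow> f c (x \<oplus> y) = f c x + f c y"
    and smult: "\<And>c r x. \<lbrakk>c \<in> C; r \<in> carrier R; x \<in> carrier M\<rbrakk> \<Longrightarrow> f c (r \<odot> x) = \<chi> c r * f c x"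
    and separating: "\<And>c a. c \<in> C \<Longrightarrow> \<exists>t\<in>carrier R. \<chi> c t = a \<and> (\<forall>d\<in>C - {c}. \<chi> d t = 0)"
    and nonzero: "\<And>c. c \<in> C \<Longrightarrow> \<exists>x\<in>carrier M. f c x \<noteq> 0"
    and D: "D = {x \<in> carrier M. \<forall>c\<in>C. f c x = 0}"
  shows "diagonal_module R (quot_module M D) C (\<lambda>c X. the_elem (f c ` X)) \<chi>"
proof -
  have zero: "f c \<zero> = 0" and minus: "x \<in> carrier M \<Longrightarrow> f c (\<ominus> x) = - f c x" if "c \<in> C" for c x
    using functional_zero[of "f c" "\<chi> c"] functional_minus[of "f c" "\<chi> c"] add smult that by auto
  have sub: "submodule D R M"
    unfolding D by (intro submoduleI) (auto simp: zero minus add smult)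
  have el: "the_elem (f c ` (D +> x)) = f c x" if "c \<in> C" "x \<in> carrier M" for c x
    using that add smult sub by (intro the_elem_functional_coset[where \<chi> = "\<chi> c"]) (auto simp: D)
  show ?thesis
  proof (intro diagonal_module.intro diagonal_module_axioms.intro)
    show "operator_module R (quot_module M D)" using sub by (rule quot_module_operator_module)
  next
    fix c X Y assume "c \<in> C" "X \<in> carrier (quot_module M D)" "Y \<in> carrier (quot_module M D)"
    then show "the_elem (f c ` (X \<oplus>\<^bsub>quot_module M D\<^esub> Y)) = the_elem (f c ` X) + the_elem (f c ` Y)"
      by (auto simp: carrier_quot_module add_quot_module[OF sub] el add)
  next
    fix c r X assume "c \<in> C" "r \<in> carrier R" "X \<in> carrier (quot_module M D)"
    then show "the_elem (f c ` (r \<odot>\<^bsub>quot_module M D\<^esub> X)) = \<chi> c r * the_elem (f c ` X)"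
      by (auto simp: carrier_quot_module smult_quot_module[OF sub] el smult)
  next
    fix X assume X: "X \<in> carrier (quot_module M D)" "\<And>c. c \<in> C \<Longrightarrow> the_elem (f c ` X) = 0"
    then obtain x where x: "x \<in> carrier M" "X = D +> x" by (auto simp: carrier_quot_module)
    then have "x \<in> D" using X(2) el by (auto simp: D)
    then have "x \<ominus> \<zero> \<in> D" using submoduleD(2,5)[OF sub] by blast
    then show "X = \<zero>\<^bsub>quot_module M D\<^esub>"
      using x coset_eq_iff[OF sub] unfolding zero_quot_module[OF sub] by blast
  next
    fix c assume c: "c \<in> C"
    then obtain x where x: "x \<in> carrier M" "f c x \<noteq> 0" using nonzero by blast
    then have "the_elem (f c ` (D +> x)) \<noteq> 0" using el c by simp
    then show "\<exists>X\<in>carrier (quot_module M D). the_elem (f c ` X) \<noteq> 0"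
      using x by (auto simp: carrier_quot_module)
  qed (use assms in auto)
qed

section \<open>Set compositions and the elements attached to them\<close>

lemma Nil_in_set_compositions [simp]: "[] \<in> set_compositions B \<longleftrightarrow> B = {}"
  by (auto simp: set_compositions_def partition_on_def)

text \<open>
  This recursive description makes set compositions amenable to structural induction.
\<close>
lemma Cons_in_set_compositions [simp]:
  "W # R \<in> set_compositions B \<longleftrightarrow> W \<noteq> {} \<and> W \<subseteq> B \<and> R \<in> set_compositions (B - W)"
proof (cases "W \<in> set R")
  case True
  then show ?thesis by (auto simp: set_compositions_def partition_on_def)
next
  case False
  have "partition_on B (insert W (set R)) \<longleftrightarrow> W \<noteq> {} \<and> W \<subseteq> B \<and> partition_on (B - W) (set R)"
  proof
    assume p: "partition_on B (insert W (set R))"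
    then have "disjoint (insert W (set R))" "\<Union>(set R) \<union> W = B" by (auto simp: partition_on_def)
    moreover from this(1) False have "W \<inter> \<Union>(set R) = {}"
      by (auto simp: disjoint_def)
    ultimately show "W \<noteq> {} \<and> W \<subseteq> B \<and> partition_on (B - W) (set R)"
      using p by (auto simp: partition_on_def disjoint_def)
  qed (auto simp: partition_on_def disjoint_def)
  then show ?thesis using False by (auto simp: set_compositions_def)
qed

lemma Union_set_composition: "R \<in> set_compositions B \<Longrightarrow> \<Union>(set R) = B"
  by (simp add: set_compositions_def partition_on_def)

lemma partition_on_disjoint:
  "\<lbrakk>partition_on A \<P>; U \<in> \<P>; V \<in> \<P>; U \<noteq> V\<rbrakk> \<Longrightarrow> U \<inter> V = {}"
  using partition_onD2 disjointD by blast

lemma set_compositions_block: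
  assumes "Q \<in> set_compositions A" "B \<in> set Q"
  shows "B \<noteq> {}" "B \<subseteq> A" "finite A \<Longrightarrow> finite B"
  using assms by (auto simp: set_compositions_def partition_on_def intro: finite_subset)

lemma finite_set_compositions: "finite B \<Longrightarrow> finite (set_compositions B)"
  by (rule finite_subset[OF _ finite_subset_distinct[of "Pow B"]])
    (auto simp: set_compositions_def partition_on_def)

text \<open>
  The set composition induced on \<open>U\<close>; the product \<open>meet P R\<close> lists the
  traces of \<open>R\<close> on the blocks of \<open>P\<close>.
\<close>
definition trace :: "'a set \<Rightarrow> 'a set list \<Rightarrow> 'a set list" where
  "trace U R = filter (\<lambda>X. X \<noteq> {}) (map ((\<inter>) U) R)"

lemma trace_simps [simp]:
  "trace U [] = []"
  "trace U (W # R) = (if U \<inter> W = {} then trace U R else (U \<inter> W) # trace U R)"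
  by (auto simp: trace_def)

lemma trace_concat: "trace U (concat Rs) = concat (map (trace U) Rs)"
  by (induction Rs) (auto simp: trace_def)

lemma meet_eq_concat_trace: "meet P R = concat (map (\<lambda>U. trace U R) P)"
  by (induction P) (auto simp: meet_def trace_def)

lemma trace_superset: "R \<in> set_compositions B \<Longrightarrow> B \<subseteq> U \<Longrightarrow> trace U R = R"
proof (induction R arbitrary: B)
  case (Cons W R)
  then have "U \<inter> W = W" "W \<noteq> {}" "trace U R = R" by auto
  then show ?case by simp
qed simp

lemma trace_disjoint: "R \<in> set_compositions B \<Longrightarrow> B \<inter> U = {} \<Longrightarrow> trace U R = []"
proof (induction R arbitrary: B)
  case (Cons W R)
  then have "U \<inter> W = {}" "trace U R = []" by auto
  then show ?case by simp
qed simp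

definition pointed_compositions :: "nat set \<Rightarrow> nat set list set" where
  "pointed_compositions B = {P \<in> set_compositions B. Min B \<in> hd P}"

text \<open>
  Together with its inverse \<open>unsplit_first\<close>, this is the sign-reversing involution
  behind the vanishing of \<open>P \<and> e\<^sub>B\<close> for \<open>P\<close> with at least two
  blocks. In the first block of \<open>R\<close> that meets \<open>S\<close>, the part outside
  \<open>S\<close> is moved in front of the part inside \<open>S\<close>; if both parts are
  non-empty, this changes the length by one, but neither the trace on \<open>S\<close> nor the trace
  on any set disjoint from \<open>S\<close>.
\<close>
fun split_first :: "'a set \<Rightarrow> 'a set list \<Rightarrow> 'a set list" where
  "split_first S [] = []"
| "split_first S (W # R) = (if W \<inter> S = {} then W # split_first S R else (W - S) # (W \<inter> S) # R)"

fun unsplit_first :: "'a set \<Rightarrow> 'a set list \<Rightarrow> 'a set list" where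
  "unsplit_first S (W # X # R) = (if X \<inter> S = {} then W # unsplit_first S (X # R) else (W \<union> X) # R)"
| "unsplit_first S R = R"

text \<open>
  Tells the two halves of the involution apart: whether the first block meeting \<open>S\<close>
  lies inside \<open>S\<close>.
\<close>
fun first_within :: "'a set \<Rightarrow> 'a set list \<Rightarrow> bool" where
  "first_within S [] = True"
| "first_within S (W # R) = (if W \<inter> S = {} then first_within S R else W \<subseteq> S)"

lemma split_first_props:
  assumes "R \<in> set_compositions B" "\<not> first_within S R"
  shows "split_first S R \<in> set_compositions B" "first_within S (split_first S R)"
    "length (split_first S R) = Suc (length R)" "unsplit_first S (split_first S R) = R"
    "split_first S R \<noteq> []" "hd (split_first S R) = hd R - S"
  using assms
proof (induction R arbitrary: B)
  case (Cons W R)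
  {
    case 1
    have "B - (W - S) - (W \<inter> S) = B - W" by blast
    then show ?case using 1 Cons.IH(1) by (cases "W \<inter> S = {}") auto
  next
    case 2 then show ?case using Cons.IH(2) by (cases "W \<inter> S = {}") auto
  next
    case 3 then show ?case using Cons.IH(3) by (cases "W \<inter> S = {}") auto
  next
    case 4
    show ?case
    proof (cases "W \<inter> S = {}")
      case True
      with 4 have "split_first S R \<noteq> []" "hd (split_first S R) = hd R - S"
        "unsplit_first S (split_first S R) = R"
        using Cons.IH(4,5,6) by auto
      then show ?thesis using True by (cases "split_first S R") auto
    qed auto
  next
    case 5 then show ?case by auto
  next
    case 6 then show ?case by auto
  }
qed simp_all

lemma unsplit_first_props:
  assumes "R \<in> set_compositions B" "first_within S R" "hd R \<inter> S = {}" "B \<inter> S \<noteq> {}"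
  shows "unsplit_first S R \<in> set_compositions B" "\<not> first_within S (unsplit_first S R)"
    "split_first S (unsplit_first S R) = R" "hd R \<subseteq> hd (unsplit_first S R)"
  using assms
proof (induction S R arbitrary: B rule: unsplit_first.induct)
  case (1 S W X R)
  have *: "\<And>B. B - W - X = B - (W \<union> X)" by blast
  {
    case 1
    show ?case
    proof (cases "X \<inter> S = {}")
      case False
      have "R \<in> set_compositions (B - W - X)" using 1 by simp
      then have "R \<in> set_compositions (B - (W \<union> X))" unfolding * .
      then show ?thesis using False 1 by auto
    qed (use 1 "1.IH"(1)[of "B - W"] in auto)
  next
    case 2
    then show ?case using "1.IH"(2)[of "B - W"] by (cases "X \<inter> S = {}") auto
  next
    case 3
    then show ?case using "1.IH"(3)[of "B - W"] by (cases "X \<inter> S = {}") auto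
  next
    case 4
    then show ?case by auto
  }
qed auto

lemma trace_split_first:
  assumes "R \<in> set_compositions B" "U \<inter> B \<subseteq> S \<or> U \<inter> S = {}"
  shows "trace U (split_first S R) = trace U R"
  using assms
proof (induction R arbitrary: B)
  case (Cons W R)
  show ?case
  proof (cases "W \<inter> S = {}")
    case True
    have "U \<inter> (B - W) \<subseteq> S \<or> U \<inter> S = {}" using Cons.prems by blast
    then have "trace U (split_first S R) = trace U R"
      using Cons.prems(1) by (intro Cons.IH[of "B - W"]) simp_all
    then show ?thesis using True by simp
  next
    case False
    have "U \<inter> (W - S) = {} \<and> U \<inter> (W \<inter> S) = U \<inter> W \<or> U \<inter> (W \<inter> S) = {} \<and> U \<inter> (W - S) = U \<inter> W"
      using Cons.prems by auto
    then show ?thesis using False by (elim disjE conjE) simp_all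
  qed
qed simp

text \<open>
  The head of \<open>R\<close> contains \<open>Min B\<close>, which is outside \<open>S\<close>.
  Hence a block inside \<open>S\<close> is never the head and has a predecessor to be merged with.
  This is what the condition on the head is for.
\<close>
lemma split_first_bij:
  assumes B: "S \<subseteq> B" "S \<noteq> {}" "Min B \<notin> S"
  defines "E \<equiv> pointed_compositions B"
  shows "R \<in> E \<Longrightarrow> \<not> first_within S R \<Longrightarrow> split_first S R \<in> E \<and> first_within S (split_first S R)
      \<and> unsplit_first S (split_first S R) = R"
    "R \<in> E \<Longrightarrow> first_within S R \<Longrightarrow> unsplit_first S R \<in> E \<and> \<not> first_within S (unsplit_first S R)
      \<and> split_first S (unsplit_first S R) = R"
proof -
  assume R: "R \<in> E" "\<not> first_within S R"
  then show "split_first S R \<in> E \<and> first_within S (split_first S R)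
      \<and> unsplit_first S (split_first S R) = R"
    using split_first_props[of R B S] B(3) by (auto simp: E_def pointed_compositions_def)
next
  assume R: "R \<in> E" "first_within S R"
  have "R \<noteq> []" using R(1) B by (auto simp: E_def pointed_compositions_def)
  then have "hd R \<inter> S = {}"
    using R B(3) by (cases R) (auto simp: E_def pointed_compositions_def split: if_splits)
  moreover have "B \<inter> S \<noteq> {}" using B by blast
  ultimately show "unsplit_first S R \<in> E \<and> \<not> first_within S (unsplit_first S R)
      \<and> split_first S (unsplit_first S R) = R"
    using R unsplit_first_props[of R B S] by (auto simp: E_def pointed_compositions_def)
qed


lemma wedge_eq_sum:
  assumes "finite X" "Poly_Mapping.keys x \<subseteq> X" "finite Y" "Poly_Mapping.keys y \<subseteq> Y"
  shows "wedge x y = (\<Sum>P\<in>X. \<Sum>Q\<in>Y.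
    Poly_Mapping.single (meet P Q) (Poly_Mapping.lookup x P * Poly_Mapping.lookup y Q))"
  unfolding wedge_def using assms
  by (intro sum.mono_neutral_cong_left ballI sum.neutral)
    (auto simp: in_keys_iff intro!: sum.mono_neutral_left)

lemma wedge_add_left: "wedge (x + x') y = wedge x y + wedge x' y"
proof -
  let ?X = "Poly_Mapping.keys x \<union> Poly_Mapping.keys x'" and ?Y = "Poly_Mapping.keys y"
  have "Poly_Mapping.keys (x + x') \<subseteq> ?X" by (rule keys_add)
  then show ?thesis
    by (simp add: wedge_eq_sum[of ?X _ ?Y] lookup_add distrib_right single_add sum.distrib)
qed

lemma wedge_add_right: "wedge x (y + y') = wedge x y + wedge x y'"
proof -
  let ?Y = "Poly_Mapping.keys y \<union> Poly_Mapping.keys y'" and ?X = "Poly_Mapping.keys x"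
  have "Poly_Mapping.keys (y + y') \<subseteq> ?Y" by (rule keys_add)
  then show ?thesis
    by (simp add: wedge_eq_sum[of ?X _ ?Y] lookup_add distrib_left single_add sum.distrib)
qed

lemma wedge_zero [simp]: "wedge 0 y = 0" "wedge x 0 = 0"
  by (simp_all add: wedge_def)

lemma wedge_sum_left: "wedge (\<Sum>i\<in>I. x i) y = (\<Sum>i\<in>I. wedge (x i) y)"
  by (induction I rule: infinite_finite_induct) (simp_all add: wedge_add_left)

lemma wedge_sum_right: "wedge x (\<Sum>i\<in>I. y i) = (\<Sum>i\<in>I. wedge x (y i))"
  by (induction I rule: infinite_finite_induct) (simp_all add: wedge_add_right)

lemma wedge_single [simp]:
  "wedge (Poly_Mapping.single P a) (Poly_Mapping.single Q b) = Poly_Mapping.single (meet P Q) (a * b)"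
  using wedge_eq_sum[of "{P}" "Poly_Mapping.single P a" "{Q}" "Poly_Mapping.single Q b"] by simp

lemma vee_eq_sum:
  assumes "finite X" "Poly_Mapping.keys x \<subseteq> X" "finite Y" "Poly_Mapping.keys y \<subseteq> Y"
  shows "vee x y = (\<Sum>P\<in>X. \<Sum>Q\<in>Y. if \<Union>(set P) \<inter> \<Union>(set Q) = {}
    then Poly_Mapping.single (P @ Q) (Poly_Mapping.lookup x P * Poly_Mapping.lookup y Q) else 0)"
  unfolding vee_def using assms
  by (intro sum.mono_neutral_cong_left ballI sum.neutral)
    (auto simp: in_keys_iff intro!: sum.mono_neutral_left)

lemma vee_add_left: "vee (x + x') y = vee x y + vee x' y"
proof -
  let ?X = "Poly_Mapping.keys x \<union> Poly_Mapping.keys x'" and ?Y = "Poly_Mapping.keys y"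
  have "Poly_Mapping.keys (x + x') \<subseteq> ?X" by (rule keys_add)
  then show ?thesis
    by (auto simp: vee_eq_sum[of ?X _ ?Y] lookup_add distrib_right single_add sum.distrib[symmetric]
        intro!: sum.cong)
qed

lemma vee_add_right: "vee x (y + y') = vee x y + vee x y'"
proof -
  let ?Y = "Poly_Mapping.keys y \<union> Poly_Mapping.keys y'" and ?X = "Poly_Mapping.keys x"
  have "Poly_Mapping.keys (y + y') \<subseteq> ?Y" by (rule keys_add)
  then show ?thesis
    by (auto simp: vee_eq_sum[of ?X _ ?Y] lookup_add distrib_left single_add sum.distrib[symmetric]
        intro!: sum.cong)
qed

lemma vee_zero [simp]: "vee 0 y = 0" "vee x 0 = 0"
  by (simp_all add: vee_def)

lemma vee_sum_left: "vee (\<Sum>i\<in>I. x i) y = (\<Sum>i\<in>I. vee (x i) y)"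
  by (induction I rule: infinite_finite_induct) (simp_all add: vee_add_left)

lemma vee_sum_right: "vee x (\<Sum>i\<in>I. y i) = (\<Sum>i\<in>I. vee x (y i))"
  by (induction I rule: infinite_finite_induct) (simp_all add: vee_add_right)

lemma vee_single:
  assumes "\<Union>(set P) \<inter> \<Union>(set Q) = {}"
  shows "vee (Poly_Mapping.single P a) (Poly_Mapping.single Q b) = Poly_Mapping.single (P @ Q) (a * b)"
  using vee_eq_sum[of "{P}" "Poly_Mapping.single P a" "{Q}" "Poly_Mapping.single Q b"] assms by simp

text \<open>
  Expanding \<open>e\<^sub>Q\<close>, the summands correspond to a choice of one composition for
  each block of \<open>Q\<close>. Indexing them by functions on the set of blocks, rather than by
  lists, makes the index set and the signs independent of the order of the blocks.
\<close>
definition choices :: "nat set set \<Rightarrow> (nat set \<Rightarrow> nat set list) set" where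
  "choices \<B> = Pi\<^sub>E \<B> pointed_compositions"

lemma finite_choices:
  assumes "finite A" "Q \<in> set_compositions A"
  shows "finite (choices (set Q))"
  unfolding choices_def
proof (intro finite_PiE ballI)
  fix B assume "B \<in> set Q"
  then have "finite (set_compositions B)"
    using set_compositions_block(3)[OF assms(2)] assms(1) finite_set_compositions by blast
  then show "finite (pointed_compositions B)" by (simp add: pointed_compositions_def)
qed simp

definition choice_sign :: "nat set set \<Rightarrow> (nat set \<Rightarrow> nat set list) \<Rightarrow> 'f::field" where
  "choice_sign \<B> \<rho> = (\<Prod>B\<in>\<B>. (-1) ^ (length (\<rho> B) - 1))"

lemma Union_concat_choice:
  assumes "\<rho> \<in> choices (set Q)"
  shows "\<Union>(set (concat (map \<rho> Q))) = \<Union>(set Q)"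
proof -
  have "\<Union>(set (\<rho> B)) = B" if "B \<in> set Q" for B
    using assms that by (auto simp: choices_def pointed_compositions_def set_compositions_def
        partition_on_def PiE_iff)
  then show ?thesis by fastforce
qed

lemma e_comp_eq_sum_choices:
  assumes "Q \<in> set_compositions A"
  shows "e_comp Q = (\<Sum>\<rho>\<in>choices (set Q).
    Poly_Mapping.single (concat (map \<rho> Q)) (choice_sign (set Q) \<rho> :: 'f::field))"
  using assms
proof (induction Q arbitrary: A)
  case Nil
  then show ?case by (simp add: e_comp_def choices_def choice_sign_def)
next
  case (Cons B Q)
  let ?s = "\<lambda>P. (-1) ^ (length P - 1) :: 'f"
  have BQ: "Q \<in> set_compositions (A - B)" "B \<inter> \<Union>(set Q) = {}" "B \<notin> set Q"
    using Cons.prems Union_set_composition[of Q "A - B"] by auto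
  have "e_comp (B # Q) = vee (e_set B) (e_comp Q :: 'f combination)"
    by (simp add: e_comp_def)
  also have "\<dots> = (\<Sum>P\<in>pointed_compositions B. \<Sum>\<rho>\<in>choices (set Q).
      vee (Poly_Mapping.single P (?s P)) (Poly_Mapping.single (concat (map \<rho> Q)) (choice_sign (set Q) \<rho>)))"
    by (simp add: e_set_def Cons.IH[OF BQ(1)] vee_sum_left vee_sum_right
        flip: pointed_compositions_def cong: sum.cong)
      (rule sum.swap)
  also have "\<dots> = (\<Sum>P\<in>pointed_compositions B. \<Sum>\<rho>\<in>choices (set Q).
      Poly_Mapping.single (P @ concat (map \<rho> Q)) (?s P * choice_sign (set Q) \<rho>))"
  proof (intro sum.cong refl vee_single)
    fix P \<rho> assume "P \<in> pointed_compositions B" "\<rho> \<in> choices (set Q)"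
    then show "\<Union>(set P) \<inter> \<Union>(set (concat (map \<rho> Q))) = {}"
      using Union_concat_choice[of \<rho> Q] BQ(2)
      by (auto simp: pointed_compositions_def set_compositions_def partition_on_def)
  qed
  also have "\<dots> = (\<Sum>(P, \<rho>)\<in>pointed_compositions B \<times> choices (set Q).
      Poly_Mapping.single (concat (map (\<rho>(B := P)) (B # Q))) (choice_sign (set (B # Q)) (\<rho>(B := P))))"
  proof -
    have "concat (map (\<rho>(B := P)) (B # Q)) = P @ concat (map \<rho> Q)"
      for P and \<rho> :: "nat set \<Rightarrow> nat set list"
      using BQ(3) by (auto intro!: arg_cong[of _ _ concat])
    moreover have "choice_sign (set (B # Q)) (\<rho>(B := P)) = ?s P * choice_sign (set Q) \<rho>" for P \<rho>
      using BQ(3) by (auto simp: choice_sign_def intro!: prod.cong)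
    ultimately show ?thesis
      unfolding sum.cartesian_product
      by (intro sum.cong refl) (simp only: case_prod_unfold)
  qed
  also have "\<dots> = (\<Sum>\<rho>\<in>choices (set (B # Q)).
    Poly_Mapping.single (concat (map \<rho> (B # Q))) (choice_sign (set (B # Q)) \<rho>))"
    unfolding choices_def using BQ(3)
    by (simp only: list.set PiE_insert_eq, subst sum.reindex[OF inj_combinator])
      (auto simp: case_prod_unfold)
  finally show ?case .
qed


lemma act_e_comp:
  assumes "Q \<in> set_compositions A"
  shows "wedge (Poly_Mapping.single P a) (e_comp Q) = (\<Sum>\<rho>\<in>choices (set Q).
    Poly_Mapping.single (meet P (concat (map \<rho> Q))) (a * choice_sign (set Q) \<rho> :: 'f::field))"
  by (simp add: e_comp_eq_sum_choices[OF assms] wedge_sum_right)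

lemma trace_choice:
  assumes "\<rho> \<in> choices (set Q)" "\<And>B. B \<in> set Q \<Longrightarrow> B \<subseteq> U \<or> B \<inter> U = {}"
  shows "trace U (concat (map \<rho> Q)) = concat (map \<rho> (filter (\<lambda>B. B \<noteq> {} \<and> B \<subseteq> U) Q))"
proof -
  have "trace U (\<rho> B) = (if B \<noteq> {} \<and> B \<subseteq> U then \<rho> B else [])" if "B \<in> set Q" for B
  proof -
    have "\<rho> B \<in> set_compositions B"
      using assms(1) that by (auto simp: choices_def pointed_compositions_def PiE_iff)
    then show ?thesis using assms(2)[OF that] trace_superset[of "\<rho> B" B U] trace_disjoint[of "\<rho> B" B U] by auto
  qed
  then have "trace U (concat (map \<rho> Q)) = concat (map (\<lambda>B. if B \<noteq> {} \<and> B \<subseteq> U then \<rho> B else []) Q)"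
    unfolding trace_concat by (auto intro!: arg_cong[of _ _ concat])
  also have "\<dots> = concat (map \<rho> (filter (\<lambda>B. B \<noteq> {} \<and> B \<subseteq> U) Q))"
    by (induction Q) auto
  finally show ?thesis .
qed

lemma refines_block_cases:
  assumes "refines A (set Q) (set P)" "U \<in> set P" "B \<in> set Q"
  shows "B \<subseteq> U \<or> B \<inter> U = {}"
proof -
  obtain V where V: "V \<in> set P" "B \<subseteq> V" using assms(1,3) by (auto simp: refines_def)
  have "V = U \<or> V \<inter> U = {}"
    using assms(1,2) V(1) partition_on_disjoint unfolding refines_def by blast
  then show ?thesis using V(2) by auto
qed

lemma meet_refined:
  assumes "refines A (set Q) (set P)"
  shows "meet P Q = concat (map (\<lambda>U. filter (\<lambda>B. B \<subseteq> U) Q) P)"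
proof -
  have "trace U Q = filter (\<lambda>B. B \<subseteq> U) Q" if U: "U \<in> set P" for U
  proof -
    have "B \<noteq> {} \<and> (B \<subseteq> U \<or> B \<inter> U = {})" if "B \<in> set Q" for B
      using refines_block_cases[OF assms U that] assms that by (auto simp: refines_def partition_on_def)
    then show ?thesis by (induction Q) (auto simp: Int_absorb1 Int_commute)
  qed
  then show ?thesis unfolding meet_eq_concat_trace by (auto intro!: arg_cong[of _ _ concat])
qed

lemma set_meet_refined:
  assumes "refines A (set Q) (set P)"
  shows "set (meet P Q) = set Q"
  using assms unfolding meet_refined[OF assms] by (fastforce simp: refines_def)

lemma meet_mset:
  assumes "P \<in> set_compositions A" "Q \<in> set_compositions A" "refines A (set Q) (set P)"
  shows "mset (meet P Q) = mset Q"
proof -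
  have "distinct (concat (map (\<lambda>U. filter (\<lambda>B. B \<subseteq> U) Q) P))"
  proof (rule distinct_concat)
    have ne: "\<exists>B\<in>set Q. B \<subseteq> U" if U: "U \<in> set P" for U
    proof -
      obtain x where "x \<in> U" "x \<in> A"
        using set_compositions_block(1)[OF assms(1) U] set_compositions_block(2)[OF assms(1) U] by blast
      moreover then obtain B where "B \<in> set Q" "x \<in> B"
        using Union_set_composition[OF assms(2)] by blast
      ultimately show ?thesis using refines_block_cases[OF assms(3) U] by blast
    qed
    have disj: "\<not> (B \<subseteq> U \<and> B \<subseteq> V)" if "U \<in> set P" "V \<in> set P" "U \<noteq> V" "B \<in> set Q" for U V B
    proof -
      have "U \<inter> V = {}"
        using that(1-3) assms(1) partition_on_disjoint unfolding set_compositions_def by blast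
      then show ?thesis using set_compositions_block(1)[OF assms(2) that(4)] by blast
    qed
    show "distinct (map (\<lambda>U. filter (\<lambda>B. B \<subseteq> U) Q) P)"
      unfolding distinct_map
    proof (intro conjI inj_onI)
      fix U V assume UV: "U \<in> set P" "V \<in> set P" "filter (\<lambda>B. B \<subseteq> U) Q = filter (\<lambda>B. B \<subseteq> V) Q"
      obtain B where "B \<in> set Q" "B \<subseteq> U" using ne UV(1) by blast
      then have "B \<in> set (filter (\<lambda>B. B \<subseteq> V) Q)" unfolding UV(3)[symmetric] by simp
      then show "U = V" using disj UV \<open>B \<subseteq> U\<close> by auto
    qed (use assms(1) in \<open>simp add: set_compositions_def\<close>)
    show "distinct Rs" if "Rs \<in> set (map (\<lambda>U. filter (\<lambda>B. B \<subseteq> U) Q) P)" for Rs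
      using that assms(2) by (auto simp: set_compositions_def)
    show "set Rs \<inter> set Ts = {}" if "Rs \<in> set (map (\<lambda>U. filter (\<lambda>B. B \<subseteq> U) Q) P)"
      "Ts \<in> set (map (\<lambda>U. filter (\<lambda>B. B \<subseteq> U) Q) P)" "Rs \<noteq> Ts" for Rs Ts
      using that disj by (auto; blast)
  qed
  moreover have "distinct Q" using assms(2) by (simp add: set_compositions_def)
  ultimately show ?thesis
    using set_meet_refined[OF assms(3)] set_eq_iff_mset_eq_distinct
    unfolding meet_refined[OF assms(3)] by blast
qed

lemma set_compositions_mset_cong: "mset Q = mset Q' \<Longrightarrow> Q \<in> set_compositions A \<longleftrightarrow> Q' \<in> set_compositions A"
  unfolding set_compositions_def by (metis (mono_tags, lifting) mem_Collect_eq mset_eq_imp_distinct_iff mset_eq_setD)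

text \<open>
  If every block of \<open>Q\<close> lies in a block of \<open>P\<close>, then multiplying by
  \<open>P\<close> only reorders the blocks, each together with the composition chosen for it.
\<close>
lemma act_e_comp_refined:
  assumes P: "P \<in> set_compositions A" and Q: "Q \<in> set_compositions A" and r: "refines A (set Q) (set P)"
  shows "wedge (Poly_Mapping.single P 1) (e_comp Q) = (e_comp (meet P Q) :: 'f::field combination)"
proof -
  have meet: "meet P (concat (map \<rho> Q)) = concat (map \<rho> (meet P Q))" if \<rho>: "\<rho> \<in> choices (set Q)" for \<rho>
  proof -
    have "trace U (concat (map \<rho> Q)) = concat (map \<rho> (filter (\<lambda>B. B \<subseteq> U) Q))" if U: "U \<in> set P" for U
    proof -
      have "filter (\<lambda>B. B \<noteq> {} \<and> B \<subseteq> U) Q = filter (\<lambda>B. B \<subseteq> U) Q"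
        using r by (intro filter_cong) (auto simp: refines_def partition_on_def)
      then show ?thesis using trace_choice[OF \<rho> refines_block_cases[OF r U]] by simp
    qed
    then show ?thesis unfolding meet_eq_concat_trace[of P "concat _"] meet_refined[OF r]
      by (induction P) auto
  qed
  have "meet P Q \<in> set_compositions A"
    using set_compositions_mset_cong[OF meet_mset[OF P Q r]] Q by simp
  then show ?thesis
    by (simp add: act_e_comp[OF Q] e_comp_eq_sum_choices[of "meet P Q"] set_meet_refined[OF r] meet)
qed

text \<open>
  Some block \<open>B\<close> of \<open>Q\<close> is cut by \<open>P\<close>, so a block of
  \<open>P\<close> meets \<open>B\<close> in a set \<open>S\<close> that misses
  \<open>Min B\<close>. Splitting the composition chosen for \<open>B\<close> at \<open>S\<close>
  pairs off the summands: \<open>P\<close> sees only traces on its blocks, which do not change,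
  whereas the sign does. Pairing summands, instead of comparing the sum with its negative, keeps the
  argument valid in characteristic two.
\<close>
lemma act_e_comp_not_refined:
  assumes "finite A" and P: "P \<in> set_compositions A" and Q: "Q \<in> set_compositions A"
    and r: "\<not> refines A (set Q) (set P)"
  shows "wedge (Poly_Mapping.single P 1) (e_comp Q) = (0 :: 'f::field combination)"
proof -
  have part: "partition_on A (set P)" "partition_on A (set Q)"
    using P Q by (auto simp: set_compositions_def)
  obtain B where B: "B \<in> set Q" "\<And>U. U \<in> set P \<Longrightarrow> \<not> B \<subseteq> U"
    using r part by (auto simp: refines_def)
  have fin: "finite B" "B \<noteq> {}" "B \<subseteq> A"
    using set_compositions_block[OF Q B(1)] \<open>finite A\<close> by auto
  then have "Min B \<in> A" using Min_in by blast
  then obtain V where V: "V \<in> set P" "Min B \<in> V"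
    using Union_set_composition[OF P] by blast
  obtain x where x: "x \<in> B" "x \<notin> V" using B(2)[OF V(1)] by blast
  then obtain U where U: "U \<in> set P" "x \<in> U"
    using fin(3) Union_set_composition[OF P] by blast
  have disj: "U' = U \<or> U' \<inter> U = {}" if "U' \<in> set P" for U'
    using partition_on_disjoint[OF part(1) that U(1)] by blast
  \<comment> \<open>S is non-empty and misses the minimum of B, so that the involution applies.\<close>
  define S where "S = U \<inter> B"
  have S: "S \<subseteq> B" "S \<noteq> {}" "Min B \<notin> S"
    using x U V disj[OF V(1)] by (auto simp: S_def)
  define summand where "summand = (\<lambda>\<rho>. Poly_Mapping.single (meet P (concat (map \<rho> Q))) (choice_sign (set Q) \<rho> :: 'f))"
  let ?C = "choices (set Q)"
  have "finite ?C" using \<open>finite A\<close> Q by (rule finite_choices)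
  have upd: "\<rho>(B := R) \<in> ?C" if "\<rho> \<in> ?C" "R \<in> pointed_compositions B" for \<rho> R
    using that B(1) by (auto simp: choices_def PiE_iff extensional_def)
  have in_B: "\<rho> B \<in> pointed_compositions B" if "\<rho> \<in> ?C" for \<rho>
    using that B(1) by (auto simp: choices_def PiE_iff)
  have cancel: "summand (\<rho>(B := split_first S (\<rho> B))) = - summand \<rho>"
    if \<rho>: "\<rho> \<in> ?C" "\<not> first_within S (\<rho> B)" for \<rho>
  proof -
    have c: "\<rho> B \<in> set_compositions B" using in_B[OF \<rho>(1)] by (simp add: pointed_compositions_def)
    have "\<rho> B \<noteq> []" using \<rho>(2) by auto
    then obtain n where n: "length (\<rho> B) = Suc n" by (cases "\<rho> B") auto
    let ?\<rho> = "\<rho>(B := split_first S (\<rho> B))"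
    have "trace W (concat (map ?\<rho> Q)) = trace W (concat (map \<rho> Q))" if W: "W \<in> set P" for W
    proof -
      have "W \<inter> B \<subseteq> S \<or> W \<inter> S = {}" using disj[OF W] by (auto simp: S_def)
      then have "trace W (split_first S (\<rho> B)) = trace W (\<rho> B)" using c by (rule trace_split_first[rotated])
      then show ?thesis unfolding trace_concat by (auto intro!: arg_cong[of _ _ concat])
    qed
    then have "meet P (concat (map ?\<rho> Q)) = meet P (concat (map \<rho> Q))"
      unfolding meet_eq_concat_trace by (auto intro!: arg_cong[of _ _ concat])
    moreover have "choice_sign (set Q) ?\<rho> = (- choice_sign (set Q) \<rho> :: 'f)"
    proof -
      have "choice_sign (set Q) \<sigma> = (-1) ^ (length (\<sigma> B) - 1) *
          (\<Prod>B'\<in>set Q - {B}. (-1) ^ (length (\<sigma> B') - 1) :: 'f)" for \<sigma>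
        unfolding choice_sign_def using B(1) by (intro prod.remove) auto
      then show ?thesis using n split_first_props(3)[OF c \<rho>(2)] by simp
    qed
    ultimately show ?thesis by (simp add: summand_def single_uminus)
  qed
  have "(\<Sum>\<rho>\<in>?C. summand \<rho>) = (\<Sum>\<rho>\<in>{\<rho>\<in>?C. \<not> first_within S (\<rho> B)}. summand \<rho>) +
      (\<Sum>\<rho>\<in>{\<rho>\<in>?C. first_within S (\<rho> B)}. summand \<rho>)"
    using \<open>finite ?C\<close> by (subst sum.union_disjoint[symmetric]) (auto intro!: sum.cong)
  also have "(\<Sum>\<rho>\<in>{\<rho>\<in>?C. first_within S (\<rho> B)}. summand \<rho>) =
      (\<Sum>\<rho>\<in>{\<rho>\<in>?C. \<not> first_within S (\<rho> B)}. summand (\<rho>(B := split_first S (\<rho> B))))"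
    using split_first_bij[OF S] in_B upd
    by (intro sum.reindex_bij_witness[where i = "\<lambda>\<rho>. \<rho>(B := split_first S (\<rho> B))"
          and j = "\<lambda>\<rho>. \<rho>(B := unsplit_first S (\<rho> B))"]) auto
  also have "\<dots> = (\<Sum>\<rho>\<in>{\<rho>\<in>?C. \<not> first_within S (\<rho> B)}. - summand \<rho>)"
    using cancel by (intro sum.cong) auto
  finally have "(\<Sum>\<rho>\<in>?C. summand \<rho>) = 0" by (simp add: sum_negf)
  then show ?thesis by (simp add: act_e_comp[OF Q] summand_def)
qed

text \<open>
  The element \<open>e\<^sub>Q\<close> is unitriangular: every choice other than the trivial one
  yields a strictly longer composition.
\<close>
lemma lookup_e_comp:
  assumes "finite A" "Q \<in> set_compositions A" "length w = length Q"
  shows "Poly_Mapping.lookup (e_comp Q) w = (if w = Q then 1 else 0 :: 'f::field)"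
proof -
  let ?C = "choices (set Q)"
  \<comment> \<open>The choice of the one-block composition for each block.\<close>
  define \<rho>0 where "\<rho>0 = (\<lambda>B\<in>set Q. [B])"
  have block: "finite B" "B \<noteq> {}" if "B \<in> set Q" for B
    using set_compositions_block[OF assms(2) that] assms(1) by auto
  have "finite ?C" using assms(1,2) by (rule finite_choices)
  have \<rho>0: "\<rho>0 \<in> ?C"
    unfolding \<rho>0_def choices_def pointed_compositions_def using block by (intro restrict_PiE_iff[THEN iffD2]) auto
  have map0: "concat (map \<rho>0 Q) = Q"
  proof -
    have "map \<rho>0 Q = map (\<lambda>B. [B]) Q" unfolding \<rho>0_def by simp
    moreover have "concat (map (\<lambda>B. [B]) R) = R" for R :: "nat set list" by (induction R) auto
    ultimately show ?thesis by metis
  qed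
  have sign0: "choice_sign (set Q) \<rho>0 = (1 :: 'f)" by (simp add: choice_sign_def \<rho>0_def)
  have longer: "concat (map \<rho> Q) \<noteq> w" if \<rho>: "\<rho> \<in> ?C" "\<rho> \<noteq> \<rho>0" for \<rho>
  proof -
    have c: "\<rho> B \<in> set_compositions B" if "B \<in> set Q" for B
      using \<rho>(1) that by (auto simp: choices_def pointed_compositions_def PiE_iff)
    have ge: "1 \<le> length (\<rho> B)" if "B \<in> set Q" for B
      using c[OF that] block[OF that] by (cases "\<rho> B") auto
    have "\<exists>B\<in>set Q. \<rho> B \<noteq> [B]"
    proof (rule ccontr)
      assume "\<not> (\<exists>B\<in>set Q. \<rho> B \<noteq> [B])"
      then have "\<rho> B = \<rho>0 B" if "B \<in> set Q" for B using that by (simp add: \<rho>0_def)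
      then have "\<rho> = \<rho>0" using PiE_ext \<rho>(1) \<rho>0 unfolding choices_def by blast
      then show False using \<rho>(2) by simp
    qed
    then obtain B where B: "B \<in> set Q" "\<rho> B \<noteq> [B]" by blast
    have "\<rho> B \<noteq> [X]" for X using B(2) c[OF B(1)] by auto
    then have "1 < length (\<rho> B)" using ge[OF B(1)] by (cases "\<rho> B" rule: remdups_adj.cases) auto
    have "distinct Q" using assms(2) by (simp add: set_compositions_def)
    have "length Q = (\<Sum>B\<in>set Q. 1)" using \<open>distinct Q\<close> by (simp add: distinct_card)
    also have "\<dots> < (\<Sum>B\<in>set Q. length (\<rho> B))"
      using ge B(1) \<open>1 < length (\<rho> B)\<close> by (intro sum_strict_mono_ex1) auto
    also have "\<dots> = length (concat (map \<rho> Q))"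
      using \<open>distinct Q\<close> by (simp add: length_concat o_def sum_list_distinct_conv_sum_set)
    finally show ?thesis using assms(3) by auto
  qed
  have "Poly_Mapping.lookup (e_comp Q) w = (\<Sum>\<rho>\<in>?C.
      Poly_Mapping.lookup (Poly_Mapping.single (concat (map \<rho> Q)) (choice_sign (set Q) \<rho> :: 'f)) w)"
    by (simp add: e_comp_eq_sum_choices[OF assms(2)] lookup_sum)
  also have "\<dots> = (\<Sum>\<rho>\<in>{\<rho>0}.
      Poly_Mapping.lookup (Poly_Mapping.single (concat (map \<rho> Q)) (choice_sign (set Q) \<rho> :: 'f)) w)"
    using \<rho>0 \<open>finite ?C\<close> longer by (intro sum.mono_neutral_right) (auto simp: lookup_single_not_eq)
  finally show ?thesis by (simp add: map0 sign0 lookup_single when_def eq_commute)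
qed

section \<open>The principal modules and their radicals\<close>

definition scal :: "'f::field \<Rightarrow> 'f combination \<Rightarrow> 'f combination" where
  "scal a v = Poly_Mapping.map ((*) a) v"

lemma lookup_scal [simp]: "Poly_Mapping.lookup (scal a v) w = a * Poly_Mapping.lookup v w"
  by (simp add: scal_def Poly_Mapping.map.rep_eq when_def)

lemma keys_scal: "Poly_Mapping.keys (scal a v) \<subseteq> Poly_Mapping.keys v"
  by (auto simp: in_keys_iff)

lemma wedge_scal_left: "wedge (scal a x) y = scal a (wedge x y)"
proof (rule poly_mapping_eqI)
  fix k show "Poly_Mapping.lookup (wedge (scal a x) y) k = Poly_Mapping.lookup (scal a (wedge x y)) k"
    using wedge_eq_sum[OF _ keys_scal[of a x], of "Poly_Mapping.keys y" y]
      wedge_eq_sum[of "Poly_Mapping.keys x" x "Poly_Mapping.keys y" y]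
    by (simp add: lookup_sum lookup_single sum_distrib_left when_def if_distrib mult.assoc cong: if_cong)
qed

lemma wedge_scal_right: "wedge x (scal a y) = scal a (wedge x y)"
proof (rule poly_mapping_eqI)
  fix k show "Poly_Mapping.lookup (wedge x (scal a y)) k = Poly_Mapping.lookup (scal a (wedge x y)) k"
    using wedge_eq_sum[of "Poly_Mapping.keys x" x, OF _ _ _ keys_scal[of a y]]
      wedge_eq_sum[of "Poly_Mapping.keys x" x "Poly_Mapping.keys y" y]
    by (simp add: lookup_sum lookup_single sum_distrib_left when_def if_distrib mult.left_commute cong: if_cong)
qed

text \<open>
  The linear extension of the character of the semigroup that takes the value one at
  \<open>P\<close> if the partition \<open>X\<close> refines \<open>P\<close>, and zero otherwise.
  These are the irreducible characters.
\<close>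
definition chi :: "nat set \<Rightarrow> nat set set \<Rightarrow> 'f::field combination \<Rightarrow> 'f" where
  "chi A X x = (\<Sum>P\<in>Poly_Mapping.keys x.
     Poly_Mapping.lookup x P * (if refines A X (set P) then 1 else 0))"

lemma chi_single: "chi A X (Poly_Mapping.single P a) = (if refines A X (set P) then a else 0)"
  by (simp add: chi_def)

lemma single_in_comp_algebra:
  "P \<in> set_compositions A \<Longrightarrow> Poly_Mapping.single P a \<in> carrier (comp_algebra A)"
  by (simp add: comp_algebra_def)

lemma composition_of_partition:
  assumes "finite A" "partition_on A X"
  obtains P where "P \<in> set_compositions A" "set P = X"
  using finite_distinct_list[OF finite_elements[OF assms]] assms(2)
  by (auto simp: set_compositions_def)

lemma chi_onto:
  assumes "finite A" "partition_on A X"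
  shows "\<exists>r\<in>carrier (comp_algebra A). chi A X r = (a :: 'f::field)"
proof -
  obtain P where "P \<in> set_compositions A" "set P = X" using composition_of_partition[OF assms] .
  then show ?thesis
    using single_in_comp_algebra refines_refl[OF assms(2)]
    by (intro bexI[of _ "Poly_Mapping.single P a"]) (auto simp: chi_single)
qed

text \<open>
  Evaluate both characters at a composition with underlying partition \<open>Y\<close>, and at one
  with underlying partition \<open>X\<close>.
\<close>
lemma chi_determines_partition:
  assumes "finite A" "partition_on A X" "partition_on A Y"
    and "\<forall>r\<in>carrier (comp_algebra A :: ('f::field combination, 'f combination) module).
      chi A X r = 0 \<longleftrightarrow> chi A Y r = 0"
  shows "X = Y"
proof -
  have *: "refines A X' Y'"
    if Y': "partition_on A Y'"
      and eq: "\<And>r. r \<in> carrier (comp_algebra A) \<Longrightarrow> chi A X' r = (0 :: 'f) \<longleftrightarrow> chi A Y' r = 0"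
    for X' Y'
  proof -
    obtain P where P: "P \<in> set_compositions A" "set P = Y'"
      using composition_of_partition[OF assms(1) Y'] .
    have "chi A Y' (Poly_Mapping.single P (1 :: 'f)) \<noteq> 0"
      using P refines_refl[OF Y'] by (simp add: chi_single)
    then have "chi A X' (Poly_Mapping.single P (1 :: 'f)) \<noteq> 0"
      using eq[OF single_in_comp_algebra[OF P(1)]] by blast
    then show ?thesis using P(2) by (simp add: chi_single split: if_splits)
  qed
  have "refines A X Y" using assms(3,4) by (intro *) simp_all
  moreover have "refines A Y X" using assms(2,4) by (intro *) simp_all
  ultimately show ?thesis by (rule refines_asym)
qed

lemma filter_eq_singleton: "\<lbrakk>distinct u; U \<in> set u\<rbrakk> \<Longrightarrow> filter (\<lambda>B. B = U) u = [U]"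
  by (induction u) (auto simp: filter_empty_conv)

lemma meet_absorb:
  assumes "w \<in> set_compositions A" "mset u = mset w"
  shows "meet w u = w"
proof -
  have set: "set u = set w" and dist: "distinct w" "distinct u" and p: "partition_on A (set w)"
    using assms mset_eq_setD[OF assms(2)] mset_eq_imp_distinct_iff[OF assms(2)]
    by (auto simp: set_compositions_def)
  have "filter (\<lambda>B. B \<subseteq> U) u = [U]" if U: "U \<in> set w" for U
  proof -
    have "B = U" if "B \<in> set u" "B \<subseteq> U" for B
      using partition_on_disjoint[OF p, of B U] set_compositions_block(1)[OF assms(1), of B] that U set by auto
    then have "filter (\<lambda>B. B \<subseteq> U) u = filter (\<lambda>B. B = U) u" using U set by (intro filter_cong) auto
    also have "\<dots> = [U]" using U set dist(2) by (simp add: filter_eq_singleton)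
    finally show ?thesis .
  qed
  then have "map (\<lambda>U. filter (\<lambda>B. B \<subseteq> U) u) w = map (\<lambda>U. [U]) w" by (rule map_cong[OF refl])
  then have "concat (map (\<lambda>U. filter (\<lambda>B. B \<subseteq> U) u) w) = concat (map (\<lambda>U. [U]) w)" by (rule arg_cong)
  moreover have "concat (map (\<lambda>U. [U]) R) = R" for R :: "nat set list" by (induction R) auto
  moreover have "refines A (set u) (set w)" using refines_refl[OF p] set by simp
  ultimately show ?thesis using meet_refined by metis
qed

locale principal_module =
  fixes F :: "'f::field itself" and A :: "nat set" and Q :: "nat set list"
  assumes finite_A: "finite A" and Q_comp: "Q \<in> set_compositions A"
begin

abbreviation R :: "('f combination, 'f combination) module" where
  "R \<equiv> comp_algebra A"

abbreviation \<Lambda> :: "('f combination, 'f combination) module" where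
  "\<Lambda> \<equiv> Lambda_module A Q"

abbreviation e :: "nat set list \<Rightarrow> 'f combination" where
  "e \<equiv> e_comp"

text \<open>
  The rearrangements of \<open>Q\<close>; they index a basis of \<open>\<Lambda>\<close>.
\<close>
definition arr :: "nat set list set" where
  "arr = {w. mset w = mset Q}"

text \<open>
  The functional on \<open>\<Lambda>\<close> that takes the value \<open>h w\<close> at the basis
  vector \<open>e w\<close>. By unitriangularity the coordinates of a vector of
  \<open>\<Lambda>\<close> are simply its coefficients at the rearrangements of \<open>Q\<close>.
\<close>
definition pairing :: "(nat set list \<Rightarrow> 'f) \<Rightarrow> 'f combination \<Rightarrow> 'f" where
  "pairing h v = (\<Sum>w\<in>arr. h w * Poly_Mapping.lookup v w)"

lemma partition_Q: "partition_on A (set Q)" and distinct_Q: "distinct Q"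
  using Q_comp by (simp_all add: set_compositions_def)

lemma finite_arr [simp]: "finite arr"
  unfolding arr_def by (rule mset_eq_finite)

lemma arrD:
  assumes "w \<in> arr"
  shows "w \<in> set_compositions A" "set w = set Q" "length w = length Q" "distinct w"
proof -
  have w: "mset w = mset Q" using assms by (simp add: arr_def)
  show "w \<in> set_compositions A" using set_compositions_mset_cong[OF w] Q_comp by simp
  show "set w = set Q" "length w = length Q" "distinct w"
    using mset_eq_setD[OF w] mset_eq_length[OF w] mset_eq_imp_distinct_iff[OF w] distinct_Q by simp_all
qed

lemma Q_arr [simp]: "Q \<in> arr" by (simp add: arr_def)

lemma meet_arr:
  assumes "P \<in> set_compositions A" "refines A (set Q) (set P)" "w \<in> arr"
  shows "meet P w \<in> arr"
  using meet_mset[OF assms(1) arrD(1)[OF assms(3)]] assms arrD(2)[OF assms(3)] by (simp add: arr_def)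

lemma lookup_e: "\<lbrakk>w \<in> arr; u \<in> arr\<rbrakk> \<Longrightarrow> Poly_Mapping.lookup (e w) u = (if u = w then 1 else 0)"
  using lookup_e_comp[OF finite_A arrD(1), of w u] arrD(3)[of w] arrD(3)[of u] by simp

lemma act_e:
  assumes "P \<in> set_compositions A" "w \<in> arr"
  shows "wedge (Poly_Mapping.single P a) (e w) =
    (if refines A (set Q) (set P) then scal a (e (meet P w)) else 0)"
proof -
  have "scal a 0 = (0 :: 'f combination)" by (rule poly_mapping_eqI) simp
  moreover have "wedge (Poly_Mapping.single P a) (e w) = scal a (wedge (Poly_Mapping.single P 1) (e w))"
    unfolding wedge_scal_left[symmetric] by (simp add: scal_def)
  ultimately show ?thesis
    using act_e_comp_refined[where 'f = 'f, OF assms(1) arrD(1)[OF assms(2)]]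
      act_e_comp_not_refined[where 'f = 'f, OF finite_A assms(1) arrD(1)[OF assms(2)]]
    by (simp add: arrD(2)[OF assms(2)])
qed

lemma scal_e: "w \<in> arr \<Longrightarrow> wedge (Poly_Mapping.single w a) (e u) = scal a (e w)" if "u \<in> arr"
  using act_e[of w u a] that arrD(1,2)[of w] meet_absorb[of w A u] refines_refl[OF partition_Q]
  by (simp add: arr_def)

text \<open>
  The linear span of the vectors \<open>e w\<close>, described through the coordinates just
  mentioned; the defining equation is linear in \<open>v\<close>, so that closure properties are
  immediate.
\<close>
definition span :: "'f combination set" where
  "span = {v. v = (\<Sum>w\<in>arr. scal (Poly_Mapping.lookup v w) (e w))}"

lemma span_eqI:
  assumes "v \<in> span" "v' \<in> span" "\<And>w. w \<in> arr \<Longrightarrow> Poly_Mapping.lookup v w = Poly_Mapping.lookup v' w"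
  shows "v = v'"
proof -
  have "v = (\<Sum>w\<in>arr. scal (Poly_Mapping.lookup v w) (e w))" using assms(1) by (simp add: span_def)
  also have "\<dots> = (\<Sum>w\<in>arr. scal (Poly_Mapping.lookup v' w) (e w))" using assms(3) by (simp cong: sum.cong)
  also have "\<dots> = v'" using assms(2) by (simp add: span_def)
  finally show ?thesis .
qed

lemma sum_scal_e_span: "(\<Sum>w\<in>arr. scal (c w) (e w)) \<in> span"
proof -
  have "Poly_Mapping.lookup (\<Sum>w\<in>arr. scal (c w) (e w)) u = c u" if "u \<in> arr" for u
    using that by (simp add: lookup_sum lookup_e if_distrib eq_commute[of u] cong: if_cong sum.cong)
  then show ?thesis unfolding span_def by (auto intro!: sum.cong)
qed

lemma span_add: "\<lbrakk>v \<in> span; v' \<in> span\<rbrakk> \<Longrightarrow> v + v' \<in> span"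
  and span_uminus: "v \<in> span \<Longrightarrow> - v \<in> span"
  and span_scal: "v \<in> span \<Longrightarrow> scal a v \<in> span"
  and span_zero: "0 \<in> span"
proof -
  have add: "(\<Sum>w\<in>arr. scal (c w) (e w)) + (\<Sum>w\<in>arr. scal (d w) (e w)) = (\<Sum>w\<in>arr. scal (c w + d w) (e w))" for c d
    by (rule poly_mapping_eqI) (simp add: lookup_sum lookup_add sum.distrib distrib_right)
  have neg: "- (\<Sum>w\<in>arr. scal (c w) (e w)) = (\<Sum>w\<in>arr. scal (- c w) (e w))" for c
    by (rule poly_mapping_eqI) (simp add: lookup_sum sum_negf)
  have scal: "scal a (\<Sum>w\<in>arr. scal (c w) (e w)) = (\<Sum>w\<in>arr. scal (a * c w) (e w))" for c
    by (rule poly_mapping_eqI) (simp add: lookup_sum sum_distrib_left mult.assoc)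
  have zero: "(0 :: 'f combination) = (\<Sum>w\<in>arr. scal 0 (e w))"
    by (rule poly_mapping_eqI) (simp add: lookup_sum)
  show "0 \<in> span" by (subst zero) (rule sum_scal_e_span)
  { assume v: "v \<in> span"
    then have v_eq: "v = (\<Sum>w\<in>arr. scal (Poly_Mapping.lookup v w) (e w))" by (simp add: span_def)
    show "- v \<in> span" by (subst v_eq) (simp only: neg sum_scal_e_span)
    show "scal a v \<in> span" by (subst v_eq) (simp only: scal sum_scal_e_span)
    assume "v' \<in> span"
    then have v'_eq: "v' = (\<Sum>w\<in>arr. scal (Poly_Mapping.lookup v' w) (e w))" by (simp add: span_def)
    show "v + v' \<in> span" by (subst v_eq, subst v'_eq) (simp only: add sum_scal_e_span) }
qed

lemma span_sum: "(\<And>i. i \<in> I \<Longrightarrow> f i \<in> span) \<Longrightarrow> (\<Sum>i\<in>I. f i) \<in> span"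
  by (induction I rule: infinite_finite_induct) (auto intro: span_add span_zero)

lemma e_span: "w \<in> arr \<Longrightarrow> e w \<in> span"
proof -
  assume w: "w \<in> arr"
  have "e w = (\<Sum>u\<in>arr. scal (if u = w then 1 else 0) (e u))"
  proof (rule poly_mapping_eqI)
    fix k show "Poly_Mapping.lookup (e w) k = Poly_Mapping.lookup (\<Sum>u\<in>arr. scal (if u = w then 1 else 0) (e u)) k"
      using w by (simp add: lookup_sum if_distrib[of "\<lambda>x. x * _"] cong: if_cong)
  qed
  then show ?thesis by (rule ssubst) (rule sum_scal_e_span)
qed

lemma combination_eq_sum: "(x :: 'f combination) = (\<Sum>P\<in>Poly_Mapping.keys x. Poly_Mapping.single P (Poly_Mapping.lookup x P))"
  by (rule poly_mapping_eqI) (auto simp: lookup_sum lookup_single when_def in_keys_iff)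

lemma act_span:
  assumes "x \<in> carrier R" "v \<in> span"
  shows "wedge x v = (\<Sum>P\<in>Poly_Mapping.keys x. if refines A (set Q) (set P)
    then \<Sum>w\<in>arr. scal (Poly_Mapping.lookup x P * Poly_Mapping.lookup v w) (e (meet P w)) else 0)"
proof -
  have step: "wedge (Poly_Mapping.single P a) v = (if refines A (set Q) (set P)
    then \<Sum>w\<in>arr. scal (a * Poly_Mapping.lookup v w) (e (meet P w)) else 0)"
    if P: "P \<in> set_compositions A" for P a
  proof -
    have sc2: "scal a (scal b u) = scal (b * a) u" for a b and u :: "'f combination"
      by (rule poly_mapping_eqI) simp
    have sc0: "scal b 0 = (0 :: 'f combination)" for b by (rule poly_mapping_eqI) simp
    have "wedge (Poly_Mapping.single P a) v = (\<Sum>w\<in>arr. scal (Poly_Mapping.lookup v w) (wedge (Poly_Mapping.single P a) (e w)))"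
      using assms(2) by (subst (1) assms(2)[unfolded span_def, simplified]) (simp only: wedge_sum_right wedge_scal_right)
    also have "\<dots> = (\<Sum>w\<in>arr. if refines A (set Q) (set P)
       then scal (a * Poly_Mapping.lookup v w) (e (meet P w)) else 0)"
      using act_e[OF P] by (intro sum.cong refl) (simp add: sc2 sc0)
    finally show ?thesis by simp
  qed
  have "wedge x v = (\<Sum>P\<in>Poly_Mapping.keys x. wedge (Poly_Mapping.single P (Poly_Mapping.lookup x P)) v)"
    by (subst (1) combination_eq_sum) (simp only: wedge_sum_left)
  also have "\<dots> = (\<Sum>P\<in>Poly_Mapping.keys x. if refines A (set Q) (set P)
    then \<Sum>w\<in>arr. scal (Poly_Mapping.lookup x P * Poly_Mapping.lookup v w) (e (meet P w)) else 0)"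
    using assms(1) step by (intro sum.cong refl) (auto simp: comp_algebra_def)
  finally show ?thesis .
qed

lemma act_closed: "\<lbrakk>x \<in> carrier R; v \<in> span\<rbrakk> \<Longrightarrow> wedge x v \<in> span"
proof -
  assume x: "x \<in> carrier R" and v: "v \<in> span"
  show ?thesis unfolding act_span[OF x v]
    using x by (auto intro!: span_sum span_zero span_scal e_span meet_arr simp: comp_algebra_def)
qed

text \<open>
  Left multiplication sends \<open>e Q\<close> to the span by the two product formulas, and
  conversely the composition \<open>w\<close> sends \<open>e Q\<close> to \<open>e w\<close>.
\<close>
lemma carrier_\<Lambda>: "carrier \<Lambda> = span"
proof (intro equalityI subsetI)
  fix v assume "v \<in> carrier \<Lambda>"
  then show "v \<in> span" using act_closed e_span[OF Q_arr] by (auto simp: Lambda_module_def)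
next
  fix v assume v: "v \<in> span"
  define x where "x = (\<Sum>w\<in>arr. Poly_Mapping.single w (Poly_Mapping.lookup v w))"
  have "Poly_Mapping.keys x \<subseteq> (\<Union>w\<in>arr. Poly_Mapping.keys (Poly_Mapping.single w (Poly_Mapping.lookup v w)))"
    unfolding x_def by (rule keys_sum)
  also have "\<dots> \<subseteq> set_compositions A" using arrD(1) by (auto split: if_splits)
  finally have "x \<in> carrier R" by (simp add: comp_algebra_def)
  moreover have "wedge x (e Q) = v"
    using v unfolding x_def wedge_sum_left span_def by (simp add: scal_e cong: sum.cong)
  ultimately show "v \<in> carrier \<Lambda>" by (force simp: Lambda_module_def)
qed

lemma \<Lambda>_simps [simp]: "zero \<Lambda> = 0" "add \<Lambda> = (+)" "smult \<Lambda> = wedge"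
  by (simp_all add: Lambda_module_def comp_algebra_def)

lemma operator_module_\<Lambda>: "operator_module R \<Lambda>"
proof (intro operator_module.intro operator_module_axioms.intro abelian_groupI)
  fix v assume "v \<in> carrier \<Lambda>"
  then show "\<exists>u\<in>carrier \<Lambda>. u \<oplus>\<^bsub>\<Lambda>\<^esub> v = \<zero>\<^bsub>\<Lambda>\<^esub>"
    using span_uminus by (auto simp: carrier_\<Lambda> intro!: bexI[of _ "- v"])
qed (auto simp: carrier_\<Lambda> span_add span_zero act_closed wedge_add_right add_ac)

lemma pairing_add: "pairing h (v + v') = pairing h v + pairing h v'"
  by (simp add: pairing_def lookup_add distrib_left sum.distrib)

lemma pairing_e: "w \<in> arr \<Longrightarrow> pairing h (e w) = h w"
  by (simp add: pairing_def lookup_e if_distrib cong: if_cong sum.cong)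

lemma pairing_act:
  assumes "x \<in> carrier R" "v \<in> span"
  shows "pairing h (wedge x v) = (\<Sum>P\<in>Poly_Mapping.keys x. Poly_Mapping.lookup x P *
    (if refines A (set Q) (set P) then pairing (\<lambda>w. h (meet P w)) v else 0))"
proof -
  have pairing_sum: "pairing h (\<Sum>i\<in>I. f i) = (\<Sum>i\<in>I. pairing h (f i))" for I :: "'i set" and f
    by (induction I rule: infinite_finite_induct) (simp_all add: pairing_add, simp_all add: pairing_def)
  have pairing_scal: "pairing h (scal a u) = a * pairing h u" for a u
    by (simp add: pairing_def sum_distrib_left mult.left_commute)
  have pairing0: "pairing h 0 = 0" by (simp add: pairing_def)
  show ?thesis
    unfolding act_span[OF assms] pairing_sum
  proof (intro sum.cong refl)
    fix P assume "P \<in> Poly_Mapping.keys x"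
    then have "P \<in> set_compositions A" using assms(1) by (auto simp: comp_algebra_def)
    then show "pairing h (if refines A (set Q) (set P) then \<Sum>w\<in>arr. scal
        (Poly_Mapping.lookup x P * Poly_Mapping.lookup v w) (e (meet P w)) else 0) =
      Poly_Mapping.lookup x P * (if refines A (set Q) (set P) then pairing (\<lambda>w. h (meet P w)) v else 0)"
      using meet_arr by (simp add: pairing0 pairing_sum pairing_scal pairing_e cong: sum.cong)
        (simp add: pairing_def sum_distrib_left mult_ac)
  qed
qed

lemma pairing_diff: "pairing h (v - v') = pairing h v - pairing h v'"
  by (simp add: pairing_def lookup_minus right_diff_distrib sum_subtractf)

lemma pairing_single_act:
  assumes "P \<in> set_compositions A" "v \<in> span"
  shows "pairing h (wedge (Poly_Mapping.single P a) v) =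
    (if refines A (set Q) (set P) then a * pairing (\<lambda>w. h (meet P w)) v else 0)"
  using pairing_act[OF single_in_comp_algebra[OF assms(1)] assms(2)] by simp

lemma lookup_eq_pairing: "u \<in> arr \<Longrightarrow> Poly_Mapping.lookup v u = pairing (\<lambda>w. if w = u then 1 else 0) v"
  by (simp add: pairing_def if_distrib[of "\<lambda>x. x * _"] cong: if_cong)

text \<open>
  The sum of the coordinates. Its kernel \<open>K\<close> will turn out to be the radical of
  \<open>\<Lambda>\<close>.
\<close>
definition aug :: "'f combination \<Rightarrow> 'f" where
  "aug = pairing (\<lambda>_. 1)"

lemma aug_act: "\<lbrakk>x \<in> carrier R; v \<in> span\<rbrakk> \<Longrightarrow> aug (wedge x v) = chi A (set Q) x * aug v"
  unfolding aug_def chi_def sum_distrib_right by (subst pairing_act) (auto intro!: sum.cong)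

lemma aug_e: "w \<in> arr \<Longrightarrow> aug (e w) = 1"
  by (simp add: aug_def pairing_def lookup_e cong: sum.cong)

definition K :: "'f combination set" where
  "K = {v \<in> carrier \<Lambda>. aug v = 0}"

lemma chi_Q_onto: "\<exists>r\<in>carrier R. chi A (set Q) r = a"
  using finite_A partition_Q by (rule chi_onto)

text \<open>
  Multiplying by \<open>w\<close> on the left forgets the order of the blocks in the second factor,
  so it maps every basis vector to \<open>e w\<close>.
\<close>
lemma act_on_generator:
  assumes "w \<in> arr" "v \<in> span"
  shows "wedge (Poly_Mapping.single w a) v = scal (a * aug v) (e w)"
proof (rule span_eqI)
  note w = arrD[OF assms(1)]
  show "wedge (Poly_Mapping.single w a) v \<in> span"
    using act_closed single_in_comp_algebra[OF w(1)] assms(2) by blast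
  show "scal (a * aug v) (e w) \<in> span" using span_scal e_span assms(1) by blast
  fix u assume u: "u \<in> arr"
  have "meet w w' = w" if "w' \<in> arr" for w'
    using meet_absorb[OF w(1)] that assms(1) by (simp add: arr_def)
  then have "pairing (\<lambda>w'. if meet w w' = u then 1 else 0) v = (if w = u then aug v else 0)"
    by (simp add: pairing_def aug_def cong: sum.cong)
  then show "Poly_Mapping.lookup (wedge (Poly_Mapping.single w a) v) u =
      Poly_Mapping.lookup (scal (a * aug v) (e w)) u"
    using pairing_single_act[OF w(1) assms(2)] lookup_eq_pairing[OF u, of "wedge _ v"]
      refines_refl[OF partition_Q] w(2)
      lookup_e[OF assms(1) u] by simp
qed

lemma submodule_\<Lambda>D:
  assumes "submodule N R \<Lambda>"
  shows "N \<subseteq> span" "0 \<in> N" "v \<in> N \<Longrightarrow> - v \<in> N" "\<lbrakk>u \<in> N; v \<in> N\<rbrakk> \<Longrightarrow> u + v \<in> N"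
    "\<lbrakk>x \<in> carrier R; v \<in> N\<rbrakk> \<Longrightarrow> wedge x v \<in> N"
proof -
  interpret L: operator_module R \<Lambda> by (rule operator_module_\<Lambda>)
  note D = L.submoduleD[OF assms]
  show sub: "N \<subseteq> span" "0 \<in> N" "\<lbrakk>u \<in> N; v \<in> N\<rbrakk> \<Longrightarrow> u + v \<in> N"
    "\<lbrakk>x \<in> carrier R; v \<in> N\<rbrakk> \<Longrightarrow> wedge x v \<in> N" for u v x
    using D(1,2) D(4)[of u v] D(6)[of x v] by (auto simp: carrier_\<Lambda>)
  show "- v \<in> N" if "v \<in> N"
  proof -
    have "\<ominus>\<^bsub>\<Lambda>\<^esub> v = - v"
      using that sub(1) span_uminus by (intro L.minus_equality) (auto simp: carrier_\<Lambda>)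
    then show ?thesis using D(3)[OF that] by simp
  qed
qed

lemma submodule_sum:
  assumes "submodule N R \<Lambda>" "\<And>i. i \<in> I \<Longrightarrow> f i \<in> N"
  shows "(\<Sum>i\<in>I. f i) \<in> N"
  using assms(2)
  by (induction I rule: infinite_finite_induct) (auto intro: submodule_\<Lambda>D(2,4)[OF assms(1)])

lemma K_maximal: "maximal_submodule R \<Lambda> K"
proof -
  interpret L: operator_module R \<Lambda> by (rule operator_module_\<Lambda>)
  show ?thesis unfolding K_def
    using e_span[OF Q_arr] aug_e[OF Q_arr] aug_act chi_Q_onto
    by (intro L.maximal_submodule_kernel[where v = "e Q" and \<chi> = "chi A (set Q)"])
      (auto simp: carrier_\<Lambda> aug_def pairing_add)
qed

text \<open>
  A vector outside \<open>K\<close> generates every \<open>e w\<close>. Hence \<open>K\<close> is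
  the only maximal submodule.
\<close>
lemma proper_submodule_subset_K:
  assumes N: "submodule N R \<Lambda>" "N \<noteq> carrier \<Lambda>"
  shows "N \<subseteq> K"
proof
  note D = submodule_\<Lambda>D[OF N(1)]
  fix v assume v: "v \<in> N"
  have "aug v = 0"
  proof (rule ccontr)
    assume nz: "aug v \<noteq> 0"
    have "u \<in> N" if u: "u \<in> span" for u
    proof -
      have "u = (\<Sum>w\<in>arr. scal (Poly_Mapping.lookup u w) (e w))" using u by (simp add: span_def)
      also have "\<dots> = (\<Sum>w\<in>arr. wedge (Poly_Mapping.single w (Poly_Mapping.lookup u w / aug v)) v)"
        using v D(1) nz by (intro sum.cong refl) (auto simp: act_on_generator)
      also have "\<dots> \<in> N"
        using D(5)[OF single_in_comp_algebra[OF arrD(1)] v] by (intro submodule_sum[OF N(1)])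
      finally show ?thesis .
    qed
    then show False using N(2) D(1) by (auto simp: carrier_\<Lambda>)
  qed
  then show "v \<in> K" using v D(1) by (auto simp: K_def carrier_\<Lambda>)
qed

lemma module_rad_\<Lambda>: "module_rad R \<Lambda> = K"
proof -
  have "N = K" if "maximal_submodule R \<Lambda> N" for N
    using that K_maximal proper_submodule_subset_K[of N] unfolding maximal_submodule_def by blast
  then have "{N. maximal_submodule R \<Lambda> N} = {K}" using K_maximal by blast
  then show ?thesis by (auto simp: module_rad_def K_def)
qed

lemma M_module_iso: "module_iso R (M_module A Q) (char_module (chi A (set Q)))"
proof -
  interpret L: operator_module R \<Lambda> by (rule operator_module_\<Lambda>)
  show ?thesis unfolding M_module_def module_rad_\<Lambda> K_def
    using e_span[OF Q_arr] aug_e[OF Q_arr] aug_act chi_Q_onto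
    by (intro L.module_iso_char_moduleI[where v = "e Q"]) (auto simp: carrier_\<Lambda> aug_def pairing_add)
qed

lemma operator_module_M: "operator_module R (M_module A Q)"
  unfolding M_module_def module_rad_\<Lambda>
  using operator_module.quot_module_operator_module[OF operator_module_\<Lambda>] K_maximal
  by (auto simp: maximal_submodule_def)

end

section \<open>The first Loewy layer of a principal module\<close>

text \<open>
  For distinct blocks \<open>a\<close> and \<open>b\<close> of a partition \<open>X\<close>, these
  are the partitions that cover \<open>X\<close> in the order by refinement.
\<close>
definition merge :: "'a set \<Rightarrow> 'a set \<Rightarrow> 'a set set \<Rightarrow> 'a set set" where
  "merge a b X = insert (a \<union> b) (X - {a, b})"

text \<open>
  For distinct \<open>a\<close> and \<open>b\<close>: each occurs exactly once, \<open>a\<close>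
  first. Filters, unlike positions, commute with the concatenations that describe
  \<open>meet\<close>.
\<close>
definition before :: "'a \<Rightarrow> 'a \<Rightarrow> 'a list \<Rightarrow> bool" where
  "before a b w \<longleftrightarrow> filter (\<lambda>x. x = a \<or> x = b) w = [a, b]"

lemma partition_on_merge:
  assumes X: "partition_on A X" "a \<in> X" "b \<in> X"
  shows "partition_on A (merge a b X)"
proof (rule partition_onI)
  show "\<Union>(merge a b X) = A" using X by (auto simp: merge_def partition_on_def)
  show "{} \<notin> merge a b X" using X by (auto simp: merge_def partition_on_def)
  show "disjnt p q" if pq: "p \<in> merge a b X" "q \<in> merge a b X" "p \<noteq> q" for p q
  proof -
    have *: "disjnt x y" if "x \<in> X" "y \<in> X" "x \<noteq> y" for x y
      using partition_on_disjoint[OF X(1)] that by (simp add: disjnt_def)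
    have out: "disjnt (a \<union> b) x" if "x \<in> X - {a, b}" for x
      using *[of a x] *[of b x] X(2,3) that by (auto simp: disjnt_Un1)
    consider "p = a \<union> b" "q \<in> X - {a, b}" | "q = a \<union> b" "p \<in> X - {a, b}" | "p \<in> X" "q \<in> X"
      using pq unfolding merge_def by blast
    then show ?thesis using out *[OF _ _ \<open>p \<noteq> q\<close>] by cases (auto intro: disjnt_sym)
  qed
qed

lemma refines_merge:
  assumes "partition_on A X" "a \<in> X" "b \<in> X"
  shows "refines A X (merge a b X)"
  using assms partition_on_merge[OF assms] by (auto simp: refines_def merge_def)

lemma refines_merge_iff:
  assumes X: "partition_on A X" "a \<in> X" "b \<in> X"
  shows "refines A (merge a b X) Y \<longleftrightarrow> refines A X Y \<and> (\<exists>S\<in>Y. a \<union> b \<subseteq> S)"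
proof
  assume r: "refines A (merge a b X) Y"
  then show "refines A X Y \<and> (\<exists>S\<in>Y. a \<union> b \<subseteq> S)"
    using refines_trans[OF refines_merge[OF X] r] by (auto simp: refines_def merge_def)
next
  assume "refines A X Y \<and> (\<exists>S\<in>Y. a \<union> b \<subseteq> S)"
  then show "refines A (merge a b X) Y"
    using partition_on_merge[OF X] by (auto simp: refines_def merge_def)
qed

lemma before_distinct:
  assumes "distinct w" "before a b w"
  shows "a \<in> set w" "b \<in> set w" "a \<noteq> b" "\<not> before b a w"
proof -
  have "set (filter (\<lambda>x. x = a \<or> x = b) w) = {a, b}" using assms(2) by (simp add: before_def)
  then show "a \<in> set w" "b \<in> set w" by auto
  have "distinct (filter (\<lambda>x. x = a \<or> x = b) w)" using assms(1) by simp
  then have "distinct [a, b]" using assms(2) by (simp only: before_def)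
  then show "a \<noteq> b" by simp
  moreover have "filter (\<lambda>x. x = b \<or> x = a) w = [a, b]"
    using assms(2) unfolding before_def by (simp add: disj_commute)
  ultimately show "\<not> before b a w" by (simp add: before_def)
qed

lemma before_total:
  assumes "distinct w" "a \<in> set w" "b \<in> set w" "a \<noteq> b"
  shows "before a b w \<or> before b a w"
  using assms
proof (induction w)
  case (Cons x w)
  show ?case
  proof -
    consider "x = a" | "x = b" | "x \<noteq> a" "x \<noteq> b" by blast
    then show ?thesis
    proof cases
      case 1
      then have "filter (\<lambda>x. x = a \<or> x = b) w = filter (\<lambda>x. x = b) w"
        using Cons.prems(1) by (intro filter_cong) auto
      then show ?thesis using 1 Cons.prems filter_eq_singleton[of w b] by (simp add: before_def)
    next
      case 2
      then have "filter (\<lambda>x. x = b \<or> x = a) w = filter (\<lambda>x. x = a) w"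
        using Cons.prems(1) by (intro filter_cong) auto
      then show ?thesis using 2 Cons.prems filter_eq_singleton[of w a] by (simp add: before_def)
    qed (use Cons in \<open>auto simp: before_def\<close>)
  qed
qed simp

text \<open>
  Multiplication by \<open>P\<close> is a stable sort of \<open>w\<close> by the blocks of
  \<open>P\<close>: it keeps the order of two entries of the same block, and the next lemma says
  that otherwise \<open>P\<close> alone decides.
\<close>
lemma before_meet_same:
  assumes r: "refines A (set w) (set P)" and dist: "distinct P"
    and ab: "a \<in> set w" "b \<in> set w" and S: "S \<in> set P" "a \<union> b \<subseteq> S"
  shows "before a b (meet P w) \<longleftrightarrow> before a b w"
proof -
  have p: "partition_on A (set P)" "partition_on A (set w)" using r by (auto simp: refines_def)
  have ne: "a \<noteq> {}" "b \<noteq> {}" using ab p(2) by (auto simp: partition_on_def)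
  have only: "\<not> a \<subseteq> U \<and> \<not> b \<subseteq> U" if "U \<in> set P" "U \<noteq> S" for U
    using partition_on_disjoint[OF p(1) that(1) S(1) that(2)] S(2) ne by blast
  have eq: "filter (\<lambda>x. x = a \<or> x = b) (filter (\<lambda>B. B \<subseteq> U) w) =
      (if U = S then filter (\<lambda>x. x = a \<or> x = b) w else [])" if "U \<in> set P" for U
    using only[OF that] S(2) by (auto simp: filter_empty_conv intro!: filter_cong)
  have "concat (map (\<lambda>U. if U = S then xs else []) P) = xs" if "S \<in> set P" for xs :: "nat set list"
    using that dist by (induction P) (auto simp: concat_eq_Nil_conv)
  then have "filter (\<lambda>x. x = a \<or> x = b) (meet P w) = filter (\<lambda>x. x = a \<or> x = b) w"
    using S(1) eq unfolding meet_refined[OF r] filter_concat map_map o_def by (simp cong: map_cong)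
  then show ?thesis by (simp add: before_def)
qed

lemma before_meet_apart:
  assumes r: "refines A (set w) (set P)" and w: "distinct w" "distinct w'" "set w' = set w"
    and apart: "\<not> (\<exists>S\<in>set P. a \<union> b \<subseteq> S)"
  shows "before a b (meet P w) \<longleftrightarrow> before a b (meet P w')"
proof -
  have "filter (\<lambda>x. x = a \<or> x = b) (filter (\<lambda>B. B \<subseteq> U) w) =
      filter (\<lambda>x. x = a \<or> x = b) (filter (\<lambda>B. B \<subseteq> U) w')" if "U \<in> set P" for U
  proof -
    \<comment> \<open>A block U of P contains at most one of a and b, so both filters see at most one entry.\<close>
    have "\<exists>c. \<forall>x. (x = a \<or> x = b) \<and> x \<subseteq> U \<longrightarrow> x = c" using apart that by blast
    then obtain c where c: "\<And>x. (x = a \<or> x = b) \<and> x \<subseteq> U \<Longrightarrow> x = c" by blast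
    have "filter (\<lambda>x. x = a \<or> x = b) (filter (\<lambda>B. B \<subseteq> U) u) =
        (if c \<in> set u \<and> (c = a \<or> c = b) \<and> c \<subseteq> U then [c] else [])" if "distinct u" for u
    proof -
      have "filter (\<lambda>x. x = a \<or> x = b) (filter (\<lambda>B. B \<subseteq> U) u) =
          filter (\<lambda>x. x = c \<and> (c = a \<or> c = b) \<and> c \<subseteq> U) u"
        unfolding filter_filter using c by (intro filter_cong) auto
      then show ?thesis using filter_eq_singleton[OF that, of c] by (auto simp: filter_empty_conv)
    qed
    then show ?thesis using w by simp
  qed
  then have "filter (\<lambda>x. x = a \<or> x = b) (meet P w) = filter (\<lambda>x. x = a \<or> x = b) (meet P w')"
    using r w(3) unfolding meet_refined[OF r] meet_refined[of A w' P, unfolded w(3), OF r]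
      filter_concat map_map o_def by (simp cong: map_cong)
  then show ?thesis by (simp add: before_def)
qed

context principal_module
begin

definition K_module :: "('f combination, 'f combination) module" where
  "K_module = sub_module \<Lambda> K"

text \<open>
  Each two-element set of blocks of \<open>Q\<close> is represented once, in the order in which
  \<open>Q\<close> lists it.
\<close>
definition block_pairs :: "(nat set \<times> nat set) set" where
  "block_pairs = {(a, b). before a b Q}"

text \<open>
  The total weight of the rearrangements in which \<open>a\<close> precedes \<open>b\<close>.
  Restricted to \<open>K\<close>, these functionals will be the coordinates of the first Loewy
  layer.
\<close>
definition order_coord :: "nat set \<times> nat set \<Rightarrow> 'f combination \<Rightarrow> 'f" where
  "order_coord = (\<lambda>(a, b). pairing (\<lambda>w. if before a b w then 1 else 0))"

abbreviation chi_pair :: "nat set \<times> nat set \<Rightarrow> 'f combination \<Rightarrow> 'f" where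
  "chi_pair \<equiv> (\<lambda>(a, b). chi A (merge a b (set Q)))"

lemma K_module_simps [simp]: "carrier K_module = K" "zero K_module = 0" "add K_module = (+)" "smult K_module = wedge"
  by (simp_all add: K_module_def)

lemma submodule_K: "submodule K R \<Lambda>"
  using K_maximal by (simp add: maximal_submodule_def)

lemma K_span: "v \<in> K \<Longrightarrow> v \<in> span"
  by (simp add: K_def carrier_\<Lambda>)

lemma operator_module_K_module: "operator_module R K_module"
  unfolding K_module_def using operator_module.sub_module_operator_module[OF operator_module_\<Lambda> submodule_K] .

lemma block_pairsD:
  assumes "(a, b) \<in> block_pairs"
  shows "a \<in> set Q" "b \<in> set Q" "a \<noteq> b" "(b, a) \<notin> block_pairs" "partition_on A (merge a b (set Q))"
  using before_distinct[OF distinct_Q, of a b] partition_on_merge[OF partition_Q] assms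
  by (auto simp: block_pairs_def)

lemma finite_block_pairs: "finite block_pairs"
  by (rule finite_subset[of _ "set Q \<times> set Q"]) (auto dest: block_pairsD)

text \<open>
  If \<open>a\<close> and \<open>b\<close> lie in the same block of \<open>P\<close>, then
  \<open>P\<close> preserves their order. Otherwise \<open>P\<close> imposes an order, and the
  functional becomes a multiple of \<open>aug\<close>, which is zero on \<open>K\<close>.
\<close>
lemma order_coord_act:
  assumes "x \<in> carrier R" "v \<in> K" "(a, b) \<in> block_pairs"
  shows "order_coord (a, b) (wedge x v) = chi A (merge a b (set Q)) x * order_coord (a, b) v"
proof -
  let ?h = "\<lambda>w. if before a b w then 1 else 0 :: 'f"
  note ab = block_pairsD[OF assms(3)]
  have aug: "pairing (\<lambda>w. c) v = 0" for c
  proof -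
    have "pairing (\<lambda>w. c) v = c * aug v" by (simp add: aug_def pairing_def sum_distrib_left)
    then show ?thesis using assms(2) by (simp add: K_def)
  qed
  have "(if refines A (set Q) (set P) then pairing (\<lambda>w. ?h (meet P w)) v else 0) =
      (if refines A (merge a b (set Q)) (set P) then pairing ?h v else 0)"
    if P: "P \<in> set_compositions A" for P
  proof (cases "refines A (set Q) (set P)")
    case r: True
    note iff = refines_merge_iff[OF partition_Q ab(1,2), of "set P"]
    show ?thesis
    proof (cases "\<exists>S\<in>set P. a \<union> b \<subseteq> S")
      case True
      then obtain S where S: "S \<in> set P" "a \<union> b \<subseteq> S" by blast
      have "before a b (meet P w) \<longleftrightarrow> before a b w" if "w \<in> arr" for w
        using r P S ab(1,2) arrD(2)[OF that]
        by (intro before_meet_same[where S = S and A = A]) (auto simp: set_compositions_def)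
      then have "pairing (\<lambda>w. ?h (meet P w)) v = pairing ?h v"
        unfolding pairing_def by (intro sum.cong) auto
      then show ?thesis using iff r True by simp
    next
      case False
      have "before a b (meet P w) \<longleftrightarrow> before a b (meet P Q)" if "w \<in> arr" for w
        using r False arrD(2,4)[OF that] distinct_Q by (intro before_meet_apart[where A = A]) auto
      then have "pairing (\<lambda>w. ?h (meet P w)) v = pairing (\<lambda>w. ?h (meet P Q)) v"
        unfolding pairing_def by (intro sum.cong refl) (simp only:)
      moreover have "\<not> refines A (merge a b (set Q)) (set P)" using iff False by blast
      ultimately show ?thesis using r aug by simp
    qed
  next
    case False
    then show ?thesis using refines_merge_iff[OF partition_Q ab(1,2), of "set P"] by simp
  qed
  note key = this
  show ?thesis
    unfolding order_coord_def prod.case pairing_act[OF assms(1) K_span[OF assms(2)]] chi_def sum_distrib_right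
  proof (intro sum.cong refl)
    fix P assume "P \<in> Poly_Mapping.keys x"
    then have P: "P \<in> set_compositions A" using assms(1) by (auto simp: comp_algebra_def)
    show "Poly_Mapping.lookup x P * (if refines A (set Q) (set P) then pairing (\<lambda>w. ?h (meet P w)) v else 0) =
        Poly_Mapping.lookup x P * (if refines A (merge a b (set Q)) (set P) then 1 else 0) * pairing ?h v"
      unfolding key[OF P] by simp
  qed
qed

definition delta :: "nat set list \<Rightarrow> nat set list \<Rightarrow> 'f combination" where
  "delta u w = e u - e w"

lemma lookup_delta: "\<lbrakk>u \<in> arr; w \<in> arr; z \<in> arr\<rbrakk> \<Longrightarrow>
  Poly_Mapping.lookup (delta u w) z = (if z = u then 1 else 0) - (if z = w then 1 else 0)"
  by (simp add: delta_def lookup_minus lookup_e)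

lemma delta_K: "\<lbrakk>u \<in> arr; w \<in> arr\<rbrakk> \<Longrightarrow> delta u w \<in> K"
  using span_add[of "e u" "- e w"] span_uminus e_span aug_e
  by (simp add: K_def carrier_\<Lambda> delta_def aug_def pairing_diff)

lemma order_coord_delta:
  assumes "u \<in> arr" "w \<in> arr"
  shows "order_coord (a, b) (delta u w) = (if before a b u then 1 else 0) - (if before a b w then 1 else 0)"
  using assms by (simp add: order_coord_def delta_def pairing_diff pairing_e)

lemma adjacent_arr:
  assumes "pre @ a # b # post \<in> arr"
  shows "pre @ b # a # post \<in> arr" "(pre @ (a \<union> b) # post) \<in> set_compositions A"
    "set (pre @ (a \<union> b) # post) = merge a b (set Q)" "before a b (pre @ a # b # post)"
proof -
  note w = arrD[OF assms]
  show "pre @ b # a # post \<in> arr" using assms by (simp add: arr_def add_mset_commute)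
  have "a \<union> b \<notin> set Q"
  proof
    assume "a \<union> b \<in> set Q"
    then have "a \<union> b = a" "a \<union> b = b"
      using partition_on_disjoint[OF partition_Q, of "a \<union> b" a] partition_on_disjoint[OF partition_Q, of "a \<union> b" b]
        set_compositions_block(1)[OF Q_comp, of a] set_compositions_block(1)[OF Q_comp, of b] w(2) by auto
    then show False using w(4) by auto
  qed
  moreover show set: "set (pre @ (a \<union> b) # post) = merge a b (set Q)"
    using w(2,4) unfolding merge_def by auto
  ultimately have "distinct (pre @ (a \<union> b) # post)" using w(2,4) by auto
  then show "(pre @ (a \<union> b) # post) \<in> set_compositions A"
    using partition_on_merge[OF partition_Q, of a b] w(2) set by (auto simp: set_compositions_def)
  have "filter (\<lambda>x. x = a \<or> x = b) pre = []" "filter (\<lambda>x. x = a \<or> x = b) post = []"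
    using w(4) by (auto simp: filter_empty_conv)
  then show "before a b (pre @ a # b # post)" by (simp add: before_def)
qed

text \<open>
  Multiplication by this composition moves every rearrangement to one of the two lists that differ
  only in the order of \<open>a\<close> and \<open>b\<close>; on \<open>K\<close> the two resulting
  coefficients are opposite.
\<close>
lemma merged_face_act:
  assumes w: "pre @ a # b # post \<in> arr" and v: "v \<in> K"
  shows "wedge (Poly_Mapping.single (pre @ (a \<union> b) # post) c) v =
    scal (c * order_coord (a, b) v) (delta (pre @ a # b # post) (pre @ b # a # post))"
proof (rule span_eqI)
  let ?T = "pre @ (a \<union> b) # post" and ?w = "pre @ a # b # post" and ?w' = "pre @ b # a # post"
  note T = adjacent_arr[OF w]
  note dist = arrD(4)[OF w]
  show "wedge (Poly_Mapping.single ?T c) v \<in> span"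
    using act_closed single_in_comp_algebra[OF T(2)] K_span[OF v] by blast
  show "scal (c * order_coord (a, b) v) (delta ?w ?w') \<in> span"
    using span_scal K_span delta_K w T(1) by blast
  fix z assume z: "z \<in> arr"
  have ab: "a \<in> set Q" "b \<in> set Q" "a \<noteq> b" using arrD(2)[OF w] dist by auto
  have r: "refines A (set Q) (set ?T)"
    unfolding T(3) using refines_merge[OF partition_Q ab(1,2)] .
  have meet: "meet ?T u = (if before a b u then ?w else ?w')" if u: "u \<in> arr" for u
  proof -
    note ud = arrD[OF u]
    have sub: "B \<subseteq> U \<longleftrightarrow> B = U" if "U \<in> set Q" "B \<in> set Q" for U B
      using partition_on_disjoint[OF partition_Q that] set_compositions_block(1)[OF Q_comp that(2)] by auto
    have single: "filter (\<lambda>B. B \<subseteq> U) u = [U]" if "U \<in> set Q" for U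
    proof -
      have "filter (\<lambda>B. B \<subseteq> U) u = filter (\<lambda>B. B = U) u"
        using sub[OF that] ud(2) by (intro filter_cong) auto
      then show ?thesis using filter_eq_singleton[OF ud(4)] that ud(2) by simp
    qed
    have "filter (\<lambda>B. B \<subseteq> a \<union> b) u = filter (\<lambda>B. B = a \<or> B = b) u"
    proof (rule filter_cong[OF refl])
      fix B assume B: "B \<in> set u"
      have "B \<noteq> {}" using set_compositions_block(1)[OF ud(1) B] .
      then show "B \<subseteq> a \<union> b \<longleftrightarrow> B = a \<or> B = b"
        using partition_on_disjoint[OF partition_Q, of B a] partition_on_disjoint[OF partition_Q, of B b]
          ab B ud(2) by auto
    qed
    also have "\<dots> = (if before a b u then [a, b] else [b, a])"
      using before_total[OF ud(4), of a b] ab ud(2) by (auto simp: before_def disj_commute)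
    finally have mid: "filter (\<lambda>B. B \<subseteq> a \<union> b) u = (if before a b u then [a, b] else [b, a])" .
    have singles: "concat (map (\<lambda>U. filter (\<lambda>B. B \<subseteq> U) u) xs) = xs" if "set xs \<subseteq> set Q" for xs
      using that by (induction xs) (auto simp: single)
    have "set pre \<subseteq> set Q" "set post \<subseteq> set Q" using arrD(2)[OF w] by auto
    then show ?thesis
      using meet_refined[of A u ?T] r ud(2) by (simp add: singles mid)
  qed
  \<comment> \<open>Write the indicator as an affine function of the indicator of a before b.\<close>
  have "pairing (\<lambda>u. if meet ?T u = z then 1 else 0) v =
      pairing (\<lambda>u. (if ?w' = z then 1 else 0) + ((if ?w = z then 1 else 0) - (if ?w' = z then 1 else 0)) *
        (if before a b u then 1 else 0)) v"
    unfolding pairing_def using meet by (intro sum.cong) auto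
  also have "\<dots> = (if ?w' = z then 1 else 0) * aug v +
      ((if ?w = z then 1 else 0) - (if ?w' = z then 1 else 0)) * order_coord (a, b) v"
    by (simp add: pairing_def aug_def order_coord_def sum.distrib sum_distrib_left distrib_right mult.assoc)
  finally have "pairing (\<lambda>u. if meet ?T u = z then 1 else 0) v =
      ((if ?w = z then 1 else 0) - (if ?w' = z then 1 else 0)) * order_coord (a, b) v"
    using v by (simp add: K_def)
  then show "Poly_Mapping.lookup (wedge (Poly_Mapping.single ?T c) v) z =
      Poly_Mapping.lookup (scal (c * order_coord (a, b) v) (delta ?w ?w')) z"
    using pairing_single_act[OF T(2) K_span[OF v]] lookup_eq_pairing[OF z, of "wedge _ v"] r
      lookup_delta[OF w T(1) z] by (auto simp: eq_commute[of z])
qed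

text \<open>
  Submodules are closed under scalars because the one-block composition (the empty one if
  \<open>A\<close> is empty) acts as the identity.
\<close>
lemma scal_closed:
  assumes N: "submodule N R \<Lambda>" and v: "v \<in> N"
  shows "scal a v \<in> N"
proof -
  define I where "I = (if A = {} then [] else [A])"
  have I: "I \<in> set_compositions A" by (auto simp: I_def)
  have r: "refines A (set Q) (set I)"
    using partition_Q I set_compositions_block(1,2)[OF Q_comp]
    by (cases Q) (auto simp: refines_def set_compositions_def I_def)
  have vs: "v \<in> span" using submodule_\<Lambda>D(1)[OF N] v by blast
  have "wedge (Poly_Mapping.single I a) v = scal a v"
  proof (rule span_eqI)
    show "wedge (Poly_Mapping.single I a) v \<in> span" using act_closed single_in_comp_algebra[OF I] vs by blast
    show "scal a v \<in> span" using span_scal vs by blast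
    fix u assume u: "u \<in> arr"
    have "meet I w = w" if "w \<in> arr" for w
      using trace_superset[OF arrD(1)[OF that]] arrD(1)[OF that]
      by (cases "A = {}"; cases w) (auto simp: I_def meet_eq_concat_trace)
    then have "pairing (\<lambda>w. if meet I w = u then 1 else 0) v = pairing (\<lambda>w. if w = u then 1 else 0) v"
      unfolding pairing_def by (intro sum.cong) auto
    then show "Poly_Mapping.lookup (wedge (Poly_Mapping.single I a) v) u = Poly_Mapping.lookup (scal a v) u"
      using pairing_single_act[OF I vs] lookup_eq_pairing[OF u, of "wedge _ v"] lookup_eq_pairing[OF u, of v] r
      by simp
  qed
  then show ?thesis using submodule_\<Lambda>D(5)[OF N single_in_comp_algebra[OF I] v] by metis
qed

text \<open>
  Any two rearrangements are connected by adjacent transpositions, so the differences along such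
  transpositions span all differences \<open>e u - e w\<close>, and these span \<open>K\<close>.
\<close>
lemma K_generated_by_swaps:
  assumes N: "submodule N R \<Lambda>"
    and adj: "\<And>pre a b post. pre @ a # b # post \<in> arr \<Longrightarrow>
      delta (pre @ a # b # post) (pre @ b # a # post) \<in> N"
  shows "K \<subseteq> N"
proof
  note D = submodule_\<Lambda>D[OF N]
  have trans: "delta u z \<in> N" if "delta u w \<in> N" "delta w z \<in> N" for u w z
    using D(4)[OF that] by (simp add: delta_def)
  have refl: "delta u u \<in> N" for u using D(2) by (simp add: delta_def)
  \<comment> \<open>Move x to the left past u, one step at a time.\<close>
  have move: "delta (pre @ u @ x # v) (pre @ x # u @ v) \<in> N" if "pre @ u @ x # v \<in> arr" for pre u x v
    using that
  proof (induction u arbitrary: pre)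
    case (Cons y u)
    have "delta (pre @ y # u @ x # v) (pre @ y # x # u @ v) \<in> N"
      using Cons.IH[of "pre @ [y]"] Cons.prems by simp
    moreover have "pre @ y # x # u @ v \<in> arr" using Cons.prems by (simp add: arr_def add_mset_commute)
    then have "delta (pre @ y # x # u @ v) (pre @ x # y # u @ v) \<in> N" by (rule adj)
    ultimately show ?case unfolding append_Cons by (rule trans)
  qed (simp add: refl)
  \<comment> \<open>Bring the head of the target to its place, then continue behind it.\<close>
  have perm: "delta (pre @ xs) (pre @ ys) \<in> N" if "mset xs = mset ys" "pre @ xs \<in> arr" for pre xs ys
    using that
  proof (induction ys arbitrary: pre xs)
    case (Cons y ys)
    then have "y \<in> set xs" by (metis list.set_intros(1) mset_eq_setD)
    then obtain u v where xs: "xs = u @ y # v" by (meson split_list)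
    have "delta (pre @ u @ y # v) (pre @ y # u @ v) \<in> N" using move Cons.prems xs by simp
    moreover have "delta ((pre @ [y]) @ u @ v) ((pre @ [y]) @ ys) \<in> N"
      using Cons.prems xs by (intro Cons.IH) (simp_all add: arr_def)
    ultimately show ?case unfolding xs append_assoc append_Cons append_Nil by (rule trans)
  qed (simp add: refl)
  fix v assume v: "v \<in> K"
  have "v = (\<Sum>w\<in>arr. scal (Poly_Mapping.lookup v w) (e w))" using K_span[OF v] by (simp add: span_def)
  \<comment> \<open>The last summand vanishes because v lies in K.\<close>
  also have "\<dots> = (\<Sum>w\<in>arr. scal (Poly_Mapping.lookup v w) (delta w Q)) + scal (aug v) (e Q)"
    by (rule poly_mapping_eqI)
      (simp add: lookup_sum lookup_add delta_def lookup_minus right_diff_distrib sum_subtractf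
        aug_def pairing_def sum_distrib_right)
  also have "scal (aug v) (e Q) = 0" using v by (intro poly_mapping_eqI) (simp add: K_def)
  also have "(\<Sum>w\<in>arr. scal (Poly_Mapping.lookup v w) (delta w Q)) + 0 \<in> N"
    using perm[of _ Q "[]"] unfolding add_0_right
    by (intro submodule_sum[OF N] scal_closed[OF N]) (auto simp: arr_def)
  finally show "v \<in> N" .
qed

text \<open>
  The common kernel of the coordinates, to be identified with the radical of \<open>K\<close>.
\<close>
definition K_rad :: "'f combination set" where
  "K_rad = {v \<in> K. \<forall>c\<in>block_pairs. order_coord c v = 0}"

lemma order_coord_add: "order_coord c (v + v') = order_coord c v + order_coord c v'"
  by (cases c) (simp add: order_coord_def pairing_add)

lemma chi_pair_onto: "(a, b) \<in> block_pairs \<Longrightarrow> \<exists>r\<in>carrier R. chi A (merge a b (set Q)) r = c"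
  using chi_onto[OF finite_A block_pairsD(5)] by blast

lemma adjacent_rearrangement:
  assumes "(a, b) \<in> block_pairs"
  obtains post where "[] @ a # b # post \<in> arr"
proof
  let ?post = "filter (\<lambda>x. \<not> (x = a \<or> x = b)) Q"
  have "mset Q = mset (filter (\<lambda>x. x = a \<or> x = b) Q) + mset ?post"
    by (metis mset_filter multiset_partition)
  also have "filter (\<lambda>x. x = a \<or> x = b) Q = [a, b]" using assms by (simp add: block_pairs_def before_def)
  finally show "[] @ a # b # ?post \<in> arr" by (simp add: arr_def)
qed

lemma kernel_order_coord_maximal:
  assumes "(a, b) \<in> block_pairs"
  shows "maximal_submodule R K_module {v \<in> carrier K_module. order_coord (a, b) v = 0}"
proof -
  interpret K_module: operator_module R K_module by (rule operator_module_K_module)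
  obtain post where w: "[] @ a # b # post \<in> arr" using adjacent_rearrangement[OF assms] .
  note w' = adjacent_arr[OF w]
  have "\<not> before a b (b # a # post)"
    using before_distinct(4)[of "a # b # post" a b] adjacent_arr(4)[OF w'(1)] arrD(4)[OF w'(1)]
      before_distinct(4)[of "b # a # post" b a] by auto
  then have "order_coord (a, b) (delta (a # b # post) (b # a # post)) = 1"
    using order_coord_delta[OF w w'(1)] w'(4) by simp
  then show ?thesis
    using delta_K[OF w w'(1)] order_coord_act[OF _ _ assms] chi_pair_onto[OF assms] order_coord_add
    by (intro K_module.maximal_submodule_kernel[where v = "delta (a # b # post) (b # a # post)"
          and \<chi> = "chi A (merge a b (set Q))"]) auto
qed

lemma submodule_K_module_\<Lambda>: "submodule N R K_module \<Longrightarrow> submodule N R \<Lambda>"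
proof -
  assume N: "submodule N R K_module"
  interpret L: operator_module R \<Lambda> by (rule operator_module_\<Lambda>)
  interpret K_module: operator_module R K_module by (rule operator_module_K_module)
  note D = K_module.submoduleD[OF N]
  show ?thesis
  proof (rule L.submoduleI)
    fix v assume v: "v \<in> N"
    then have "v \<in> K" using D(1) by auto
    then have "- v \<in> K" using submodule_\<Lambda>D(3)[OF submodule_K] by blast
    have "\<ominus>\<^bsub>K_module\<^esub> v = - v" using \<open>v \<in> K\<close> \<open>- v \<in> K\<close> by (intro K_module.minus_equality) auto
    moreover have "\<ominus>\<^bsub>\<Lambda>\<^esub> v = - v" using K_span \<open>v \<in> K\<close> \<open>- v \<in> K\<close>
      by (intro L.minus_equality) (auto simp: carrier_\<Lambda>)
    ultimately show "\<ominus>\<^bsub>\<Lambda>\<^esub> v \<in> N" using D(3)[OF v] by simp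
  qed (use D(1,2,4,6) K_span in \<open>auto simp: carrier_\<Lambda>\<close>)
qed

text \<open>
  A proper submodule \<open>N\<close> misses the difference of two rearrangements that differ by an
  adjacent transposition of \<open>a\<close> and \<open>b\<close>. The composition that merges
  \<open>a\<close> with \<open>b\<close> would map any vector of \<open>N\<close> with non-zero
  coordinate to a non-zero multiple of this difference; so the coordinate vanishes on
  \<open>N\<close>, and a maximal \<open>N\<close> is its kernel.
\<close>
lemma maximal_submodule_K_module:
  assumes N: "maximal_submodule R K_module N"
  obtains c where "c \<in> block_pairs" "N = {v \<in> carrier K_module. order_coord c v = 0}"
proof -
  have NJ: "submodule N R K_module" "N \<noteq> K" using N by (auto simp: maximal_submodule_def)
  note sub = submodule_K_module_\<Lambda>[OF NJ(1)]
  note D = submodule_\<Lambda>D[OF sub]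
  have NK: "N \<subseteq> K"
    using operator_module.submoduleD(1)[OF operator_module_K_module NJ(1)] by simp
  then have "\<not> K \<subseteq> N" using NJ(2) by blast
  then obtain pre a b post where w: "pre @ a # b # post \<in> arr"
    and notin: "delta (pre @ a # b # post) (pre @ b # a # post) \<notin> N"
    using K_generated_by_swaps[OF sub] by blast
  note w' = adjacent_arr[OF w]
  have ab: "a \<in> set Q" "b \<in> set Q" "a \<noteq> b" using arrD(2,4)[OF w] by auto
  have zero: "order_coord (a, b) v = 0" if v: "v \<in> N" for v
  proof (rule ccontr)
    assume nz: "order_coord (a, b) v \<noteq> 0"
    let ?x = "Poly_Mapping.single (pre @ (a \<union> b) # post) (1 / order_coord (a, b) v)"
    have "wedge ?x v = scal 1 (delta (pre @ a # b # post) (pre @ b # a # post))"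
      using merged_face_act[OF w, of v] v NK nz by auto
    also have "\<dots> = delta (pre @ a # b # post) (pre @ b # a # post)"
      by (rule poly_mapping_eqI) simp
    finally show False
      using D(5)[OF single_in_comp_algebra[OF w'(2)] v] notin by metis
  qed
  \<comment> \<open>The pair may be listed in the other order in Q; the two coordinates differ by a sign on K.\<close>
  have neg: "order_coord (b, a) v = - order_coord (a, b) v" if "v \<in> K" for v
  proof -
    have "before b a w = (\<not> before a b w)" if "w \<in> arr" for w
      using before_total[OF arrD(4)[OF that], of a b] before_distinct(4)[OF arrD(4)[OF that]]
        arrD(2)[OF that] ab by auto
    then have "order_coord (a, b) v + order_coord (b, a) v = aug v"
      unfolding order_coord_def prod.case pairing_def aug_def sum.distrib[symmetric]
      by (intro sum.cong) auto
    then show ?thesis using that by (simp add: K_def eq_neg_iff_add_eq_0 add.commute)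
  qed
  have "(a, b) \<in> block_pairs \<or> (b, a) \<in> block_pairs"
    using before_total[OF distinct_Q ab] by (simp add: block_pairs_def)
  then obtain c where c: "c \<in> block_pairs" "\<And>v. v \<in> N \<Longrightarrow> order_coord c v = 0"
    using zero neg NK by fastforce
  obtain a' b' where ab': "c = (a', b')" by (cases c)
  have max: "maximal_submodule R K_module {v \<in> carrier K_module. order_coord c v = 0}"
    using kernel_order_coord_maximal c(1) ab' by simp
  moreover have "N \<subseteq> {v \<in> carrier K_module. order_coord c v = 0}" using c(2) NK by auto
  ultimately have "N = {v \<in> carrier K_module. order_coord c v = 0}"
    using N unfolding maximal_submodule_def by blast
  then show ?thesis using that c(1) by blast
qed

lemma module_rad_K_module: "module_rad R K_module = K_rad"
proof -
  have "{N. maximal_submodule R K_module N} = (\<lambda>c. {v \<in> carrier K_module. order_coord c v = 0}) ` block_pairs"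
    using maximal_submodule_K_module kernel_order_coord_maximal by (auto; blast)
  then show ?thesis by (auto simp: module_rad_def K_rad_def)
qed

lemma first_Loewy_layer_\<Lambda>: "first_Loewy_layer R \<Lambda> = quot_module K_module K_rad"
  unfolding first_Loewy_layer_def module_rad_\<Lambda> Let_def K_module_def[symmetric] module_rad_K_module ..

text \<open>
  The composition that merges \<open>a\<close> and \<open>b\<close> separates this pair from all
  other pairs, since \<open>a \<union> b\<close> is its only block that contains two blocks of
  \<open>Q\<close>.
\<close>
lemma diagonal_module_layer:
  "diagonal_module R (first_Loewy_layer R \<Lambda>) block_pairs (\<lambda>c X. the_elem (order_coord c ` X)) chi_pair"
proof -
  interpret K_module: operator_module R K_module by (rule operator_module_K_module)
  show ?thesis
    unfolding first_Loewy_layer_\<Lambda>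
  proof (rule K_module.diagonal_module_quotient[OF finite_block_pairs])
    fix c :: "nat set \<times> nat set" assume c: "c \<in> block_pairs"
    obtain a b where ab: "c = (a, b)" by (cases c)
    obtain post where w: "[] @ a # b # post \<in> arr" using adjacent_rearrangement c ab by blast
    note w' = adjacent_arr[OF w]
    note sw = block_pairsD[OF c[unfolded ab]]
    let ?T = "[] @ (a \<union> b) # post"
    have only: "d = c" if d: "d \<in> block_pairs" "refines A (merge (fst d) (snd d) (set Q)) (set ?T)" for d
    proof -
      obtain a' b' where ab': "d = (a', b')" by (cases d)
      note sw' = block_pairsD[OF d(1)[unfolded ab']]
      obtain S where S: "S \<in> merge a b (set Q)" "a' \<union> b' \<subseteq> S"
        using d(2) refines_merge_iff[OF partition_Q sw'(1,2)] unfolding w'(3) ab' by auto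
      have sub: "x \<in> {a, b}" if "x \<in> set Q" "x \<subseteq> S" "S = a \<union> b" for x
        using partition_on_disjoint[OF partition_Q that(1) sw(1)] partition_on_disjoint[OF partition_Q that(1) sw(2)]
          set_compositions_block(1)[OF Q_comp that(1)] that by blast
      have eq: "x = S" if "x \<in> set Q" "x \<subseteq> S" "S \<in> set Q" for x
        using partition_on_disjoint[OF partition_Q that(1,3)] set_compositions_block(1)[OF Q_comp that(1)] that by blast
      have "S = a \<union> b"
        using S eq[of a'] eq[of b'] sw' by (auto simp: merge_def)
      then have "a' \<in> {a, b}" "b' \<in> {a, b}" using sub sw' S(2) by auto
      then show ?thesis using sw' sw(4) c d ab ab' by auto
    qed
    fix k
    have "chi_pair c (Poly_Mapping.single ?T k) = k"
      using refines_refl[OF sw(5)] by (simp add: ab chi_single w'(3)[simplified])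
    moreover have "chi_pair d (Poly_Mapping.single ?T k) = 0" if "d \<in> block_pairs - {c}" for d
      using only[of d] that by (cases d) (auto simp: chi_single)
    ultimately show "\<exists>t\<in>carrier R. chi_pair c t = k \<and> (\<forall>d\<in>block_pairs - {c}. chi_pair d t = 0)"
      using single_in_comp_algebra[OF w'(2)] by blast
  next
    fix c assume c: "c \<in> block_pairs"
    then show "\<exists>x\<in>carrier K_module. order_coord c x \<noteq> 0"
      using kernel_order_coord_maximal[of "fst c" "snd c"] unfolding maximal_submodule_def by auto
  qed (auto simp: order_coord_add K_rad_def order_coord_act)
qed

text \<open>
  The characters that occur in the layer belong to the partitions covering that of \<open>Q\<close>,
  each once.
\<close>
theorem multiplicity_layer:
  assumes P: "P \<in> set_compositions A"
  shows "multiplicity_in R (M_module A P) (first_Loewy_layer R \<Lambda>) =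
    (if \<exists>a\<in>set Q. \<exists>b\<in>set Q. a \<noteq> b \<and> set P = merge a b (set Q) then 1 else 0)"
proof -
  interpret P: principal_module F A P using finite_A P by unfold_locales
  interpret L: diagonal_module R "first_Loewy_layer R \<Lambda>" block_pairs "\<lambda>c X. the_elem (order_coord c ` X)" chi_pair
    by (rule diagonal_module_layer)
  have eq: "set P = merge a b (set Q)"
    if "(a, b) \<in> block_pairs" "\<forall>r\<in>carrier R. chi A (set P) r = 0 \<longleftrightarrow> chi A (merge a b (set Q)) r = (0 :: 'f)" for a b
    using chi_determines_partition[OF finite_A P.partition_Q block_pairsD(5)[OF that(1)] that(2)] .
  have "multiplicity_in R (M_module A P) (first_Loewy_layer R \<Lambda>) =
      (if \<exists>c\<in>block_pairs. \<forall>r\<in>carrier R. chi A (set P) r = chi_pair c r then 1 else 0)"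
    using eq by (intro L.multiplicity_diagonal P.operator_module_M P.M_module_iso) auto
  moreover have "(\<exists>c\<in>block_pairs. \<forall>r\<in>carrier R. chi A (set P) r = chi_pair c r) \<longleftrightarrow>
      (\<exists>a\<in>set Q. \<exists>b\<in>set Q. a \<noteq> b \<and> set P = merge a b (set Q))"
  proof
    assume "\<exists>c\<in>block_pairs. \<forall>r\<in>carrier R. chi A (set P) r = chi_pair c r"
    then obtain a b where ab: "(a, b) \<in> block_pairs" "\<forall>r\<in>carrier R. chi A (set P) r = chi A (merge a b (set Q)) r"
      by auto
    then have "set P = merge a b (set Q)" by (intro eq) auto
    then show "\<exists>a\<in>set Q. \<exists>b\<in>set Q. a \<noteq> b \<and> set P = merge a b (set Q)" using block_pairsD[OF ab(1)] by blast
  next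
    assume "\<exists>a\<in>set Q. \<exists>b\<in>set Q. a \<noteq> b \<and> set P = merge a b (set Q)"
    then obtain a b where ab: "a \<in> set Q" "b \<in> set Q" "a \<noteq> b" "set P = merge a b (set Q)" by blast
    have "merge b a (set Q) = merge a b (set Q)" by (auto simp: merge_def)
    moreover have "(a, b) \<in> block_pairs \<or> (b, a) \<in> block_pairs"
      using before_total[OF distinct_Q ab(1-3)] by (simp add: block_pairs_def)
    ultimately obtain c where "c \<in> block_pairs" "chi_pair c = chi A (set P)" using ab(4) by fastforce
    then show "\<exists>c\<in>block_pairs. \<forall>r\<in>carrier R. chi A (set P) r = chi_pair c r" by metis
  qed
  ultimately show ?thesis by simp
qed

end

section \<open>The lattice of set partitions and the quiver\<close>

text \<open>
  Every block of \<open>Y\<close> contains a block of \<open>X\<close>, and different blocks of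
  \<open>Y\<close> contain different ones.
\<close>
lemma card_le_refines:
  assumes "refines A X Y" "finite A"
  shows "card Y \<le> card X"
proof -
  have p: "partition_on A X" "partition_on A Y" using assms(1) by (auto simp: refines_def)
  have "\<exists>x. x \<in> X \<and> x \<subseteq> S" if S: "S \<in> Y" for S
  proof -
    have "S \<noteq> {}" "S \<subseteq> A" using p(2) S by (auto simp: partition_on_def)
    then obtain u where u: "u \<in> S" "u \<in> A" by blast
    then obtain x T where x: "x \<in> X" "u \<in> x" "T \<in> Y" "x \<subseteq> T"
      using p(1) assms(1) unfolding refines_def partition_on_def by blast
    then have "T = S" using partition_on_disjoint[OF p(2), of T S] S u by blast
    then show ?thesis using x by blast
  qed
  then obtain g where g: "\<And>S. S \<in> Y \<Longrightarrow> g S \<in> X \<and> g S \<subseteq> S" by metis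
  have "inj_on g Y"
  proof (rule inj_onI)
    fix S T assume *: "S \<in> Y" "T \<in> Y" "g S = g T"
    have "g S \<noteq> {}" using g[OF *(1)] p(1) by (auto simp: partition_on_def)
    then show "S = T" using partition_on_disjoint[OF p(2) *(1,2)] g[OF *(1)] g[OF *(2)] *(3) by auto
  qed
  moreover have "finite X" using finite_elements assms(2) p(1) by blast
  ultimately show ?thesis using g by (intro card_inj_on_le[of g]) auto
qed

lemma card_merge:
  assumes X: "partition_on A X" "finite A" "a \<in> X" "b \<in> X" "a \<noteq> b"
  shows "card X = card (merge a b X) + 1"
proof -
  have ne: "a \<noteq> {}" "b \<noteq> {}" using X by (auto simp: partition_on_def)
  have "a \<inter> b = {}" using partition_on_disjoint[OF X(1,3,4,5)] .
  then have "a \<union> b \<notin> X"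
    using partition_on_disjoint[OF X(1), of "a \<union> b" a] partition_on_disjoint[OF X(1), of "a \<union> b" b] X(3,4) ne
    by auto
  moreover have "finite X" using finite_elements X(1,2) by blast
  ultimately have "card (merge a b X) = Suc (card X - 2)"
    using X(3-5) by (simp add: merge_def card_Diff_subset)
  moreover have "2 \<le> card X"
    using card_mono[OF \<open>finite X\<close>, of "{a, b}"] X(3-5) by simp
  ultimately show ?thesis by simp
qed

text \<open>
  If no block of \<open>Y\<close> contained two blocks of \<open>X\<close>, the two partitions would
  be equal. So every proper coarsening passes through the merging of two blocks; both descriptions
  of the quiver rest on this.
\<close>
lemma refines_neq_obtains_merge:
  assumes r: "refines A X Y" and "X \<noteq> Y"
  obtains a b where "a \<in> X" "b \<in> X" "a \<noteq> b" "refines A (merge a b X) Y"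
proof -
  have p: "partition_on A X" "partition_on A Y" using r by (auto simp: refines_def)
  have "\<exists>a\<in>X. \<exists>b\<in>X. a \<noteq> b \<and> (\<exists>S\<in>Y. a \<union> b \<subseteq> S)"
  proof (rule ccontr)
    assume no: "\<not> ?thesis"
    have X_Y: "x = S" if x: "x \<in> X" "S \<in> Y" "x \<subseteq> S" for x S
    proof (rule ccontr)
      assume "x \<noteq> S"
      then obtain u where u: "u \<in> S" "u \<notin> x" using x(3) by blast
      then have "u \<in> A" using x(2) p(2) by (auto simp: partition_on_def)
      then obtain y T where y: "y \<in> X" "u \<in> y" "T \<in> Y" "y \<subseteq> T"
        using p(1) r unfolding refines_def partition_on_def by blast
      have "T = S" using partition_on_disjoint[OF p(2) y(3) x(2)] u(1) y by blast
      then show False using no x y u by blast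
    qed
    have "X \<subseteq> Y" using r X_Y unfolding refines_def by blast
    then have "refines A Y X"
      using p unfolding refines_def
    proof (intro conjI ballI)
      fix S assume S: "S \<in> Y"
      then have "S \<noteq> {}" "S \<subseteq> A" using p(2) by (auto simp: partition_on_def)
      then obtain u where u: "u \<in> S" "u \<in> A" by blast
      then obtain x where "x \<in> X" "u \<in> x" using p(1) by (auto simp: partition_on_def)
      then show "\<exists>x\<in>X. S \<subseteq> x"
        using \<open>X \<subseteq> Y\<close> partition_on_disjoint[OF p(2), of x S] S u(1) by blast
    qed
    then show False using refines_asym[OF r] \<open>X \<noteq> Y\<close> by blast
  qed
  then show ?thesis using that refines_merge_iff[OF p(1)] r by blast
qed

lemma card_less_refines:
  assumes "refines A X Y" "X \<noteq> Y" "finite A"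
  shows "card Y < card X"
proof -
  obtain a b where ab: "a \<in> X" "b \<in> X" "a \<noteq> b" "refines A (merge a b X) Y"
    using refines_neq_obtains_merge[OF assms(1,2)] .
  have "partition_on A X" using assms(1) by (simp add: refines_def)
  then show ?thesis using card_le_refines[OF ab(4) assms(3)] card_merge[OF _ assms(3) ab(1-3)] by simp
qed

lemma length_set_composition: "Q \<in> set_compositions A \<Longrightarrow> length Q = card (set Q)"
  by (simp add: set_compositions_def distinct_card)

lemma merge_iff_finer:
  assumes "finite A" "P \<in> set_compositions A" "Q \<in> set_compositions A"
  shows "(\<exists>a\<in>set Q. \<exists>b\<in>set Q. a \<noteq> b \<and> set P = merge a b (set Q)) \<longleftrightarrow>
    finer A Q P \<and> length Q = length P + 1"
proof
  have p: "partition_on A (set Q)" using assms(3) by (simp add: set_compositions_def)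
  {
    assume "\<exists>a\<in>set Q. \<exists>b\<in>set Q. a \<noteq> b \<and> set P = merge a b (set Q)"
    then obtain a b where ab: "a \<in> set Q" "b \<in> set Q" "a \<noteq> b" "set P = merge a b (set Q)" by blast
    then show "finer A Q P \<and> length Q = length P + 1"
      using refines_merge[OF p ab(1,2)] card_merge[OF p assms(1) ab(1-3)] assms(2,3)
      by (simp add: finer_def length_set_composition)
  next
    assume f: "finer A Q P \<and> length Q = length P + 1"
    then have "card (set Q) = card (set P) + 1" using assms(2,3) by (simp add: length_set_composition)
    then have "set Q \<noteq> set P" by auto
    then obtain a b where ab: "a \<in> set Q" "b \<in> set Q" "a \<noteq> b" "refines A (merge a b (set Q)) (set P)"
      using refines_neq_obtains_merge f unfolding finer_def by metis
    have "merge a b (set Q) = set P"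
      using card_less_refines[OF ab(4) _ assms(1)] card_merge[OF p assms(1) ab(1-3)]
        \<open>card (set Q) = card (set P) + 1\<close> by auto
    then show "\<exists>a\<in>set Q. \<exists>b\<in>set Q. a \<noteq> b \<and> set P = merge a b (set Q)" using ab by metis
  }
qed

lemma ordered_compositions_subset: "P \<in> ordered_compositions A \<Longrightarrow> P \<in> set_compositions A"
  by (simp add: ordered_compositions_def)

lemma inj_on_Min:
  assumes "finite (A :: nat set)" "partition_on A X"
  shows "inj_on Min X"
proof (rule inj_onI)
  fix a b assume ab: "a \<in> X" "b \<in> X" "Min a = Min b"
  have "finite c \<and> c \<noteq> {}" if "c \<in> X" for c
    using that assms by (auto simp: partition_on_def intro: finite_subset)
  then have "Min a \<in> a" "Min b \<in> b" using ab(1,2) by simp_all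
  then show "a = b" using partition_on_disjoint[OF assms(2) ab(1,2)] ab(3) by auto
qed

lemma ordered_compositions_eqI:
  assumes "finite A" "P \<in> ordered_compositions A" "Q \<in> ordered_compositions A" "set P = set Q"
  shows "P = Q"
proof -
  have "partition_on A (set P)" using assms(2) by (simp add: ordered_compositions_def set_compositions_def)
  then have "inj_on Min (set P \<union> set Q)" using inj_on_Min assms(1,4) by simp
  moreover have "map Min P = map Min Q"
    using assms(2-4) by (intro strict_sorted_equal) (auto simp: ordered_compositions_def)
  ultimately show ?thesis using map_inj_on by blast
qed

text \<open>
  Sort the blocks by their minima.
\<close>
lemma ordered_representative:
  assumes "finite A" "P \<in> set_compositions A"
  obtains Q where "Q \<in> ordered_compositions A" "mset Q = mset P"
proof
  let ?Q = "sort_key Min P"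
  have Q: "?Q \<in> set_compositions A" using assms(2) by (simp add: set_compositions_def)
  have "distinct (map Min ?Q)"
    using inj_on_Min[OF assms(1), of "set P"] assms(2) by (simp add: set_compositions_def distinct_map)
  then have "sorted_wrt (<) (map Min ?Q)" by (simp add: strict_sorted_iff)
  then show "?Q \<in> ordered_compositions A" using Q by (simp add: ordered_compositions_def)
qed simp

definition rearr_class :: "nat set \<Rightarrow> nat set list \<Rightarrow> nat set list set" where
  "rearr_class A Q = rearrangement_rel A `` {Q}"

lemma mem_rearr_class: "Q \<in> set_compositions A \<Longrightarrow>
  P \<in> rearr_class A Q \<longleftrightarrow> P \<in> set_compositions A \<and> set P = set Q"
  using set_eq_iff_mset_eq_distinct[of P Q]
  by (auto simp: rearr_class_def rearrangement_rel_def set_compositions_def)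

lemma rearr_class_eq_iff:
  assumes "P \<in> set_compositions A" "Q \<in> set_compositions A"
  shows "rearr_class A P = rearr_class A Q \<longleftrightarrow> set P = set Q"
  using mem_rearr_class[OF assms(1)] mem_rearr_class[OF assms(2)] assms by auto

lemma carrier_support_lattice:
  assumes "finite A"
  shows "carrier (support_lattice A) = rearr_class A ` ordered_compositions A"
proof
  show "rearr_class A ` ordered_compositions A \<subseteq> carrier (support_lattice A)"
    using ordered_compositions_subset by (auto simp: support_lattice_def rearr_class_def intro: quotientI)
  show "carrier (support_lattice A) \<subseteq> rearr_class A ` ordered_compositions A"
  proof
    fix X assume "X \<in> carrier (support_lattice A)"
    then obtain P where P: "P \<in> set_compositions A" "X = rearr_class A P"
      by (auto simp: support_lattice_def rearr_class_def elim: quotientE)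
    obtain Q where Q: "Q \<in> ordered_compositions A" "mset Q = mset P"
      using ordered_representative[OF assms P(1)] .
    then have "rearr_class A P = rearr_class A Q"
      using rearr_class_eq_iff[OF P(1) ordered_compositions_subset[OF Q(1)]] mset_eq_setD by metis
    then show "X \<in> rearr_class A ` ordered_compositions A" using P(2) Q(1) by blast
  qed
qed

lemma less_support_lattice:
  assumes "P \<in> set_compositions A" "Q \<in> set_compositions A"
  shows "rearr_class A Q \<sqsubset>\<^bsub>support_lattice A\<^esub> rearr_class A P \<longleftrightarrow> finer A Q P \<and> set Q \<noteq> set P"
proof -
  have "(\<exists>Q'\<in>rearr_class A Q. \<exists>P'\<in>rearr_class A P. finer A Q' P') \<longleftrightarrow> finer A Q P"
    using assms by (auto simp: mem_rearr_class finer_def)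
  then show ?thesis
    using rearr_class_eq_iff[OF assms(2,1)] by (simp add: support_lattice_def lless_def)
qed

text \<open>
  An intermediate partition would have an intermediate number of blocks; conversely, if the numbers
  of blocks differ by more than one, merging two blocks yields an intermediate partition.
\<close>
lemma covers_support_lattice:
  assumes "finite A" "P \<in> ordered_compositions A" "Q \<in> ordered_compositions A"
  shows "(rearr_class A P, rearr_class A Q) \<in> arcs (hasse_diagram (support_lattice A)) \<longleftrightarrow>
    finer A Q P \<and> length Q = length P + 1" (is "?L \<longleftrightarrow> ?R")
proof -
  note PQ = ordered_compositions_subset[OF assms(2)] ordered_compositions_subset[OF assms(3)]
  have less: "rearr_class A S \<sqsubset>\<^bsub>support_lattice A\<^esub> rearr_class A T \<longleftrightarrow> finer A S T \<and> set S \<noteq> set T"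
    if "S \<in> ordered_compositions A" "T \<in> ordered_compositions A" for S T
    using less_support_lattice that ordered_compositions_subset by blast
  have L: "?L \<longleftrightarrow> finer A Q P \<and> set Q \<noteq> set P \<and>
      \<not> (\<exists>T\<in>ordered_compositions A. finer A Q T \<and> set Q \<noteq> set T \<and> finer A T P \<and> set T \<noteq> set P)"
    using assms(2,3)
    by (simp add: hasse_diagram_def carrier_support_lattice[OF assms(1)] less cong: conj_cong bex_cong)
      blast
  show ?thesis
  proof
    assume ?R
    then have card: "card (set Q) = card (set P) + 1" using PQ by (simp add: length_set_composition)
    have "\<not> (finer A Q T \<and> set Q \<noteq> set T \<and> finer A T P \<and> set T \<noteq> set P)" for T
    proof
      assume "finer A Q T \<and> set Q \<noteq> set T \<and> finer A T P \<and> set T \<noteq> set P"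
      then have "card (set T) < card (set Q)" "card (set P) < card (set T)"
        using card_less_refines[OF _ _ assms(1)] unfolding finer_def by blast+
      then show False using card by simp
    qed
    then show ?L using L \<open>?R\<close> card by auto
  next
    assume ?L
    then have cov: "finer A Q P" "set Q \<noteq> set P"
      "\<And>T. \<lbrakk>T \<in> ordered_compositions A; finer A Q T; set Q \<noteq> set T; finer A T P\<rbrakk> \<Longrightarrow> set T = set P"
      using L by blast+
    have p: "partition_on A (set Q)" using PQ by (simp add: set_compositions_def)
    obtain a b where ab: "a \<in> set Q" "b \<in> set Q" "a \<noteq> b" "refines A (merge a b (set Q)) (set P)"
      using refines_neq_obtains_merge cov(1,2) unfolding finer_def by metis
    obtain T' where T': "T' \<in> set_compositions A" "set T' = merge a b (set Q)"
      using composition_of_partition[OF assms(1) partition_on_merge[OF p ab(1,2)]] .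
    obtain T where T: "T \<in> ordered_compositions A" "mset T = mset T'"
      using ordered_representative[OF assms(1) T'(1)] .
    have set: "set T = merge a b (set Q)" using mset_eq_setD[OF T(2)] T'(2) by simp
    have "set Q \<noteq> set T" using card_merge[OF p assms(1) ab(1-3)] set by auto
    then have "set T = set P"
      using refines_merge[OF p ab(1,2)] ab(4) set by (intro cov(3) T(1)) (simp_all add: finer_def)
    then show ?R using merge_iff_finer[OF assms(1) PQ] ab set by metis
  qed
qed

lemma wf_ordered_composition_digraph: "wf_digraph (ordered_composition_digraph A)"
  by (auto simp: wf_digraph_def ordered_composition_digraph_def)

lemma hasse_diagram_support_lattice:
  assumes "finite A"
  shows "\<exists>h. pre_digraph.digraph_isomorphism (ordered_composition_digraph A) h \<and>
    hasse_diagram (support_lattice A) = app_iso h (ordered_composition_digraph A)"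
proof -
  let ?h = "\<lparr>iso_verts = rearr_class A, iso_arcs = \<lambda>(P, Q). (rearr_class A P, rearr_class A Q),
    iso_head = snd, iso_tail = fst\<rparr>"
  let ?O = "ordered_composition_digraph A"
  have inj: "P = Q" if "P \<in> ordered_compositions A" "Q \<in> ordered_compositions A"
    "rearr_class A P = rearr_class A Q" for P Q
    using that rearr_class_eq_iff ordered_compositions_subset ordered_compositions_eqI[OF assms] by metis
  have "pre_digraph.digraph_isomorphism ?O ?h"
    unfolding pre_digraph.digraph_isomorphism_def using wf_ordered_composition_digraph inj
    by (auto simp: ordered_composition_digraph_def inj_on_def)
  moreover have "arcs (hasse_diagram (support_lattice A)) = iso_arcs ?h ` arcs ?O"
  proof -
    have "x \<in> rearr_class A ` ordered_compositions A \<and> y \<in> rearr_class A ` ordered_compositions A"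
      if "(x, y) \<in> arcs (hasse_diagram (support_lattice A))" for x y
      using that carrier_support_lattice[OF assms] by (auto simp: hasse_diagram_def)
    then show ?thesis
      using covers_support_lattice[OF assms]
      by (fastforce simp: ordered_composition_digraph_def image_iff)
  qed
  then have "hasse_diagram (support_lattice A) = app_iso ?h ?O"
    by (intro pre_digraph.equality)
      (auto simp: ordered_composition_digraph_def hasse_diagram_def carrier_support_lattice[OF assms])
  ultimately show ?thesis by blast
qed

text \<open>
  The vertices of the quiver are modules, not isomorphism classes; they are nevertheless different,
  since not even isomorphic, for different ordered compositions.
\<close>
lemma M_module_inject:
  fixes F :: "'f::field itself"
  assumes "finite A" "P \<in> ordered_compositions A" "Q \<in> ordered_compositions A"
    "(M_module A P :: ('f combination, 'f combination set) module) = M_module A Q"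
  shows "P = Q"
proof -
  interpret P: principal_module F A P
    using assms(1,2) by unfold_locales (auto intro: ordered_compositions_subset)
  interpret Q: principal_module F A Q
    using assms(1,3) by unfold_locales (auto intro: ordered_compositions_subset)
  have "\<forall>r\<in>carrier (comp_algebra A). chi A (set P) r = 0 \<longleftrightarrow> chi A (set Q) r = (0 :: 'f)"
    using module_iso_char_annihilator[OF P.operator_module_M P.M_module_iso]
      module_iso_char_annihilator[OF Q.operator_module_M Q.M_module_iso] assms(4) by simp
  then have "set P = set Q"
    using chi_determines_partition[OF assms(1) P.partition_Q Q.partition_Q] by blast
  then show ?thesis using ordered_compositions_eqI assms by blast
qed

lemma number_of_arrows:
  fixes F :: "'f::field itself"
  assumes "finite A" "P \<in> ordered_compositions A" "Q \<in> ordered_compositions A"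
  shows "multiplicity_in (comp_algebra A :: ('f combination, 'f combination) module) (M_module A P)
      (first_Loewy_layer (comp_algebra A) (Lambda_module A Q)) =
    (if finer A Q P \<and> length Q = length P + 1 then 1 else 0)"
proof -
  note PQ = ordered_compositions_subset[OF assms(2)] ordered_compositions_subset[OF assms(3)]
  interpret Q: principal_module F A Q using assms(1) PQ(2) by unfold_locales
  show ?thesis
    using Q.multiplicity_layer[OF PQ(1)] merge_iff_finer[OF assms(1) PQ] by simp
qed

lemma digraph_iso_app_iso:
  assumes "wf_digraph G" "pre_digraph.digraph_isomorphism G h" "pre_digraph.digraph_isomorphism G k"
  shows "digraph_iso (app_iso h G) (app_iso k G)"
  using digraph_iso_trans digraph_iso_swap assms unfolding digraph_iso_def by metis

theorem theorem8p1:
  fixes F :: "'f::field itself" and A :: "nat set"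
  assumes "finite A" and "0 \<notin> A"
  shows "digraph_iso (ext_quiver F A) (hasse_diagram (support_lattice A)) \<and>
    (\<exists>h. pre_digraph.digraph_isomorphism (ordered_composition_digraph A) h \<and>
         (\<forall>Q\<in>ordered_compositions A. iso_verts h Q = M_module A Q) \<and>
         ext_quiver F A = app_iso h (ordered_composition_digraph A))"
proof -
  let ?O = "ordered_composition_digraph A"
  let ?M = "M_module A :: nat set list \<Rightarrow> ('f combination, 'f combination set) module"
  let ?h = "\<lparr>iso_verts = ?M, iso_arcs = \<lambda>(P, Q). (?M P, ?M Q, 0 :: nat),
    iso_head = \<lambda>a. fst (snd a), iso_tail = fst\<rparr>"
  have iso: "pre_digraph.digraph_isomorphism ?O ?h"
    unfolding pre_digraph.digraph_isomorphism_def
    using wf_ordered_composition_digraph M_module_inject[OF assms(1)]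
    by (auto simp: ordered_composition_digraph_def inj_on_def)
  have eq: "ext_quiver F A = app_iso ?h ?O"
  proof (intro pre_digraph.equality)
    show "arcs (ext_quiver F A) = arcs (app_iso ?h ?O)"
    proof (intro equalityI subsetI)
      fix x assume "x \<in> arcs (ext_quiver F A)"
      then obtain P Q i where x: "x = (?M P, ?M Q, i)" "P \<in> ordered_compositions A" "Q \<in> ordered_compositions A"
        "i < multiplicity_in (comp_algebra A :: ('f combination, 'f combination) module) (M_module A P)
           (first_Loewy_layer (comp_algebra A) (Lambda_module A Q))"
        by (auto simp: ext_quiver_def)
      then have "i = 0" "(P, Q) \<in> arcs ?O"
        using number_of_arrows[where 'f = 'f, OF assms(1) x(2,3)]
        by (auto simp: ordered_composition_digraph_def split: if_splits)
      then show "x \<in> arcs (app_iso ?h ?O)" using x(1) by (auto intro!: image_eqI[of _ _ "(P, Q)"])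
    next
      fix x assume "x \<in> arcs (app_iso ?h ?O)"
      then obtain P Q where x: "x = (?M P, ?M Q, 0)" "P \<in> ordered_compositions A" "Q \<in> ordered_compositions A"
        "finer A Q P \<and> length Q = length P + 1"
        by (auto simp: ordered_composition_digraph_def)
      then have "0 < multiplicity_in (comp_algebra A :: ('f combination, 'f combination) module) (M_module A P)
           (first_Loewy_layer (comp_algebra A) (Lambda_module A Q))"
        using number_of_arrows[where 'f = 'f, OF assms(1) x(2,3)] by simp
      then show "x \<in> arcs (ext_quiver F A)" using x(1-3) by (auto simp: ext_quiver_def)
    qed
  qed (auto simp: ext_quiver_def ordered_composition_digraph_def)
  obtain k where k: "pre_digraph.digraph_isomorphism ?O k"
    "hasse_diagram (support_lattice A) = app_iso k ?O"
    using hasse_diagram_support_lattice[OF assms(1)] by blast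
  have "digraph_iso (ext_quiver F A) (hasse_diagram (support_lattice A))"
    unfolding eq k(2) using wf_ordered_composition_digraph iso k(1) by (rule digraph_iso_app_iso)
  then show ?thesis using iso eq by (intro conjI exI[of _ ?h]) simp_all
qed

end
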